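(* Let $\mathcal A$, $I[\lambda]$, $J[\lambda]$ be the class of admissible functions and the two functionals defined in the context. For given $q$, let $J_{\min}(q)$ and $J_{\max}(q)$ denote, respectively, the global minimum and the global maximum of $J[\lambda]$ over all $\lambda\in\mathcal A$ with $I[\lambda]=q$. Put $q_{\max}=1/e$ and $q_*=\frac{3}{4e}$. 1) The function $J_{\min}(q)$, $q\in(0,q_{\max})$, is defined by the parametric equations $$q=q(b)=\tfrac12\Big[b^2-k^2+k(b-a)-k^2\log\tfrac{b}{a}\Big],\qquad J_{\min}=\sqrt2\,\Big(k\log\tfrac{b}{a}+b+k\Big),$$ with parameter $b\in(\sqrt{2/e},\sqrt2)$, where $$k=-\frac{(e-1)\,b\,(b^2e-2)}{2+(e-2)b^2e},\qquad a=\frac{b^2e-2}{(e-1)b}.$$ (That is, $q(b)$ takes all values in $(0,q_{\max})$ and no others as $b$ runs over $(\sqrt{2/e},\sqrt2)$, and $J_{\min}(q(b))$ equals the stated expression for every such $b$.) For $q=q(b)$ the global minimum is achieved by the function $$\lambda(\sigma)=\begin{cases}\sqrt{2\sigma}, & 0\le\sigma<\gamma,\\ -k+\sqrt{2c(\sigma-\gamma)+(a+k)^2}, & \gamma\le\sigma\le1,\end{cases}\qquad c=\frac{2-b^2}{2+(e-2)b^2e},\quad \gamma=\frac{a^2}{2}.$$ 2) The function $J_{\max}(q)$, $q\in(0,q_{\max}]$, is defined by the parametric equations $$q=q(b)=\tfrac12\Big[b^2+kb-k^2\log\tfrac{b+k}{k}\Big],\qquad J_{\max}=\sqrt2\,\Big(k\log\tfrac{b+k}{k}+b\Big),\qquad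 k=-\frac{b(b^2e-2)}{2(b^2e-1)},$$ with parameter $b\in(0,\sqrt{2/e}]$, in the same sense as in part 1), where at $b=\sqrt{1/e}$ and at $b=\sqrt{2/e}$ (where $k$ is infinite, respectively zero) the expressions are understood as their limits, namely $q=q_*$, $J_{\max}=2\sqrt{2/e}$ at $b=\sqrt{1/e}$, and $q=q_{\max}$, $J_{\max}=2/\sqrt e$ at $b=\sqrt{2/e}$. The values $b\in(0,\sqrt{1/e})$ correspond to $q\in(0,q_* )$ and the values $b\in(\sqrt{1/e},\sqrt{2/e}]$ correspond to $q\in(q_*,q_{\max}]$. With $c=\frac{b^2}{2(b^2e-1)}$, the global maximum is achieved by the functions $$\lambda(\sigma)=-k-\sqrt{2c\sigma+k^2}\quad\text{for } q=q(b)\in(0,q_* ),\ b\in(0,\sqrt{1/e}),$$ $$\lambda(\sigma)=\sigma/\sqrt e\quad\text{for } q=q_*,$$ $$\lambda(\sigma)=-k+\sqrt{2c\sigma+k^2}\quad\text{for } q=q(b)\in(q_*,q_{\max}],\ b\in(\sqrt{1/e},\sqrt{2/e}].$$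
   Context: Here $e$ is the base of natural logarithms and $\log$ is the natural logarithm. The class $\mathcal A$ of admissible functions consists of all absolutely continuous $\lambda:[0,1]\to\mathbb R$ with $$\lambda(0)=0,\qquad \lambda'(\sigma)\ge0,\qquad \lambda(\sigma)\lambda'(\sigma)\le1\quad\text{for a.e. }\sigma\in[0,1].$$ (Equivalently, $\lambda(\sigma)=\sqrt{2\int_0^\sigma u(\sigma_1)\,d\sigma_1}$ for a measurable $u:[0,1]\to[0,1]$, and then $u=\lambda\lambda'$ a.e.) The functionals are $$I[\lambda]=-\int_0^1\lambda\lambda'\log(\lambda\lambda')\,d\sigma,\qquad J[\lambda]=-\sqrt2\int_0^1\lambda'\log(\lambda\lambda')\,d\sigma,$$ where the integrands are taken to be $0$ at points where $\lambda'=0$. *)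

theory Defs
  imports "HOL-Analysis.Analysis"
begin

definition absolutely_continuous_on :: "real set \<Rightarrow> (real \<Rightarrow> real) \<Rightarrow> bool" where
  "absolutely_continuous_on S f \<longleftrightarrow>
     (\<forall>\<epsilon>>0. \<exists>\<delta>>0. \<forall>D. D division_of \<Union>D \<and> \<Union>D \<subseteq> S \<and> (\<Sum>K\<in>D. measure lborel K) < \<delta> \<longrightarrow>
        (\<Sum>K\<in>D. \<bar>f (Sup K) - f (Inf K)\<bar>) < \<epsilon>)"

text \<open>Only the restriction to \<open>{0..1}\<close> matters. Since \<open>deriv\<close> is total, existence of the
  derivative is part of the almost-everywhere condition.\<close>

definition admissible :: "(real \<Rightarrow> real) set" where
  "admissible = {f. absolutely_continuous_on {0..1} f \<and> f 0 = 0 \<and>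
     (AE \<sigma> in lebesgue_on {0..1}.
        f differentiable (at \<sigma>) \<and> 0 \<le> deriv f \<sigma> \<and> f \<sigma> * deriv f \<sigma> \<le> 1)}"

text \<open>Where the derivative vanishes, both integrands are \<open>0\<close> because of the factor in front
  of the logarithm. For admissible functions both integrands are nonpositive almost
  everywhere and integrable: writing \<open>u = f f'\<close>, one has
  \<open>- u ln u \<le> 1/e\<close>, and with \<open>v = f\<^sup>2 / 2\<close> as variable and \<open>\<sigma>' = d\<sigma>/dv = 1/u\<close> the second
  functional is the integral of \<open>v powr (-1/2) * ln \<sigma>'\<close>, which Young's inequality bounds by
  \<open>2 * (sqrt \<sigma>' + y ln y - y)\<close> with \<open>y = v powr (-1/2)\<close>. So the Bochner integrals below
  never take their default value.\<close>

definition I_fun :: "(real \<Rightarrow> real) \<Rightarrow> real" where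
  "I_fun f = - (LINT \<sigma>:{0..1}|lebesgue. f \<sigma> * deriv f \<sigma> * ln (f \<sigma> * deriv f \<sigma>))"

definition J_fun :: "(real \<Rightarrow> real) \<Rightarrow> real" where
  "J_fun f = - sqrt 2 * (LINT \<sigma>:{0..1}|lebesgue. deriv f \<sigma> * ln (f \<sigma> * deriv f \<sigma>))"

definition level :: "real \<Rightarrow> (real \<Rightarrow> real) set" where
  "level q = {f \<in> admissible. I_fun f = q}"

text \<open>\<open>LEAST\<close> and \<open>GREATEST\<close> are meaningful only where the extremum is attained.\<close>

definition J_min :: "real \<Rightarrow> real" where
  "J_min q = (LEAST v. v \<in> J_fun ` level q)"

definition J_max :: "real \<Rightarrow> real" where
  "J_max q = (GREATEST v. v \<in> J_fun ` level q)"

abbreviation e :: real where "e \<equiv> exp 1"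

definition q_max :: real where "q_max = 1 / e"

definition q_star :: real where "q_star = 3 / (4 * e)"

subsection \<open>Parametrization of the minimum\<close>

definition k_lo :: "real \<Rightarrow> real" where
  "k_lo b = - ((e - 1) * b * (b\<^sup>2 * e - 2) / (2 + (e - 2) * b\<^sup>2 * e))"

definition a_lo :: "real \<Rightarrow> real" where
  "a_lo b = (b\<^sup>2 * e - 2) / ((e - 1) * b)"

definition c_lo :: "real \<Rightarrow> real" where
  "c_lo b = (2 - b\<^sup>2) / (2 + (e - 2) * b\<^sup>2 * e)"

definition \<gamma>_lo :: "real \<Rightarrow> real" where
  "\<gamma>_lo b = (a_lo b)\<^sup>2 / 2"

definition q_lo :: "real \<Rightarrow> real" where
  "q_lo b = (let k = k_lo b; a = a_lo b in
     (b\<^sup>2 - k\<^sup>2 + k * (b - a) - k\<^sup>2 * ln (b / a)) / 2)"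

definition J_lo :: "real \<Rightarrow> real" where
  "J_lo b = (let k = k_lo b; a = a_lo b in sqrt 2 * (k * ln (b / a) + b + k))"

definition lam_lo :: "real \<Rightarrow> real \<Rightarrow> real" where
  "lam_lo b \<sigma> = (let k = k_lo b; a = a_lo b; c = c_lo b; \<gamma> = \<gamma>_lo b in
     if \<sigma> < \<gamma> then sqrt (2 * \<sigma>) else - k + sqrt (2 * c * (\<sigma> - \<gamma>) + (a + k)\<^sup>2))"

subsection \<open>Parametrization of the maximum\<close>

definition k_up :: "real \<Rightarrow> real" where
  "k_up b = - (b * (b\<^sup>2 * e - 2) / (2 * (b\<^sup>2 * e - 1)))"

definition c_up :: "real \<Rightarrow> real" where
  "c_up b = b\<^sup>2 / (2 * (b\<^sup>2 * e - 1))"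

definition q_up_formula :: "real \<Rightarrow> real" where
  "q_up_formula b = (let k = k_up b in (b\<^sup>2 + k * b - k\<^sup>2 * ln ((b + k) / k)) / 2)"

definition J_up_formula :: "real \<Rightarrow> real" where
  "J_up_formula b = (let k = k_up b in sqrt 2 * (k * ln ((b + k) / k) + b))"

text \<open>The formulas are singular at \<open>b = sqrt (1 / e)\<close>, where the denominator of \<open>k_up\<close> vanishes,
  and at \<open>b = sqrt (2 / e)\<close>, where \<open>k_up\<close> itself vanishes; the values inserted there are the
  limits of the formulas.\<close>

definition q_up :: "real \<Rightarrow> real" where
  "q_up b = (if b = sqrt (1 / e) then q_star else if b = sqrt (2 / e) then q_max
     else q_up_formula b)"

definition J_up :: "real \<Rightarrow> real" where
  "J_up b = (if b = sqrt (1 / e) then 2 * sqrt (2 / e) else if b = sqrt (2 / e) then 2 / sqrt e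
     else J_up_formula b)"

definition lam_up :: "real \<Rightarrow> real \<Rightarrow> real" where
  "lam_up b \<sigma> = (let k = k_up b; c = c_up b in
     if b < sqrt (1 / e) then - k - sqrt (2 * c * \<sigma> + k\<^sup>2)
     else if b = sqrt (1 / e) then \<sigma> / sqrt e
     else - k + sqrt (2 * c * \<sigma> + k\<^sup>2))"

end

theory Submission
  imports Defs "HOL-Real_Asymp.Real_Asymp"
begin

text \<open>Both extremal problems are solved by Lagrangian duality. Write \<open>p = f'\<close> and
  \<open>w = - ln (f p) \<ge> 0\<close>, so that \<open>I_fun f\<close> and \<open>J_fun f / sqrt 2\<close> are the integrals of
  \<open>f p w\<close> and \<open>p w\<close>. If \<open>(\<alpha> + \<beta> x) p w \<le> \<nu> + \<phi> x p\<close> holds pointwise whenever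
  \<open>x p = exp (- w) \<le> 1\<close>, then integrating along \<open>f\<close> gives
  \<open>\<alpha> J_fun f / sqrt 2 + \<beta> I_fun f \<le> \<nu> + (\<Phi> (f 1) - \<Phi> 0)\<close> with \<open>\<Phi>' = \<phi>\<close>.

  For the maximum, \<open>\<phi>\<close> is the best possible choice \<open>y (ln (y / (\<nu> x)) - 1)\<close> with
  \<open>y = 1 + x / k\<close>; it is nonnegative exactly up to \<open>x = b\<close>, and the candidate attains equality.

  For the minimum, put \<open>\<kappa> = - k > 0\<close>, \<open>\<alpha> = - \<kappa>\<close> and \<open>\<beta> = 1\<close>. Below \<open>x = a\<close> the constraint \<open>w \<ge> 0\<close> is active and
  \<open>\<phi> x = - c x\<close>. With \<open>c\<close> fixed, \<open>\<Phi>\<close> would have a minimum, not a maximum, at \<open>b\<close>. Hence \<open>c\<close> is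
  chosen as the function \<open>c = (1 - \<kappa> / x) / e\<close> of the end point \<open>x = f 1\<close>; the resulting bound is
  an explicit function of \<open>x\<close> that is unimodal with its maximum at \<open>b\<close>.\<close>

section \<open>Absolutely continuous functions\<close>

text \<open>The pointwise inequalities are Legendre transforms. In the variable \<open>x = f\<close>
  the functionals integrate \<open>x w\<close> and \<open>w\<close> over \<open>x\<close>, and
  elapsed time is the integral of \<open>x exp w\<close>. Pricing time at \<open>\<nu>\<close>
  leaves, at each \<open>x\<close> separately, the maximization over \<open>w\<close> of
  \<open>y w - \<nu> x exp w\<close>, with \<open>y\<close> the weight. The maximizer is
  \<open>exp w = y / (\<nu> x)\<close> and the value is \<open>\<phi> x\<close>; multiplying by
  \<open>p\<close> and using \<open>x p exp w = 1\<close> returns the inequality. A free end point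
  forces \<open>\<phi> b = 0\<close>, that is \<open>w = 1\<close> there, and total time 1 fixes
  \<open>\<nu>\<close>. For the minimum, \<open>w\<close> increases with \<open>x\<close>, so
  \<open>\<phi>\<close> turns from negative to positive where \<open>w = 1\<close>. Every
  \<open>c\<close> in (0, 1) yields a bound; prescribing \<open>w = 1\<close> at
  \<open>x = f 1\<close> agrees with the candidate when \<open>f 1 = b\<close> and makes the
  logarithms collapse. The analytic obstacle is that \<open>\<phi>\<close> may grow like
  \<open>- ln x\<close> at 0, so \<open>\<Phi>\<close> is not Lipschitz near the zeros of
  \<open>f\<close>. The chain rule is integrated away from them and extended by monotone
  convergence, which \<open>f f' \<le> 1\<close> makes available.\<close>

lemma negligible_open_cover:
  fixes N :: "real set"
  assumes "negligible N" "0 < \<delta>"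
  obtains U where "open U" "N \<subseteq> U" "U \<in> lmeasurable" "measure lebesgue U < \<delta>"
proof -
  have N: "N \<in> lmeasurable" "measure lebesgue N = 0"
    using assms(1) negligible_iff_measure by blast+
  then have "N \<in> sets lebesgue" by (simp add: fmeasurableD)
  then obtain U where "open U" "N \<subseteq> U" "U - N \<in> lmeasurable" "emeasure lebesgue (U - N) < ennreal \<delta>"
    using sets_lebesgue_outer_open[OF _ assms(2)] by metis
  moreover have U: "U = N \<union> (U - N)" using \<open>N \<subseteq> U\<close> by auto
  moreover have "U \<in> lmeasurable" using N(1) calculation(3) U by (metis fmeasurable.Un)
  moreover have "measure lebesgue (U - N) < \<delta>"
    using calculation(3,4) by (simp add: emeasure_eq_measure2 ennreal_less_iff assms(2) less_imp_le)
  moreover have "measure lebesgue U \<le> measure lebesgue N + measure lebesgue (U - N)"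
    using N calculation(3) U by (metis fmeasurableD measure_Un_le)
  ultimately show thesis using N that by fastforce
qed

lemma measure_lborel_division_le:
  fixes D :: "real set set"
  assumes "D division_of \<Union>D" "\<Union>D \<subseteq> U" "U \<in> lmeasurable"
  shows "(\<Sum>K\<in>D. measure lborel K) \<le> measure lebesgue U"
proof -
  have "(\<Sum>K\<in>D. measure lborel K) = measure lebesgue (\<Union>D)"
  proof -
    have "measure lborel K = measure lebesgue K" if "K \<in> D" for K
      using division_ofD(4)[OF assms(1) that] by (metis borel_closed closed_cbox measure_completion sets_lborel)
    then show ?thesis using content_division[OF assms(1)] by simp
  qed
  also have "\<dots> \<le> measure lebesgue U"
    using assms lmeasurable_division[OF assms(1)] measure_mono_fmeasurable
    by (metis fmeasurableD)
  finally show ?thesis .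
qed

text \<open>Riemann sums over a fine tagged division split into two parts: the tags in \<open>N\<close> lie in an
  open set so small that absolute continuity controls the increments of \<open>f\<close> there.\<close>

lemma absolutely_continuous_FTC:
  fixes f f' :: "real \<Rightarrow> real"
  assumes ac: "absolutely_continuous_on S f" and S: "{a..b} \<subseteq> S" and "a \<le> b"
    and N: "negligible N"
    and der: "\<And>x. x \<in> {a..b} - N \<Longrightarrow> (f has_real_derivative f' x) (at x within {a..b})"
  shows "(f' has_integral (f b - f a)) {a..b}"
proof -
  \<comment> \<open>\<open>f'\<close> carries no information on \<open>N\<close>; with
    \<open>g = 0\<close> there, a tag in \<open>N\<close> leaves only the increment of
    \<open>f\<close> to be estimated.\<close>
  define g where "g x = (if x \<in> N then 0 else f' x)" for x
  have "(g has_integral (f b - f a)) {a..b}"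
    unfolding has_integral_real
  proof (intro allI impI)
    fix \<epsilon> :: real assume "\<epsilon> > 0"
    \<comment> \<open>The \<open>+ 1\<close> keeps the denominator positive when
      \<open>a = b\<close>.\<close>
    define \<eta> where "\<eta> = \<epsilon> / (2 * (b - a + 1))"
    have "\<eta> > 0" using \<open>\<epsilon> > 0\<close> \<open>a \<le> b\<close> by (simp add: \<eta>_def)
    have "\<forall>x. \<exists>d>0. x \<in> {a..b} - N \<longrightarrow>
         (\<forall>y\<in>{a..b}. norm (y-x) < d \<longrightarrow> norm (f y - f x - (y-x) * f' x) \<le> \<eta> * norm (y-x))"
      using der[unfolded has_field_derivative_def has_derivative_within_alt] \<open>\<eta> > 0\<close>
      by (metis mult.commute zero_less_one)
    then obtain d where d: "\<And>x. 0 < d x"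
      "\<And>x y. \<lbrakk>x \<in> {a..b} - N; y \<in> {a..b}; norm (y-x) < d x\<rbrakk>
          \<Longrightarrow> norm (f y - f x - (y-x) * f' x) \<le> \<eta> * norm (y-x)"
      by metis
    obtain \<delta> where "\<delta> > 0" and \<delta>: "\<And>D. \<lbrakk>D division_of \<Union>D; \<Union>D \<subseteq> S; (\<Sum>K\<in>D. measure lborel K) < \<delta>\<rbrakk>
        \<Longrightarrow> (\<Sum>K\<in>D. \<bar>f (Sup K) - f (Inf K)\<bar>) < \<epsilon>/2"
      using ac[unfolded absolutely_continuous_on_def, rule_format, of "\<epsilon>/2"] \<open>\<epsilon> > 0\<close> by auto
    obtain U where U: "open U" "N \<subseteq> U" "U \<in> lmeasurable" "measure lebesgue U < \<delta>"
      by (rule negligible_open_cover[OF N \<open>\<delta> > 0\<close>])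
    define \<gamma> where "\<gamma> x = (if x \<in> N then U else ball x (d x))" for x
    have "gauge \<gamma>" using U d(1) by (auto simp: gauge_def \<gamma>_def)
    moreover have "norm ((\<Sum>(x, K)\<in>p. measure lborel K *\<^sub>R g x) - (f b - f a)) < \<epsilon>"
      if p: "p tagged_division_of {a..b}" and fine: "\<gamma> fine p" for p
    proof -
      define q where "q = {t\<in>p. fst t \<in> N}"
      define r where "r = {t\<in>p. fst t \<notin> N}"
      have fin: "finite p" using p by blast
      have pq: "p = q \<union> r" "q \<inter> r = {}" "finite q" "finite r" "q \<subseteq> p" "r \<subseteq> p"
        using fin by (auto simp: q_def r_def)
      have interval: "\<exists>u v. K = {u..v} \<and> u \<le> v \<and> x \<in> K \<and> K \<subseteq> {a..b}" if xK: "(x, K) \<in> p" for x K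
      proof -
        obtain u v where "K = cbox u v" "x \<in> K" "K \<subseteq> {a..b}"
          using tagged_division_ofD(2-4)[OF p xK] by metis
        then show ?thesis by (metis atLeastAtMost_iff box_real(2) order_trans)
      qed
      let ?F = "\<lambda>(x, K). measure lborel K *\<^sub>R g x - (f (Sup K) - f (Inf K))"
      have "f b - f a = (\<Sum>(x,K)\<in>p. f(Sup K) - f(Inf K))"
        using additive_tagged_division_1[where f= f] \<open>a \<le> b\<close> p by auto
      then have "(\<Sum>(x, K)\<in>p. measure lborel K *\<^sub>R g x) - (f b - f a) = sum ?F p"
        by (simp add: sum_subtractf case_prod_unfold)
      also have "\<dots> = sum ?F q + sum ?F r"
        unfolding pq(1) by (rule sum.union_disjoint[OF pq(3,4,2)])
      finally have eq: "(\<Sum>(x, K)\<in>p. measure lborel K *\<^sub>R g x) - (f b - f a) = sum ?F q + sum ?F r" .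
      have q_part: "norm (sum ?F q) < \<epsilon>/2"
      proof -
        have "q tagged_partial_division_of {a..b}"
          by (rule tagged_partial_division_subset[OF conjunct1[OF p[unfolded tagged_division_of_def]] pq(5)])
        then have tq: "q tagged_division_of \<Union>(snd ` q)" and dq: "(snd ` q) division_of \<Union>(snd ` q)"
          by (auto simp: tagged_partial_division_of_Union_self partial_division_of_tagged_division)
        have "\<Union>(snd ` q) \<subseteq> U"
          using fine by (fastforce simp: fine_def q_def \<gamma>_def)
        then have "(\<Sum>K\<in>snd ` q. measure lborel K) < \<delta>"
          using measure_lborel_division_le[OF dq _ U(3)] U(4) by fastforce
        moreover have "\<Union>(snd ` q) \<subseteq> S"
          using interval pq(5) S by fastforce
        ultimately have "(\<Sum>K\<in>snd ` q. \<bar>f (Sup K) - f (Inf K)\<bar>) < \<epsilon>/2"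
          using \<delta> dq by blast
        moreover have "(\<Sum>K\<in>snd ` q. \<bar>f (Sup K) - f (Inf K)\<bar>) = (\<Sum>(x,K)\<in>q. \<bar>f (Sup K) - f (Inf K)\<bar>)"
        proof -
          \<comment> \<open>Two tagged pairs can share an interval only if its interior is empty,
            and then the increment is 0; so pairs may be replaced by intervals. The value 0 is also
            required on the empty interval, where \<open>Sup\<close> and \<open>Inf\<close> are
            unspecified.\<close>
          define h where "h K = (if K = {} then 0 else \<bar>f (Sup K) - f (Inf K)\<bar>)" for K
          have ne: "K \<noteq> {}" if "(x, K) \<in> q" for x K using interval pq(5) that by fastforce
          have "(\<Sum>(_,K)\<in>q. h K) = sum h (snd ` q)"
          proof (rule sum.over_tagged_division_lemma[OF tq])
            fix u v :: real assume "box u v = {}"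
            then consider "v < u" | "u = v" by fastforce
            then show "h (cbox u v) = 0" by cases (auto simp: h_def)
          qed
          moreover have "sum h (snd ` q) = (\<Sum>K\<in>snd ` q. \<bar>f (Sup K) - f (Inf K)\<bar>)"
            using ne by (intro sum.cong) (auto simp: h_def)
          moreover have "(\<Sum>(_,K)\<in>q. h K) = (\<Sum>(x,K)\<in>q. \<bar>f (Sup K) - f (Inf K)\<bar>)"
            using ne by (intro sum.cong) (auto simp: h_def)
          ultimately show ?thesis by simp
        qed
        moreover have "norm (sum ?F q) \<le> (\<Sum>(x,K)\<in>q. \<bar>f (Sup K) - f (Inf K)\<bar>)"
          by (rule sum_norm_le) (auto simp: q_def g_def)
        ultimately show ?thesis by simp
      qed
      have "norm (sum ?F r) \<le> (\<Sum>(x,K)\<in>r. \<eta> * (Sup K - Inf K))"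
      proof (rule sum_norm_le, safe)
        fix x K assume xK: "(x, K) \<in> r"
        then obtain u v where K: "K = {u..v}" "u \<le> v" "x \<in> K" "K \<subseteq> {a..b}"
          using interval pq(6) by blast
        have x: "x \<notin> N" "x \<in> {a..b}" using xK K by (auto simp: r_def)
        have "K \<subseteq> ball x (d x)" using fine xK x pq(6) by (force simp: fine_def \<gamma>_def)
        moreover have "u \<in> K" "v \<in> K" using K by auto
        ultimately have "dist x u < d x" "dist x v < d x" by (meson mem_ball subsetD)+
        then have near: "norm (u - x) < d x" "norm (v - x) < d x"
          by (simp_all add: dist_norm norm_minus_commute)
        have mem: "x \<in> {a..b} - N" "u \<in> {a..b}" "v \<in> {a..b}" using x K by auto
        note d(2)[OF mem(1,2) near(1)] d(2)[OF mem(1,3) near(2)]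
        moreover have "norm (u-x) = x - u" "norm (v - x) = v - x" using K by auto
        ultimately have *: "\<bar>f u - f x - (u-x) * f' x\<bar> \<le> \<eta> * (x-u)"
          "\<bar>f v - f x - (v-x) * f' x\<bar> \<le> \<eta> * (v-x)" by simp_all
        \<comment> \<open>Both ends are compared with the tag; since the tag lies between them, the
          two errors add up to \<open>\<eta>\<close> times the length.\<close>
        have "measure lborel K *\<^sub>R g x - (f (Sup K) - f (Inf K)) =
           (f u - f x - (u-x) * f' x) - (f v - f x - (v-x) * f' x)"
          using K x by (simp add: g_def algebra_simps)
        then have "\<bar>measure lborel K *\<^sub>R g x - (f (Sup K) - f (Inf K))\<bar> \<le> \<eta> * (x-u) + \<eta> * (v-x)"
          using * by linarith
        then show "norm (measure lborel K *\<^sub>R g x - (f (Sup K) - f (Inf K))) \<le> \<eta> * (Sup K - Inf K)"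
          using K by (simp add: algebra_simps)
      qed
      also have "\<dots> \<le> (\<Sum>(x,K)\<in>p. \<eta> * (Sup K - Inf K))"
      proof (rule sum_mono2[OF fin pq(6)])
        fix t assume t: "t \<in> p - r"
        obtain x K where "t = (x, K)" by fastforce
        moreover then obtain u v where "K = {u..v}" "u \<le> v" using interval t by blast
        ultimately show "0 \<le> (case t of (x, K) \<Rightarrow> \<eta> * (Sup K - Inf K))"
          using \<open>\<eta> > 0\<close> by simp
      qed
      also have "\<dots> = \<eta> * (\<Sum>(x,K)\<in>p. Sup K - Inf K)"
        by (simp add: sum_distrib_left case_prod_unfold)
      also have "\<dots> = \<eta> * (b - a)"
        using additive_tagged_division_1[where f= "\<lambda>x. x"] \<open>a \<le> b\<close> p by auto
      also have "\<dots> \<le> \<epsilon>/2"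
        using \<open>a \<le> b\<close> \<open>\<epsilon> > 0\<close> by (simp add: \<eta>_def field_simps)
      finally have "norm (sum ?F r) \<le> \<epsilon>/2" .
      then show ?thesis
        unfolding eq using q_part by (simp add: norm_triangle_lt)
    qed
    ultimately show "\<exists>\<gamma>. gauge \<gamma> \<and> (\<forall>p. p tagged_division_of {a..b} \<and> \<gamma> fine p \<longrightarrow>
      norm ((\<Sum>(x, K)\<in>p. measure lborel K *\<^sub>R g x) - (f b - f a)) < \<epsilon>)"
      by (intro exI[of _ \<gamma>]) simp
  qed
  then show ?thesis
    by (rule has_integral_spike[OF N, rotated]) (auto simp: g_def)
qed

text \<open>The Lipschitz bound is asked for only at values of \<open>f\<close> on \<open>T\<close>,
  because \<open>\<Phi>\<close> may be singular elsewhere, in particular at 0.\<close>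

lemma absolutely_continuous_lipschitz_compose:
  assumes ac: "absolutely_continuous_on S f" and "T \<subseteq> S"
    and lip: "\<And>x y. x \<in> T \<Longrightarrow> y \<in> T \<Longrightarrow> \<bar>\<Phi> (f x) - \<Phi> (f y)\<bar> \<le> B * \<bar>f x - f y\<bar>"
  shows "absolutely_continuous_on T (\<lambda>x. \<Phi> (f x))"
  unfolding absolutely_continuous_on_def
proof (intro allI impI)
  fix \<epsilon> :: real assume "\<epsilon> > 0"
  define B' where "B' = \<bar>B\<bar> + 1"
  have "B' > 0" "B \<le> B'" by (auto simp: B'_def)
  then obtain \<delta> where "\<delta> > 0" and \<delta>: "\<And>D. \<lbrakk>D division_of \<Union>D; \<Union>D \<subseteq> S; (\<Sum>K\<in>D. measure lborel K) < \<delta>\<rbrakk>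
        \<Longrightarrow> (\<Sum>K\<in>D. \<bar>f (Sup K) - f (Inf K)\<bar>) < \<epsilon> / B'"
    using ac[unfolded absolutely_continuous_on_def, rule_format, of "\<epsilon> / B'"] \<open>\<epsilon> > 0\<close> by auto
  show "\<exists>\<delta>>0. \<forall>D. D division_of \<Union>D \<and> \<Union>D \<subseteq> T \<and> (\<Sum>K\<in>D. measure lborel K) < \<delta> \<longrightarrow>
        (\<Sum>K\<in>D. \<bar>\<Phi> (f (Sup K)) - \<Phi> (f (Inf K))\<bar>) < \<epsilon>"
  proof (intro exI conjI allI impI)
    fix D assume D: "D division_of \<Union>D \<and> \<Union>D \<subseteq> T \<and> (\<Sum>K\<in>D. measure lborel K) < \<delta>"
    have "\<bar>\<Phi> (f (Sup K)) - \<Phi> (f (Inf K))\<bar> \<le> B' * \<bar>f (Sup K) - f (Inf K)\<bar>" if "K \<in> D" for K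
    proof -
      have "K \<noteq> {}" "\<exists>u v. K = cbox u v" "K \<subseteq> T"
        using division_ofD(3,4)[OF conjunct1[OF D] that] D that by auto
      then obtain u v where "K = {u..v}" "u \<le> v" "K \<subseteq> T" by auto
      then have "Sup K \<in> T" "Inf K \<in> T" by auto
      then have "\<bar>\<Phi> (f (Sup K)) - \<Phi> (f (Inf K))\<bar> \<le> B * \<bar>f (Sup K) - f (Inf K)\<bar>" by (rule lip)
      also have "\<dots> \<le> B' * \<bar>f (Sup K) - f (Inf K)\<bar>" by (rule mult_right_mono[OF \<open>B \<le> B'\<close>]) simp
      finally show ?thesis .
    qed
    then have "(\<Sum>K\<in>D. \<bar>\<Phi> (f (Sup K)) - \<Phi> (f (Inf K))\<bar>) \<le> B' * (\<Sum>K\<in>D. \<bar>f (Sup K) - f (Inf K)\<bar>)"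
      by (simp add: sum_distrib_left sum_mono)
    also have "\<dots> < B' * (\<epsilon> / B')"
      using D \<delta>[of D] \<open>T \<subseteq> S\<close> \<open>B' > 0\<close> by (intro mult_strict_left_mono) auto
    finally show "(\<Sum>K\<in>D. \<bar>\<Phi> (f (Sup K)) - \<Phi> (f (Inf K))\<bar>) < \<epsilon>"
      using \<open>B' > 0\<close> by simp
  qed (rule \<open>\<delta> > 0\<close>)
qed

section \<open>Admissible functions outside a fixed null set\<close>

locale admissible_off =
  fixes f :: "real \<Rightarrow> real" and N :: "real set"
  assumes ac: "absolutely_continuous_on {0..1} f"
    and f0: "f 0 = 0"
    and neg: "negligible N"
    and der: "\<sigma> \<in> {0..1} - N \<Longrightarrow> (f has_real_derivative deriv f \<sigma>) (at \<sigma>)"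
    and deriv_nonneg: "\<sigma> \<in> {0..1} - N \<Longrightarrow> 0 \<le> deriv f \<sigma>"
    and prod_le_1: "\<sigma> \<in> {0..1} - N \<Longrightarrow> f \<sigma> * deriv f \<sigma> \<le> 1"

lemma admissible_offE:
  assumes "f \<in> admissible"
  obtains N where "admissible_off f N"
proof -
  from assms have ac: "absolutely_continuous_on {0..1} f" "f 0 = 0"
    and "AE \<sigma> in lebesgue_on {0..1}.
        f differentiable (at \<sigma>) \<and> 0 \<le> deriv f \<sigma> \<and> f \<sigma> * deriv f \<sigma> \<le> 1"
    by (auto simp: admissible_def)
  then have "AE \<sigma> in lebesgue. \<sigma> \<in> {0..1} \<longrightarrow>
        f differentiable (at \<sigma>) \<and> 0 \<le> deriv f \<sigma> \<and> f \<sigma> * deriv f \<sigma> \<le> 1"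
    by (subst (asm) AE_restrict_space_iff) auto
  then obtain N where N: "negligible N" "\<And>\<sigma>. \<sigma> \<in> {0..1} - N \<Longrightarrow>
        f differentiable (at \<sigma>) \<and> 0 \<le> deriv f \<sigma> \<and> f \<sigma> * deriv f \<sigma> \<le> 1"
    unfolding eventually_ae_filter_negligible by blast
  have "admissible_off f N"
    using ac N by unfold_locales (auto simp: DERIV_deriv_iff_real_differentiable)
  then show thesis by (rule that)
qed

context admissible_off
begin

lemma FTC:
  assumes "0 \<le> s" "s \<le> t" "t \<le> 1"
  shows "(deriv f has_integral f t - f s) {s..t}"
  by (rule absolutely_continuous_FTC[OF ac _ assms(2) neg])
    (use assms in \<open>auto intro!: DERIV_subset[OF der]\<close>)

lemma mono:
  assumes "0 \<le> s" "s \<le> t" "t \<le> 1"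
  shows "f s \<le> f t"
proof -
  have "((\<lambda>x. if x \<in> N then 0 else deriv f x) has_integral f t - f s) {s..t}"
    by (rule has_integral_spike[OF neg _ FTC[OF assms]]) auto
  then have "0 \<le> f t - f s"
    by (rule has_integral_nonneg) (use assms in \<open>auto intro: deriv_nonneg\<close>)
  then show ?thesis by simp
qed

lemma nonneg: "\<sigma> \<in> {0..1} \<Longrightarrow> 0 \<le> f \<sigma>"
  using mono[of 0 \<sigma>] f0 by auto

lemma cont: "continuous_on {0..1} f"
proof -
  have "continuous_on {0..1} (\<lambda>t. integral {0..t} (deriv f))"
    using FTC[of 0 1] by (intro indefinite_integral_continuous_1) (auto simp: integrable_on_def)
  moreover have "integral {0..t} (deriv f) = f t" if "t \<in> {0..1}" for t
    using FTC[of 0 t] that f0 by (auto simp: integral_unique)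
  ultimately show ?thesis by (metis (no_types, lifting) continuous_on_cong)
qed

lemma deriv_absolutely_integrable: "deriv f absolutely_integrable_on {0..1}"
proof -
  have "((\<lambda>x. if x \<in> N then 0 else deriv f x) has_integral f 1 - f 0) {0..1}"
    by (rule has_integral_spike[OF neg _ FTC]) auto
  then have "(\<lambda>x. if x \<in> N then 0 else deriv f x) absolutely_integrable_on {0..1}"
    by (intro nonnegative_absolutely_integrable_1) (auto intro: deriv_nonneg has_integral_integrable)
  then show ?thesis
    by (rule absolutely_integrable_spike[OF _ neg]) auto
qed

text \<open>An interior zero of the nonnegative \<open>f\<close> is a local minimum. Thus
  \<open>\<phi> (f \<sigma>) * deriv f \<sigma>\<close> vanishes at zeros of \<open>f\<close>,
  whatever \<open>\<phi>\<close> does at 0. The end points are excluded since every neighbourhood of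
  them leaves the interval; they join \<open>N\<close> below.\<close>

lemma deriv_eq_0:
  assumes "\<sigma> \<in> {0<..<1} - N" "f \<sigma> = 0"
  shows "deriv f \<sigma> = 0"
proof (rule DERIV_local_min[OF der])
  show "0 < min \<sigma> (1 - \<sigma>)" using assms by auto
  show "\<forall>y. \<bar>\<sigma> - y\<bar> < min \<sigma> (1 - \<sigma>) \<longrightarrow> f \<sigma> \<le> f y"
    using assms by (auto intro!: nonneg)
qed (use assms in auto)

text \<open>By monotonicity \<open>f\<close> stays in a compact interval of positive numbers, where
  \<open>\<phi>\<close> is bounded and \<open>\<Phi>\<close> is Lipschitz.\<close>

lemma FTC_compose_away:
  assumes d\<Phi>: "\<And>x. x > 0 \<Longrightarrow> (\<Phi> has_real_derivative \<phi> x) (at x)"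
    and cont\<phi>: "continuous_on {0<..} \<phi>"
    and s: "0 \<le> s" "s \<le> 1" "0 < f s"
  shows "((\<lambda>\<sigma>. \<phi> (f \<sigma>) * deriv f \<sigma>) has_integral \<Phi> (f 1) - \<Phi> (f s)) {s..1}"
proof -
  have "compact (\<phi> ` {f s..f 1})"
    using s by (intro compact_continuous_image continuous_on_subset[OF cont\<phi>]) auto
  then obtain B where B: "\<And>x. x \<in> {f s..f 1} \<Longrightarrow> norm (\<phi> x) \<le> B"
    by (meson compact_imp_bounded bounded_iff imageI)
  have range: "f x \<in> {f s..f 1}" if "x \<in> {s..1}" for x
    using s that by (auto intro!: mono)
  have "absolutely_continuous_on {s..1} (\<lambda>x. \<Phi> (f x))"
  proof (rule absolutely_continuous_lipschitz_compose[OF ac])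
    fix x y assume "x \<in> {s..1}" "y \<in> {s..1}"
    then have "norm (\<Phi> (f x) - \<Phi> (f y)) \<le> B * norm (f x - f y)"
      using s by (intro field_differentiable_bound[where S = "{f s..f 1}" and f' = \<phi>] range B)
        (auto intro!: DERIV_subset[OF d\<Phi>])
    then show "\<bar>\<Phi> (f x) - \<Phi> (f y)\<bar> \<le> B * \<bar>f x - f y\<bar>" by simp
  qed (use s in auto)
  then show ?thesis
  proof (rule absolutely_continuous_FTC[OF _ _ s(2) neg])
    fix x assume x: "x \<in> {s..1} - N"
    then have "0 < f x" using range[of x] s by auto
    then show "((\<lambda>x. \<Phi> (f x)) has_real_derivative \<phi> (f x) * deriv f x) (at x within {s..1})"
      using x s by (intro DERIV_chain2[OF d\<Phi>] DERIV_subset[OF der]) auto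
  qed auto
qed

text \<open>Near the zeros of \<open>f\<close> the factor \<open>\<phi> (f \<sigma>)\<close> may be
  unbounded above. The lower bound \<open>- C x\<close> together with \<open>f f' \<le> 1\<close>
  keeps the integrand above \<open>- C\<close>; adding \<open>C\<close> makes it nonnegative, so
  that monotone convergence and absolute integrability apply.\<close>

lemma FTC_compose:
  assumes cont\<Phi>: "continuous_on {0..} \<Phi>"
    and d\<Phi>: "\<And>x. x > 0 \<Longrightarrow> (\<Phi> has_real_derivative \<phi> x) (at x)"
    and cont\<phi>: "continuous_on {0<..} \<phi>"
    and lower: "\<And>x. x > 0 \<Longrightarrow> - C * x \<le> \<phi> x" and "0 \<le> C"
  shows "(\<lambda>\<sigma>. \<phi> (f \<sigma>) * deriv f \<sigma>) absolutely_integrable_on {0..1}"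
    and "((\<lambda>\<sigma>. \<phi> (f \<sigma>) * deriv f \<sigma>) has_integral \<Phi> (f 1) - \<Phi> 0) {0..1}"
proof -
  let ?g = "\<lambda>\<sigma>. \<phi> (f \<sigma>) * deriv f \<sigma>"
  have zero: "?g \<sigma> = 0" if "\<sigma> \<in> {0..1} - (N \<union> {0, 1})" "f \<sigma> = 0" for \<sigma>
    using deriv_eq_0[of \<sigma>] that by auto
  have neg': "negligible (N \<union> {0, 1})" using neg by (simp add: negligible_insert)
  have ge: "0 \<le> C + ?g \<sigma>" if "\<sigma> \<in> {0..1} - (N \<union> {0, 1})" for \<sigma>
  proof (cases "f \<sigma> = 0")
    case True
    then show ?thesis using zero[OF that True] \<open>0 \<le> C\<close> by linarith
  next
    case False
    then have "0 < f \<sigma>" using nonneg[of \<sigma>] that by auto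
    then have "- C * f \<sigma> * deriv f \<sigma> \<le> ?g \<sigma>"
      using lower deriv_nonneg that by (intro mult_right_mono) auto
    moreover have "C * (f \<sigma> * deriv f \<sigma>) \<le> C * 1"
      using prod_le_1 that \<open>0 \<le> C\<close> by (intro mult_left_mono) auto
    ultimately show ?thesis by (simp add: mult.assoc)
  qed
  show int: "(?g has_integral \<Phi> (f 1) - \<Phi> 0) {0..1}"
  proof (cases "f 1 = 0")
    case True
    then have "f \<sigma> = 0" if "\<sigma> \<in> {0..1}" for \<sigma>
      using nonneg[OF that] mono[of \<sigma> 1] that by auto
    then show ?thesis
      using True zero by (intro has_integral_spike[OF neg' _ has_integral_0[of "{0..1}"], THEN has_integral_eq_rhs]) auto
  next
    case False
    \<comment> \<open>Since \<open>f\<close> is nondecreasing, its zeros fill the interval from 0 to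
      their last point \<open>s\<close>; only the behaviour just after \<open>s\<close> is
      delicate.\<close>
    define Z where "Z = {\<sigma>\<in>{0..1}. f \<sigma> = 0}"
    define s where "s = Sup Z"
    have "0 \<in> Z" "bdd_above Z" using f0 by (auto simp: Z_def)
    have "closed Z"
      unfolding Z_def by (rule continuous_closed_preimage_constant[OF cont]) simp
    then have "s \<in> Z"
      unfolding s_def using \<open>0 \<in> Z\<close> \<open>bdd_above Z\<close> closed_contains_Sup by blast
    then have s: "0 \<le> s" "s < 1" "f s = 0" using False by (auto simp: Z_def order_le_less)
    have pos: "0 < f \<sigma>" if "s < \<sigma>" "\<sigma> \<le> 1" for \<sigma>
    proof -
      have "\<sigma> \<notin> Z" using that \<open>bdd_above Z\<close> cSup_upper s_def by fastforce
      then show ?thesis using that s nonneg[of \<sigma>] by (auto simp: Z_def)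
    qed
    have before: "f \<sigma> = 0" if "0 \<le> \<sigma>" "\<sigma> \<le> s" for \<sigma>
      using that s mono[of \<sigma> s] nonneg[of \<sigma>] by auto
    \<comment> \<open>Points decreasing from \<open>k 0 = 1\<close> to \<open>s\<close>; on each
      \<open>{k n..1}\<close> the function \<open>f\<close> is bounded away from 0.\<close>
    define k where "k n = s + (1 - s) * inverse (real (Suc n))" for n
    have k: "s < k n" "k n \<le> 1" for n
    proof -
      show "s < k n" using s by (simp add: k_def)
      have "(1 - s) * inverse (real (Suc n)) \<le> (1 - s) * 1"
        using s by (intro mult_left_mono) (auto simp: field_simps)
      then show "k n \<le> 1" by (simp add: k_def)
    qed
    have k_dec: "k (Suc n) \<le> k n" for n
      unfolding k_def using s by (intro add_left_mono mult_left_mono) (auto intro!: le_imp_inverse_le)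
    have k_lim: "k \<longlonglongrightarrow> s"
    proof -
      have "k \<longlonglongrightarrow> s + (1 - s) * 0"
        unfolding k_def by (intro tendsto_intros LIMSEQ_inverse_real_of_nat)
      then show ?thesis by simp
    qed
    \<comment> \<open>The intervals grow with \<open>n\<close>, and the values are nonnegative
      because the exceptional points get 0; hence \<open>h\<close> increases in
      \<open>n\<close>.\<close>
    define h where "h n \<sigma> = (if \<sigma> \<in> {k n..1} then if \<sigma> \<in> N \<union> {0,1} then 0 else C + ?g \<sigma> else 0)" for n \<sigma>
    have h_int: "(h n has_integral C * (1 - k n) + (\<Phi> (f 1) - \<Phi> (f (k n)))) {s..1}" for n
    proof -
      have "(?g has_integral \<Phi> (f 1) - \<Phi> (f (k n))) {k n..1}"
        using k[of n] s pos by (intro FTC_compose_away[OF d\<Phi> cont\<phi>]) auto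
      then have "((\<lambda>\<sigma>. C + ?g \<sigma>) has_integral C * (1 - k n) + (\<Phi> (f 1) - \<Phi> (f (k n)))) {k n..1}"
        using has_integral_const_real[of C "k n" 1] k[of n]
        by (intro has_integral_add) (auto simp: mult.commute)
      then have "((\<lambda>\<sigma>. if \<sigma> \<in> N \<union> {0,1} then 0 else C + ?g \<sigma>) has_integral
          C * (1 - k n) + (\<Phi> (f 1) - \<Phi> (f (k n)))) {k n..1}"
        by (rule has_integral_spike[OF neg', rotated]) auto
      then show ?thesis
        unfolding h_def by (subst has_integral_restrict) (use k[of n] in auto)
    qed
    have f_lim: "(\<lambda>n. \<Phi> (f (k n))) \<longlonglongrightarrow> \<Phi> (f s)"
    proof -
      have "(\<lambda>n. f (k n)) \<longlonglongrightarrow> f s"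
      proof (rule continuous_on_tendsto_compose[OF cont k_lim])
        have "k n \<in> {0..1}" for n using k[of n] s by simp
        then show "\<forall>\<^sub>F n in sequentially. k n \<in> {0..1}" by simp
      qed (use s in simp)
      moreover have "0 \<le> f (k n)" for n using pos[OF k] by (rule less_imp_le)
      ultimately show ?thesis
        using s by (intro continuous_on_tendsto_compose[OF cont\<Phi>]) auto
    qed
    have "((\<lambda>\<sigma>. if \<sigma> \<in> {s<..1} then if \<sigma> \<in> N \<union> {0,1} then 0 else C + ?g \<sigma> else 0) has_integral
        C * (1 - s) + (\<Phi> (f 1) - \<Phi> (f s))) {s..1}"
    proof (rule has_integral_monotone_convergence_increasing[OF h_int])
      fix n \<sigma> assume "\<sigma> \<in> {s..1}"
      then show "h n \<sigma> \<le> h (Suc n) \<sigma>"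
        using ge[of \<sigma>] k_dec[of n] s by (auto simp: h_def)
    next
      fix \<sigma> assume \<sigma>: "\<sigma> \<in> {s..1}"
      show "(\<lambda>n. h n \<sigma>) \<longlonglongrightarrow> (if \<sigma> \<in> {s<..1} then if \<sigma> \<in> N \<union> {0,1} then 0 else C + ?g \<sigma> else 0)"
      proof (cases "\<sigma> = s")
        case True
        have "h n \<sigma> = 0" for n using k[of n] by (auto simp: h_def True)
        then show ?thesis using True by simp
      next
        case False
        then have "s < \<sigma>" using \<sigma> by auto
        then have "\<forall>\<^sub>F n in sequentially. k n < \<sigma>" using k_lim order_tendstoD(2) by blast
        then have "\<forall>\<^sub>F n in sequentially. h n \<sigma> =
          (if \<sigma> \<in> {s<..1} then if \<sigma> \<in> N \<union> {0,1} then 0 else C + ?g \<sigma> else 0)"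
          by eventually_elim (use \<sigma> \<open>s < \<sigma>\<close> in \<open>auto simp: h_def\<close>)
        then show ?thesis by (rule tendsto_eventually)
      qed
    next
      show "(\<lambda>n. C * (1 - k n) + (\<Phi> (f 1) - \<Phi> (f (k n)))) \<longlonglongrightarrow> C * (1 - s) + (\<Phi> (f 1) - \<Phi> (f s))"
        by (intro tendsto_intros k_lim f_lim)
    qed
    then have "((\<lambda>\<sigma>. C + ?g \<sigma>) has_integral C * (1 - s) + (\<Phi> (f 1) - \<Phi> (f s))) {s..1}"
      by (rule has_integral_spike[of "N \<union> {0, 1, s}", rotated 2]) (use neg in \<open>auto simp: negligible_insert\<close>)
    then have "((\<lambda>\<sigma>. (C + ?g \<sigma>) - C) has_integral C * (1 - s) + (\<Phi> (f 1) - \<Phi> (f s)) - C * (1 - s)) {s..1}"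
      using has_integral_const_real[of C s 1] s
      by (intro has_integral_diff) (auto simp: mult.commute)
    then have right: "(?g has_integral \<Phi> (f 1) - \<Phi> 0) {s..1}"
      using s by simp
    have left: "(?g has_integral 0) {0..s}"
      by (rule has_integral_spike[OF neg' _ has_integral_0])
        (use zero before s in auto)
    show ?thesis
      using has_integral_combine[OF s(1) less_imp_le[OF s(2)] left right] by simp
  qed
  \<comment> \<open>An integrable nonnegative function is absolutely integrable; the constant
    \<open>C\<close> is subtracted afterwards.\<close>
  have "((\<lambda>\<sigma>. C + ?g \<sigma>) has_integral C * (1 - 0) + (\<Phi> (f 1) - \<Phi> 0)) {0..1}"
    using has_integral_const_real[of C 0 1] by (intro has_integral_add int) auto
  then have "((\<lambda>\<sigma>. if \<sigma> \<in> N \<union> {0,1} then 0 else C + ?g \<sigma>) has_integral C * (1 - 0) + (\<Phi> (f 1) - \<Phi> 0)) {0..1}"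
    by (rule has_integral_spike[OF neg', rotated]) auto
  then have "(\<lambda>\<sigma>. if \<sigma> \<in> N \<union> {0,1} then 0 else C + ?g \<sigma>) absolutely_integrable_on {0..1}"
    using ge by (intro nonnegative_absolutely_integrable_1) (auto intro: has_integral_integrable)
  then have "(\<lambda>\<sigma>. C + ?g \<sigma>) absolutely_integrable_on {0..1}"
    by (rule absolutely_integrable_spike[OF _ neg']) auto
  moreover have "(\<lambda>\<sigma>::real. C) absolutely_integrable_on {0..1}"
    by (rule absolutely_integrable_on_const) simp
  ultimately have "(\<lambda>\<sigma>. (C + ?g \<sigma>) - C) absolutely_integrable_on {0..1}"
    by (rule set_integral_diff(1))
  then show "?g absolutely_integrable_on {0..1}" by simp
qed

end

section \<open>The duality bound\<close>

text \<open>Matching values and slopes at \<open>c\<close> give both one-sided difference quotients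
  the same limit. Differentiability of each piece is asked for only on its own side, since the
  pieces may be singular on the other.\<close>

lemma DERIV_if_le:
  fixes g h :: "real \<Rightarrow> real"
  assumes "x \<le> c \<Longrightarrow> (g has_real_derivative g' x) (at x)"
    and "c \<le> x \<Longrightarrow> (h has_real_derivative h' x) (at x)"
    and "g c = h c" "g' c = h' c"
  shows "((\<lambda>t. if t \<le> c then g t else h t) has_real_derivative (if x \<le> c then g' x else h' x)) (at x)"
proof (rule linorder_cases[of x c])
  assume "x < c"
  then show ?thesis
    using has_field_derivative_transform_within_open[OF assms(1), of "{..<c}" "\<lambda>t. if t \<le> c then g t else h t"] by auto
next
  assume "c < x"
  then show ?thesis
    using has_field_derivative_transform_within_open[OF assms(2), of "{c<..}" "\<lambda>t. if t \<le> c then g t else h t"] by auto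
next
  assume [simp]: "x = c"
  let ?F = "\<lambda>t. if t \<le> c then g t else h t"
  have l: "(g has_real_derivative g' c) (at c within {..<c})" and r: "(h has_real_derivative g' c) (at c within {c<..})"
    using assms by (auto intro: has_field_derivative_at_within)
  have "(?F has_real_derivative g' c) (at c within {..<c})"
    unfolding has_field_derivative_iff
    by (rule Lim_transform_within[OF l[unfolded has_field_derivative_iff] zero_less_one]) auto
  moreover have "(?F has_real_derivative g' c) (at c within {c<..})"
    unfolding has_field_derivative_iff
    by (rule Lim_transform_within[OF r[unfolded has_field_derivative_iff] zero_less_one]) (use assms in auto)
  ultimately have "(?F has_real_derivative g' c) (at c)"
    unfolding has_field_derivative_iff by (subst filterlim_at_split) auto
  then show ?thesis by simp
qed

section \<open>Convexity inequalities for the entropy\<close>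

lemma continuous_on_x_ln_x: "continuous_on {0..} (\<lambda>x::real. x * ln x)"
  unfolding continuous_on
proof
  fix x :: real assume "x \<in> {0..}"
  then consider "x = 0" | "0 < x" by fastforce
  then show "((\<lambda>x. x * ln x) \<longlongrightarrow> x * ln x) (at x within {0..})"
  proof cases
    case 1
    have "((\<lambda>x::real. x * ln x) \<longlongrightarrow> 0) (at_right 0)" by real_asymp
    then show ?thesis using 1 by (simp add: at_within_Ici_at_right)
  next
    case 2
    then show ?thesis by (intro tendsto_intros) auto
  qed
qed

text \<open>The right-hand side is the tangent at \<open>u = c\<close> of the concave function
  \<open>- u ln u\<close>. The choice \<open>c = 1 / e\<close> gives the constant
  \<open>1 / e\<close>, and \<open>c = 1\<close> gives \<open>1 - u\<close>.\<close>

lemma neg_x_ln_x_le: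
  fixes u :: real
  assumes "0 \<le> u" "0 < c"
  shows "- (u * ln u) \<le> c - (ln c + 1) * u"
proof (cases "u = 0")
  case False
  then have "0 < u" using assms by simp
  then have "ln (c / u) \<le> c / u - 1" using assms by (intro ln_le_minus_one) simp
  then have "u * ln (c / u) \<le> u * (c / u - 1)" using \<open>0 < u\<close> by (intro mult_left_mono) auto
  then show ?thesis using \<open>0 < u\<close> assms by (simp add: ln_div algebra_simps)
qed (use assms in auto)

text \<open>This is \<open>ln t \<le> t - 1\<close> at \<open>t = \<nu> / (y p)\<close>. Equality
  for positive \<open>p\<close> means \<open>p = \<nu> / y\<close>, the slope law that the extremal
  functions obey.\<close>

lemma weighted_entropy_le:
  fixes y x p \<nu> :: real
  assumes "0 < y" "0 < x" "0 \<le> p" "0 < \<nu>"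
  shows "- y * (p * ln (x * p)) \<le> \<nu> + y * (ln (y / (\<nu> * x)) - 1) * p"
proof (cases "p = 0")
  case False
  then have "0 < p" using assms by simp
  then have "ln (\<nu> / (y * p)) \<le> \<nu> / (y * p) - 1" using assms by (intro ln_le_minus_one) simp
  then have "y * p * ln (\<nu> / (y * p)) \<le> y * p * (\<nu> / (y * p) - 1)"
    using assms \<open>0 < p\<close> by (intro mult_left_mono) auto
  also have "\<dots> = \<nu> - y * p" using assms \<open>0 < p\<close> by (simp add: right_diff_distrib)
  finally show ?thesis using assms \<open>0 < p\<close> by (simp add: ln_div ln_mult algebra_simps)
qed (use assms in auto)

section \<open>Integrability of the integrands and weak duality\<close>

context admissible_off
begin

lemma integrand_measurable:
  "(\<lambda>\<sigma>. deriv f \<sigma> * ln (f \<sigma> * deriv f \<sigma>)) \<in> borel_measurable (lebesgue_on {0..1})"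
  "(\<lambda>\<sigma>. f \<sigma> * deriv f \<sigma> * ln (f \<sigma> * deriv f \<sigma>)) \<in> borel_measurable (lebesgue_on {0..1})"
proof -
  have [measurable]: "deriv f \<in> borel_measurable (lebesgue_on {0..1})"
    by (rule absolutely_integrable_imp_borel_measurable[OF deriv_absolutely_integrable]) simp
  have [measurable]: "f \<in> borel_measurable (lebesgue_on {0..1})"
    by (rule continuous_imp_measurable_on_sets_lebesgue[OF cont]) simp
  show "(\<lambda>\<sigma>. deriv f \<sigma> * ln (f \<sigma> * deriv f \<sigma>)) \<in> borel_measurable (lebesgue_on {0..1})"
    "(\<lambda>\<sigma>. f \<sigma> * deriv f \<sigma> * ln (f \<sigma> * deriv f \<sigma>)) \<in> borel_measurable (lebesgue_on {0..1})"
    by measurable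
qed

lemma ln_prod_nonpos:
  assumes "\<sigma> \<in> {0..1} - N"
  shows "ln (f \<sigma> * deriv f \<sigma>) \<le> 0"
proof -
  have "0 \<le> f \<sigma> * deriv f \<sigma>" using assms nonneg deriv_nonneg by simp
  then consider "f \<sigma> * deriv f \<sigma> = 0" | "0 < f \<sigma> * deriv f \<sigma>" by linarith
  then show ?thesis
  proof cases
    case 1
    then show ?thesis by (simp only: ln_0)
  next
    case 2
    then show ?thesis using prod_le_1[OF assms] by (simp only: ln_le_zero_iff)
  qed
qed

text \<open>For \<open>u = f f'\<close> in [0, 1] the integrand \<open>u ln u\<close> lies between
  -1 and 0.\<close>

lemma I_integrable: "(\<lambda>\<sigma>. f \<sigma> * deriv f \<sigma> * ln (f \<sigma> * deriv f \<sigma>)) absolutely_integrable_on {0..1}"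
proof -
  let ?h = "\<lambda>\<sigma>. f \<sigma> * deriv f \<sigma> * ln (f \<sigma> * deriv f \<sigma>)"
  have "norm (if \<sigma> \<in> N then 0 else ?h \<sigma>) \<le> 1" if \<sigma>: "\<sigma> \<in> {0..1}" for \<sigma>
  proof (cases "\<sigma> \<in> N")
    case False
    then have "0 \<le> f \<sigma> * deriv f \<sigma>" "ln (f \<sigma> * deriv f \<sigma>) \<le> 0"
      using \<sigma> nonneg deriv_nonneg ln_prod_nonpos by simp_all
    moreover from this have "f \<sigma> * deriv f \<sigma> * ln (f \<sigma> * deriv f \<sigma>) \<le> 0"
      by (rule mult_nonneg_nonpos)
    ultimately show ?thesis using neg_x_ln_x_le[of "f \<sigma> * deriv f \<sigma>" 1] False by auto
  qed simp
  moreover have "(\<lambda>\<sigma>. if \<sigma> \<in> N then 0 else ?h \<sigma>) \<in> borel_measurable (lebesgue_on {0..1})"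
  proof (rule measurable_If_set)
    show "N \<inter> space (lebesgue_on {0..1}) \<in> sets (lebesgue_on {0..1})"
      using negligible_imp_sets[OF neg] by (auto simp: sets_restrict_space_iff intro!: sets.Int)
  qed (use integrand_measurable in auto)
  ultimately have "(\<lambda>\<sigma>. if \<sigma> \<in> N then 0 else ?h \<sigma>) absolutely_integrable_on {0..1}"
    by (intro measurable_bounded_by_integrable_imp_absolutely_integrable[where g = "\<lambda>_. 1"])
      (auto intro: integrable_const_ivl)
  then show ?thesis by (rule absolutely_integrable_spike[OF _ neg]) auto
qed

text \<open>The integrand may be unbounded where \<open>f\<close> is small. There
  \<open>weighted_entropy_le\<close> with \<open>y = \<nu> = 1\<close> bounds its negative by
  \<open>1 + (- ln f - 1) f'\<close>, which \<open>FTC_compose\<close> integrates.\<close>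

lemma J_integrable: "(\<lambda>\<sigma>. deriv f \<sigma> * ln (f \<sigma> * deriv f \<sigma>)) absolutely_integrable_on {0..1}"
proof -
  \<comment> \<open>The primitive \<open>- x ln x\<close> of \<open>- ln x - 1\<close> has its
    maximum \<open>1 / e\<close> at \<open>1 / e\<close>, so continuing it by that constant keeps
    the derivative continuous on the positive axis.\<close>
  define \<Phi> :: "real \<Rightarrow> real" where "\<Phi> x = (if x \<le> 1/e then - (x * ln x) else 1/e)" for x
  define \<phi> :: "real \<Rightarrow> real" where "\<phi> x = (if x \<le> 1/e then - ln x - 1 else 0)" for x
  have "0 < 1/e" by simp
  have d\<Phi>: "(\<Phi> has_real_derivative \<phi> x) (at x)" if "0 < x" for x
    unfolding \<Phi>_def \<phi>_def
    by (rule DERIV_if_le) (use that in \<open>auto intro!: derivative_eq_intros simp: ln_div\<close>)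
  have cont\<Phi>: "continuous_on {0..} \<Phi>"
    unfolding \<Phi>_def
  proof (rule continuous_on_cases_le)
    have "continuous_on {0..} (\<lambda>x::real. - (x * ln x))"
      by (intro continuous_on_minus continuous_on_x_ln_x)
    then show "continuous_on {x \<in> {0..}. x \<le> 1/e} (\<lambda>x. - (x * ln x))"
      by (rule continuous_on_subset) auto
  qed (auto simp: ln_div intro!: continuous_intros)
  have cont\<phi>: "continuous_on {0<..} \<phi>"
    unfolding \<phi>_def by (rule continuous_on_cases_le) (auto simp: ln_div intro!: continuous_intros)
  have \<phi>_nonneg: "0 \<le> \<phi> x" if "0 < x" for x
  proof (cases "x \<le> 1/e")
    case True
    then have "ln x \<le> ln (1/e)" using that by (subst ln_le_cancel_iff) auto
    then show ?thesis by (simp add: \<phi>_def ln_div)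
  qed (simp add: \<phi>_def)
  have "(\<lambda>\<sigma>. \<phi> (f \<sigma>) * deriv f \<sigma>) absolutely_integrable_on {0..1}"
    by (rule FTC_compose(1)[OF cont\<Phi> d\<Phi> cont\<phi>, of 0]) (use \<phi>_nonneg in auto)
  then have int: "(\<lambda>\<sigma>. 1 + \<phi> (f \<sigma>) * deriv f \<sigma>) integrable_on {0..1}"
    by (intro integrable_add integrable_const_ivl set_lebesgue_integral_eq_integral(1))
  have neg': "negligible (N \<union> {0, 1})" using neg by (simp add: negligible_insert)
  have int: "(\<lambda>\<sigma>. if \<sigma> \<in> N \<union> {0,1} then 0 else 1 + \<phi> (f \<sigma>) * deriv f \<sigma>) integrable_on {0..1}"
    by (rule integrable_spike[OF int neg']) auto
  let ?h = "\<lambda>\<sigma>. deriv f \<sigma> * ln (f \<sigma> * deriv f \<sigma>)"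
  have "norm (if \<sigma> \<in> N \<union> {0,1} then 0 else ?h \<sigma>) \<le> (if \<sigma> \<in> N \<union> {0,1} then 0 else 1 + \<phi> (f \<sigma>) * deriv f \<sigma>)"
    if "\<sigma> \<in> {0..1}" for \<sigma>
  proof (cases "\<sigma> \<in> N \<union> {0,1}")
    case False
    then have \<sigma>: "\<sigma> \<in> {0..1} - N" "\<sigma> \<in> {0<..<1} - N" using that by auto
    have "- ?h \<sigma> \<le> 1 + \<phi> (f \<sigma>) * deriv f \<sigma>"
    proof (cases "f \<sigma> = 0")
      case True
      then show ?thesis using deriv_eq_0[OF \<sigma>(2)] by simp
    next
      case f: False
      then have fpos: "0 < f \<sigma>" using nonneg[of \<sigma>] \<sigma> by auto
      have p: "0 \<le> deriv f \<sigma>" using deriv_nonneg[OF \<sigma>(1)] .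
      show ?thesis
      proof (cases "f \<sigma> \<le> 1/e")
        case True
        then show ?thesis
          using weighted_entropy_le[of 1 "f \<sigma>" "deriv f \<sigma>" 1] fpos p by (simp add: \<phi>_def ln_div)
      next
        case False
        \<comment> \<open>Here division by \<open>f\<close> is harmless:
          \<open>f p w \<le> 1 / e \<le> f\<close>, hence \<open>p w \<le> 1\<close>.\<close>
        have "- (f \<sigma> * deriv f \<sigma> * ln (f \<sigma> * deriv f \<sigma>)) \<le> 1 / e"
          using neg_x_ln_x_le[of "f \<sigma> * deriv f \<sigma>" "1/e"] fpos p by (simp add: ln_div)
        also have "\<dots> \<le> f \<sigma>" using False by simp
        finally have "f \<sigma> * (- ?h \<sigma>) \<le> f \<sigma> * 1" by (simp add: algebra_simps)
        then have "- ?h \<sigma> \<le> 1" using fpos by (simp only: mult_le_cancel_left_pos)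
        then show ?thesis using False by (simp add: \<phi>_def)
      qed
    qed
    moreover have "?h \<sigma> \<le> 0"
      using deriv_nonneg[OF \<sigma>(1)] ln_prod_nonpos[OF \<sigma>(1)] by (rule mult_nonneg_nonpos)
    ultimately show ?thesis using False by auto
  qed simp
  moreover have "(\<lambda>\<sigma>. if \<sigma> \<in> N \<union> {0,1} then 0 else ?h \<sigma>) \<in> borel_measurable (lebesgue_on {0..1})"
  proof (rule measurable_If_set)
    show "(N \<union> {0,1}) \<inter> space (lebesgue_on {0..1}) \<in> sets (lebesgue_on {0..1})"
      using negligible_imp_sets[OF neg'] by (auto simp: sets_restrict_space_iff simp del: Un_insert_right intro!: sets.Int)
  qed (use integrand_measurable in auto)
  ultimately have "(\<lambda>\<sigma>. if \<sigma> \<in> N \<union> {0,1} then 0 else ?h \<sigma>) absolutely_integrable_on {0..1}"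
    by (intro measurable_bounded_by_integrable_imp_absolutely_integrable[OF _ _ int]) auto
  then show ?thesis by (rule absolutely_integrable_spike[OF _ neg']) auto
qed

text \<open>The pointwise inequality is integrated along \<open>f\<close> by
  \<open>FTC_compose\<close>. Where \<open>f\<close> vanishes, so does \<open>deriv f\<close>, and
  \<open>0 \<le> \<nu>\<close> takes the place of the inequality. The restriction
  \<open>x \<le> f 1\<close> serves weights whose sign changes further out.\<close>

lemma dual_bound:
  assumes \<Phi>: "continuous_on {0..} \<Phi>" "\<And>x. x > 0 \<Longrightarrow> (\<Phi> has_real_derivative \<phi> x) (at x)"
    and \<phi>: "continuous_on {0<..} \<phi>" "\<And>x. x > 0 \<Longrightarrow> - C * x \<le> \<phi> x" and "0 \<le> C" "0 \<le> \<nu>"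
    and pointwise: "\<And>x p. 0 < x \<Longrightarrow> x \<le> f 1 \<Longrightarrow> 0 \<le> p \<Longrightarrow> x * p \<le> 1 \<Longrightarrow>
      - (\<alpha> + \<beta> * x) * (p * ln (x * p)) \<le> \<nu> + \<phi> x * p"
  shows "\<alpha> * (J_fun f / sqrt 2) + \<beta> * I_fun f \<le> \<nu> + (\<Phi> (f 1) - \<Phi> 0)"
proof -
  let ?J = "\<lambda>\<sigma>. deriv f \<sigma> * ln (f \<sigma> * deriv f \<sigma>)"
  let ?I = "\<lambda>\<sigma>. f \<sigma> * deriv f \<sigma> * ln (f \<sigma> * deriv f \<sigma>)"
  let ?L = "\<lambda>\<sigma>. - (\<alpha> + \<beta> * f \<sigma>) * ?J \<sigma>"
  let ?R = "\<lambda>\<sigma>. \<nu> + \<phi> (f \<sigma>) * deriv f \<sigma>"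
  have neg': "negligible (N \<union> {0, 1})" using neg by (simp add: negligible_insert)
  have "((\<lambda>\<sigma>. - \<alpha> * ?J \<sigma> - \<beta> * ?I \<sigma>) has_integral
      - \<alpha> * (LINT \<sigma>:{0..1}|lebesgue. ?J \<sigma>) - \<beta> * (LINT \<sigma>:{0..1}|lebesgue. ?I \<sigma>)) {0..1}"
    by (intro has_integral_diff has_integral_mult_right has_integral_set_lebesgue I_integrable J_integrable)
  then have L: "(?L has_integral \<alpha> * (J_fun f / sqrt 2) + \<beta> * I_fun f) {0..1}"
    by (simp add: J_fun_def I_fun_def algebra_simps)
  have R: "(?R has_integral \<nu> + (\<Phi> (f 1) - \<Phi> 0)) {0..1}"
    using has_integral_add[OF has_integral_const_real[of \<nu> 0 1] FTC_compose(2)[OF \<Phi> \<phi> \<open>0 \<le> C\<close>]]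
    by simp
  have le: "?L \<sigma> \<le> ?R \<sigma>" if \<sigma>: "\<sigma> \<in> {0..1} - (N \<union> {0, 1})" for \<sigma>
  proof (cases "f \<sigma> = 0")
    case True
    then show ?thesis using deriv_eq_0[of \<sigma>] \<sigma> \<open>0 \<le> \<nu>\<close> by auto
  next
    case False
    then have "0 < f \<sigma>" using nonneg[of \<sigma>] \<sigma> by auto
    then show ?thesis using \<sigma> deriv_nonneg prod_le_1 mono[of \<sigma> 1] by (intro pointwise) auto
  qed
  show ?thesis
  proof (rule has_integral_le)
    show "((\<lambda>\<sigma>. if \<sigma> \<in> N \<union> {0,1} then 0 else ?L \<sigma>) has_integral \<alpha> * (J_fun f / sqrt 2) + \<beta> * I_fun f) {0..1}"
      by (rule has_integral_spike[OF neg' _ L]) auto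
    show "((\<lambda>\<sigma>. if \<sigma> \<in> N \<union> {0,1} then 0 else ?R \<sigma>) has_integral \<nu> + (\<Phi> (f 1) - \<Phi> 0)) {0..1}"
      by (rule has_integral_spike[OF neg' _ R]) auto
  qed (use le in auto)
qed

end

section \<open>Explicit admissible functions\<close>

text \<open>The derivative may be unbounded, as for \<open>sqrt\<close> at 0. Truncating it at
  height \<open>n\<close> leaves a remainder of small total integral, while the truncated part
  contributes at most \<open>n\<close> times the total length of the division.\<close>

lemma absolutely_continuous_of_nonneg_derivative:
  fixes g g' :: "real \<Rightarrow> real"
  assumes "a \<le> b" "finite S" and cont: "continuous_on {a..b} g"
    and der: "\<And>x. x \<in> {a<..<b} - S \<Longrightarrow> (g has_real_derivative g' x) (at x)"
    and nonneg: "\<And>x. x \<in> {a<..<b} - S \<Longrightarrow> 0 \<le> g' x"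
  shows "absolutely_continuous_on {a..b} g"
proof -
  define h where "h x = (if x \<in> {a<..<b} - S then g' x else 0)" for x
  have h_nonneg: "0 \<le> h x" for x using nonneg by (simp add: h_def)
  have h_int: "(h has_integral g v - g u) {u..v}" if "a \<le> u" "u \<le> v" "v \<le> b" for u v
    by (rule fundamental_theorem_of_calculus_interior_strong[OF \<open>finite S\<close> that(2)])
      (use that der in \<open>auto simp: h_def has_real_derivative_iff_has_vector_derivative[symmetric]
        intro: continuous_on_subset[OF cont]\<close>)
  have h_abs: "h absolutely_integrable_on {a..b}"
    using h_int[of a b] \<open>a \<le> b\<close> h_nonneg by (intro nonnegative_absolutely_integrable_1) auto
  define m where "m n x = min (h x) (real n)" for n x
  have m_int: "m n integrable_on {u..v}" if "a \<le> u" "v \<le> b" for n u v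
  proof -
    have "m n absolutely_integrable_on {a..b}"
      unfolding m_def by (intro absolutely_integrable_min_1 h_abs absolutely_integrable_on_const) simp
    then have "m n integrable_on {a..b}" by (rule set_lebesgue_integral_eq_integral(1))
    then show ?thesis by (rule integrable_on_subinterval) (use that in auto)
  qed
  have "(\<lambda>n. integral {a..b} (m n)) \<longlonglongrightarrow> integral {a..b} h"
  proof (rule dominated_convergence(2))
    show "h integrable_on {a..b}" using h_int[of a b] \<open>a \<le> b\<close> by (auto intro: has_integral_integrable)
    show "norm (m n x) \<le> h x" for n x using h_nonneg[of x] by (simp add: m_def)
    show "(\<lambda>n. m n x) \<longlonglongrightarrow> h x" for x
    proof (rule tendsto_eventually)
      have "\<forall>\<^sub>F n in sequentially. h x \<le> real n"
        using eventually_ge_at_top[of "nat \<lceil>h x\<rceil>"] by eventually_elim linarith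
      then show "\<forall>\<^sub>F n in sequentially. m n x = h x" by eventually_elim (simp add: m_def)
    qed
  qed (use m_int in auto)
  moreover have "integral {a..b} h = g b - g a" using h_int[of a b] \<open>a \<le> b\<close> by (simp add: integral_unique)
  ultimately have lim: "(\<lambda>n. integral {a..b} (m n)) \<longlonglongrightarrow> g b - g a" by simp
  show ?thesis
    unfolding absolutely_continuous_on_def
  proof (intro allI impI)
    fix \<epsilon> :: real assume "\<epsilon> > 0"
    then have "\<forall>\<^sub>F n in sequentially. g b - g a - \<epsilon>/2 < integral {a..b} (m n)"
      using lim by (intro order_tendstoD(1)[OF lim]) simp
    then obtain n where n: "g b - g a - \<epsilon>/2 < integral {a..b} (m n)"
      by (meson eventually_sequentially order_refl)
    define r where "r x = h x - m n x" for x
    have r_nonneg: "0 \<le> r x" for x by (simp add: r_def m_def)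
    have r_int: "r integrable_on {u..v}" if "a \<le> u" "u \<le> v" "v \<le> b" for u v
      unfolding r_def using h_int[of u v] m_int[of u v] that
      by (intro integrable_diff) (auto intro: has_integral_integrable)
    have r_total: "integral {a..b} r < \<epsilon>/2"
    proof -
      have "integral {a..b} r = integral {a..b} h - integral {a..b} (m n)"
        unfolding r_def using h_int[of a b] m_int[of a b] \<open>a \<le> b\<close>
        by (intro integral_diff) (auto intro: has_integral_integrable)
      then show ?thesis using n h_int[of a b] \<open>a \<le> b\<close> by (simp add: integral_unique)
    qed
    show "\<exists>\<delta>>0. \<forall>D. D division_of \<Union>D \<and> \<Union>D \<subseteq> {a..b} \<and> (\<Sum>K\<in>D. measure lborel K) < \<delta> \<longrightarrow>
        (\<Sum>K\<in>D. \<bar>g (Sup K) - g (Inf K)\<bar>) < \<epsilon>"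
    proof (intro exI conjI allI impI)
      \<comment> \<open>The factor \<open>n + 1\<close> in place of \<open>n\<close> allows for
        \<open>n = 0\<close>.\<close>
      show "0 < \<epsilon> / (2 * (real n + 1))" using \<open>\<epsilon> > 0\<close> by simp
      fix D assume asm: "D division_of \<Union>D \<and> \<Union>D \<subseteq> {a..b} \<and> (\<Sum>K\<in>D. measure lborel K) < \<epsilon> / (2 * (real n + 1))"
      then have D: "D division_of \<Union>D" "\<Union>D \<subseteq> {a..b}" by auto
      have K: "\<exists>u v. K = {u..v} \<and> a \<le> u \<and> u \<le> v \<and> v \<le> b" if KD: "K \<in> D" for K
      proof -
        obtain u v where "K = cbox u v" "K \<noteq> {}" "K \<subseteq> {a..b}"
          using division_ofD(3,4)[OF D(1) KD] D(2) KD by blast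
        then show ?thesis by auto
      qed
      have piece: "\<bar>g (Sup K) - g (Inf K)\<bar> \<le> integral K r + real n * measure lborel K" if KD: "K \<in> D" for K
      proof -
        obtain u v where uv: "K = {u..v}" "a \<le> u" "u \<le> v" "v \<le> b" using K[OF KD] by blast
        have h: "h integrable_on {u..v}" "integral {u..v} h = g v - g u"
          using h_int[OF uv(2-4)] by (auto simp: integral_unique)
        have "g v - g u = integral {u..v} r + integral {u..v} (m n)"
          unfolding r_def using h m_int[OF uv(2,4)] by (simp add: integral_diff)
        moreover have "integral {u..v} (m n) \<le> integral {u..v} (\<lambda>_. real n)"
          by (rule integral_le) (use m_int[OF uv(2,4)] in \<open>auto simp: m_def\<close>)
        moreover have "0 \<le> g v - g u"
          using has_integral_nonneg[OF h_int[OF uv(2-4)]] h_nonneg by simp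
        ultimately show ?thesis using uv by (simp add: mult.commute)
      qed
      have "((r has_integral (\<Sum>K\<in>D. integral K r)) (\<Union>D))"
      proof (rule has_integral_combine_division[OF D(1)])
        fix K assume "K \<in> D"
        then obtain u v where "K = {u..v}" "a \<le> u" "u \<le> v" "v \<le> b" using K by blast
        then show "(r has_integral integral K r) K" using r_int by (simp add: integrable_integral)
      qed
      then have "(\<Sum>K\<in>D. integral K r) \<le> integral {a..b} r"
        using r_int[of a b] r_nonneg \<open>a \<le> b\<close> D(2)
        by (intro has_integral_subset_le[of "\<Union>D" "{a..b}" r]) (auto intro: integrable_integral)
      have "(\<Sum>K\<in>D. \<bar>g (Sup K) - g (Inf K)\<bar>) \<le> (\<Sum>K\<in>D. integral K r + real n * measure lborel K)"
        by (rule sum_mono) (rule piece)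
      also have "\<dots> = (\<Sum>K\<in>D. integral K r) + real n * (\<Sum>K\<in>D. measure lborel K)"
        by (simp add: sum.distrib sum_distrib_left)
      also have "\<dots> < \<epsilon>/2 + \<epsilon>/2"
      proof (rule add_less_le_mono)
        have "real n * (\<Sum>K\<in>D. measure lborel K) \<le> real n * (\<epsilon> / (2 * (real n + 1)))"
          using asm by (intro mult_left_mono) auto
        also have "\<dots> \<le> \<epsilon>/2" using \<open>\<epsilon> > 0\<close> by (simp add: field_simps)
        finally show "real n * (\<Sum>K\<in>D. measure lborel K) \<le> \<epsilon>/2" .
      qed (use r_total \<open>(\<Sum>K\<in>D. integral K r) \<le> integral {a..b} r\<close> in simp)
      finally show "(\<Sum>K\<in>D. \<bar>g (Sup K) - g (Inf K)\<bar>) < \<epsilon>" by simp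
    qed
  qed
qed

text \<open>The fundamental theorem yields a gauge integral; the sign of \<open>F'\<close> turns it
  into a Lebesgue integral, and the finite exceptional set changes neither.\<close>

lemma set_lebesgue_integral_nonneg_FTC:
  fixes F F' g :: "real \<Rightarrow> real"
  assumes "a \<le> b" "finite S" and cont: "continuous_on {a..b} F"
    and der: "\<And>x. x \<in> {a<..<b} - S \<Longrightarrow> (F has_real_derivative F' x) (at x)"
    and nonneg: "\<And>x. x \<in> {a<..<b} - S \<Longrightarrow> 0 \<le> F' x"
    and eq: "\<And>x. x \<in> {a<..<b} - S \<Longrightarrow> g x = F' x"
  shows "(LINT x:{a..b}|lebesgue. g x) = F b - F a"
proof -
  define h where "h x = (if x \<in> {a<..<b} - S then F' x else 0)" for x
  have h_nonneg: "0 \<le> h x" for x using nonneg by (simp add: h_def)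
  have h_int: "(h has_integral F b - F a) {a..b}"
    by (rule fundamental_theorem_of_calculus_interior_strong[OF \<open>finite S\<close> \<open>a \<le> b\<close>])
      (use der cont in \<open>auto simp: h_def has_real_derivative_iff_has_vector_derivative[symmetric]\<close>)
  then have h_abs: "h absolutely_integrable_on {a..b}"
    using h_nonneg by (intro nonnegative_absolutely_integrable_1) auto
  have neg: "negligible (S \<union> {a, b})" using \<open>finite S\<close> by (intro negligible_finite) simp
  have "g absolutely_integrable_on {a..b}"
    by (rule absolutely_integrable_spike[OF h_abs neg]) (auto simp: h_def eq)
  moreover have "(g has_integral F b - F a) {a..b}"
    by (rule has_integral_spike[OF neg _ h_int]) (auto simp: h_def eq)
  ultimately show ?thesis by (simp add: set_lebesgue_integral_eq_integral integral_unique)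
qed

text \<open>\<open>A\<close> and \<open>B\<close> are antiderivatives in \<open>\<sigma>\<close> of
  the negated integrands, which are nonnegative because \<open>ln (f f') \<le> 0\<close>. The finite
  set \<open>S\<close> leaves room for a corner.\<close>

lemma admissible_explicit:
  assumes "finite S" and cont: "continuous_on {0..1} f" and "f 0 = 0"
    and der: "\<And>\<sigma>. \<sigma> \<in> {0<..<1} - S \<Longrightarrow> (f has_real_derivative f' \<sigma>) (at \<sigma>)"
    and nonneg: "\<And>\<sigma>. \<sigma> \<in> {0<..<1} - S \<Longrightarrow> 0 \<le> f' \<sigma>" "\<And>\<sigma>. \<sigma> \<in> {0<..<1} - S \<Longrightarrow> 0 < f \<sigma>"
    and le1: "\<And>\<sigma>. \<sigma> \<in> {0<..<1} - S \<Longrightarrow> f \<sigma> * f' \<sigma> \<le> 1"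
    and A: "continuous_on {0..1} A"
      "\<And>\<sigma>. \<sigma> \<in> {0<..<1} - S \<Longrightarrow> (A has_real_derivative - (f' \<sigma> * ln (f \<sigma> * f' \<sigma>))) (at \<sigma>)"
    and B: "continuous_on {0..1} B"
      "\<And>\<sigma>. \<sigma> \<in> {0<..<1} - S \<Longrightarrow> (B has_real_derivative - (f \<sigma> * f' \<sigma> * ln (f \<sigma> * f' \<sigma>))) (at \<sigma>)"
  shows "f \<in> admissible" "J_fun f = sqrt 2 * (A 1 - A 0)" "I_fun f = B 1 - B 0"
proof -
  have deriv: "deriv f \<sigma> = f' \<sigma>" if "\<sigma> \<in> {0<..<1} - S" for \<sigma>
    using der[OF that] by (rule DERIV_imp_deriv)
  have "negligible (S \<union> {0, 1})" using \<open>finite S\<close> by (intro negligible_finite) simp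
  moreover have "f differentiable (at \<sigma>) \<and> 0 \<le> deriv f \<sigma> \<and> f \<sigma> * deriv f \<sigma> \<le> 1"
    if "\<sigma> \<in> {0..1}" "\<sigma> \<notin> S \<union> {0, 1}" for \<sigma>
  proof -
    have \<sigma>: "\<sigma> \<in> {0<..<1} - S" using that by auto
    then show ?thesis
      using der[OF \<sigma>] deriv[OF \<sigma>] nonneg(1)[OF \<sigma>] le1[OF \<sigma>]
      by (auto simp: real_differentiable_def)
  qed
  ultimately have "AE \<sigma> in lebesgue. \<sigma> \<in> {0..1} \<longrightarrow>
      f differentiable (at \<sigma>) \<and> 0 \<le> deriv f \<sigma> \<and> f \<sigma> * deriv f \<sigma> \<le> 1"
    unfolding eventually_ae_filter_negligible by blast
  then have "AE \<sigma> in lebesgue_on {0..1}.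
      f differentiable (at \<sigma>) \<and> 0 \<le> deriv f \<sigma> \<and> f \<sigma> * deriv f \<sigma> \<le> 1"
    by (subst AE_restrict_space_iff) auto
  moreover have "absolutely_continuous_on {0..1} f"
    by (rule absolutely_continuous_of_nonneg_derivative[OF _ \<open>finite S\<close> cont der nonneg(1)]) auto
  ultimately show "f \<in> admissible" using \<open>f 0 = 0\<close> by (simp add: admissible_def)
  have ln: "ln (f \<sigma> * f' \<sigma>) \<le> 0" if "\<sigma> \<in> {0<..<1} - S" for \<sigma>
  proof -
    \<comment> \<open>A vanishing product is harmless, since \<open>ln 0 = 0\<close>.\<close>
    have "f' \<sigma> = 0 \<or> 0 < f \<sigma> * f' \<sigma>" using nonneg[OF that] by (cases "f' \<sigma> = 0") (simp_all add: zero_less_mult_iff less_le)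
    then show ?thesis using le1[OF that] by (auto simp del: zero_less_mult_iff simp: ln_le_zero_iff)
  qed
  have "(LINT \<sigma>:{0..1}|lebesgue. - (deriv f \<sigma> * ln (f \<sigma> * deriv f \<sigma>))) = A 1 - A 0"
  proof (rule set_lebesgue_integral_nonneg_FTC[OF _ \<open>finite S\<close> A])
    fix \<sigma> assume \<sigma>: "\<sigma> \<in> {0<..<1} - S"
    show "0 \<le> - (f' \<sigma> * ln (f \<sigma> * f' \<sigma>))"
      using mult_nonneg_nonpos[OF nonneg(1)[OF \<sigma>] ln[OF \<sigma>]] by simp
  qed (use deriv in auto)
  then show "J_fun f = sqrt 2 * (A 1 - A 0)" by (simp add: J_fun_def set_lebesgue_integral_def algebra_simps)
  have "(LINT \<sigma>:{0..1}|lebesgue. - (f \<sigma> * deriv f \<sigma> * ln (f \<sigma> * deriv f \<sigma>))) = B 1 - B 0"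
  proof (rule set_lebesgue_integral_nonneg_FTC[OF _ \<open>finite S\<close> B])
    fix \<sigma> assume \<sigma>: "\<sigma> \<in> {0<..<1} - S"
    have "0 \<le> f \<sigma> * f' \<sigma>" using nonneg[OF \<sigma>] by simp
    then show "0 \<le> - (f \<sigma> * f' \<sigma> * ln (f \<sigma> * f' \<sigma>))"
      using mult_nonneg_nonpos[OF _ ln[OF \<sigma>]] by simp
  qed (use deriv in auto)
  then show "I_fun f = B 1 - B 0" by (simp add: I_fun_def set_lebesgue_integral_def)
qed

section \<open>The upper bound\<close>

text \<open>The primitive of \<open>1 / (1 + \<beta> x)\<close> that vanishes at 0. The value at
  \<open>\<beta> = 0\<close> is the continuous limit; it carries the case
  \<open>b = sqrt (1 / e)\<close>, in which \<open>k\<close> is infinite.\<close>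

definition L_up :: "real \<Rightarrow> real \<Rightarrow> real" where
  "L_up \<beta> x = (if \<beta> = 0 then x else ln (1 + \<beta> * x) / \<beta>)"

text \<open>The primitive of \<open>x / (2 (1 + \<beta> x))\<close> that vanishes at 0.\<close>

definition M_up :: "real \<Rightarrow> real \<Rightarrow> real" where
  "M_up \<beta> x = (if \<beta> = 0 then x\<^sup>2 / 4 else (x - L_up \<beta> x) / (2 * \<beta>))"

text \<open>The optimal \<open>w\<close>: it is \<open>- ln (x p)\<close> for the slope
  \<open>p = \<nu> / (1 + \<beta> x)\<close>.\<close>

definition w_up :: "real \<Rightarrow> real \<Rightarrow> real \<Rightarrow> real" where
  "w_up \<beta> \<nu> x = ln (1 + \<beta> * x) - ln \<nu> - ln x"

text \<open>\<open>A_up\<close> and \<open>B_up\<close> are primitives of \<open>w\<close> and of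
  \<open>x w\<close>; \<open>L_up\<close> and \<open>M_up\<close> are the integrals left over by
  integration by parts.\<close>

definition A_up :: "real \<Rightarrow> real \<Rightarrow> real \<Rightarrow> real" where
  "A_up \<beta> \<nu> x = x * w_up \<beta> \<nu> x + L_up \<beta> x"

definition B_up :: "real \<Rightarrow> real \<Rightarrow> real \<Rightarrow> real" where
  "B_up \<beta> \<nu> x = x\<^sup>2 / 2 * w_up \<beta> \<nu> x + M_up \<beta> x"

lemma DERIV_L_up:
  assumes "0 < 1 + \<beta> * x"
  shows "(L_up \<beta> has_real_derivative 1 / (1 + \<beta> * x)) (at x)"
proof (cases "\<beta> = 0")
  case True
  then have "L_up \<beta> = (\<lambda>x. x)" by (simp add: L_up_def fun_eq_iff)
  then show ?thesis using True by simp
next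
  case False
  then have "L_up \<beta> = (\<lambda>x. ln (1 + \<beta> * x) / \<beta>)" by (simp add: L_up_def fun_eq_iff)
  then show ?thesis using False assms by (auto intro!: derivative_eq_intros)
qed

lemma DERIV_M_up:
  assumes "0 < 1 + \<beta> * x"
  shows "(M_up \<beta> has_real_derivative x / (2 * (1 + \<beta> * x))) (at x)"
proof (cases "\<beta> = 0")
  case True
  then have "M_up \<beta> = (\<lambda>x. x\<^sup>2 / 4)" by (simp add: M_up_def fun_eq_iff)
  then show ?thesis using True by (auto intro!: derivative_eq_intros)
next
  case False
  then have "M_up \<beta> = (\<lambda>x. (x - L_up \<beta> x) / (2 * \<beta>))" by (simp add: M_up_def fun_eq_iff)
  moreover have "((\<lambda>x. (x - L_up \<beta> x) / (2 * \<beta>)) has_real_derivative (1 - 1 / (1 + \<beta> * x)) / (2 * \<beta>)) (at x)"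
    by (intro DERIV_cdivide DERIV_diff DERIV_ident DERIV_L_up[OF assms])
  moreover have "(1 - 1 / (1 + \<beta> * x)) / (2 * \<beta>) = x / (2 * (1 + \<beta> * x))"
  proof -
    have "1 - 1 / (1 + \<beta> * x) = \<beta> * x / (1 + \<beta> * x)" using assms by (simp add: field_simps)
    then show ?thesis using False by simp
  qed
  ultimately show ?thesis by simp
qed

lemma DERIV_w_up:
  assumes "0 < 1 + \<beta> * x" "0 < x"
  shows "(w_up \<beta> \<nu> has_real_derivative - 1 / (x * (1 + \<beta> * x))) (at x)"
proof -
  have "((\<lambda>x. ln (1 + \<beta> * x) - ln \<nu> - ln x) has_real_derivative \<beta> / (1 + \<beta> * x) - 1 / x) (at x)"
    using assms by (auto intro!: derivative_eq_intros)
  moreover have "\<beta> / (1 + \<beta> * x) - 1 / x = - 1 / (x * (1 + \<beta> * x))"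
    using assms by (simp add: field_simps)
  moreover have "w_up \<beta> \<nu> = (\<lambda>x. ln (1 + \<beta> * x) - ln \<nu> - ln x)" by (simp add: w_up_def fun_eq_iff)
  ultimately show ?thesis by simp
qed

lemma DERIV_A_up:
  assumes "0 < 1 + \<beta> * x" "0 < x"
  shows "(A_up \<beta> \<nu> has_real_derivative w_up \<beta> \<nu> x) (at x)"
proof -
  have "((\<lambda>x. x * w_up \<beta> \<nu> x + L_up \<beta> x) has_real_derivative
      1 * w_up \<beta> \<nu> x + - 1 / (x * (1 + \<beta> * x)) * x + 1 / (1 + \<beta> * x)) (at x)"
    by (intro DERIV_add DERIV_mult DERIV_ident DERIV_w_up[OF assms] DERIV_L_up[OF assms(1)])
  moreover have "- 1 / (x * (1 + \<beta> * x)) * x + 1 / (1 + \<beta> * x) = 0"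
    using assms by simp
  moreover have "A_up \<beta> \<nu> = (\<lambda>x. x * w_up \<beta> \<nu> x + L_up \<beta> x)" by (simp add: A_up_def fun_eq_iff)
  ultimately show ?thesis by (simp only: add.assoc mult_1 add_0_right)
qed

lemma DERIV_B_up:
  assumes "0 < 1 + \<beta> * x" "0 < x"
  shows "(B_up \<beta> \<nu> has_real_derivative x * w_up \<beta> \<nu> x) (at x)"
proof -
  have "((\<lambda>x. x\<^sup>2 / 2) has_real_derivative x) (at x)" by (auto intro!: derivative_eq_intros)
  then have "((\<lambda>x. x\<^sup>2 / 2 * w_up \<beta> \<nu> x + M_up \<beta> x) has_real_derivative
      x * w_up \<beta> \<nu> x + - 1 / (x * (1 + \<beta> * x)) * (x\<^sup>2 / 2) + x / (2 * (1 + \<beta> * x))) (at x)"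
    by (intro DERIV_add DERIV_mult DERIV_w_up[OF assms] DERIV_M_up[OF assms(1)])
  moreover have "- 1 / (x * (1 + \<beta> * x)) * (x\<^sup>2 / 2) + x / (2 * (1 + \<beta> * x)) = 0"
    using assms by (simp add: power2_eq_square)
  moreover have "B_up \<beta> \<nu> = (\<lambda>x. x\<^sup>2 / 2 * w_up \<beta> \<nu> x + M_up \<beta> x)" by (simp add: B_up_def fun_eq_iff)
  ultimately show ?thesis by (simp only: add.assoc add_0_right)
qed

lemma A_up_0 [simp]: "A_up \<beta> \<nu> 0 = 0" and B_up_0 [simp]: "B_up \<beta> \<nu> 0 = 0"
  by (simp_all add: A_up_def B_up_def L_up_def M_up_def)

text \<open>\<open>\<beta>\<close> stands for \<open>1 / k\<close>, so that infinite
  \<open>k\<close> is the ordinary value 0. \<open>end_slope\<close> says \<open>w = 1\<close> at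
  \<open>b\<close>, the condition of a free end point; \<open>time\<close> says that the motion
  \<open>(1 + \<beta> x) dx = \<nu> d\<sigma>\<close> from 0 reaches \<open>b\<close> at time
  1.\<close>

locale up_params =
  fixes \<beta> \<nu> b :: real
  assumes b_pos: "0 < b" and \<nu>_pos: "0 < \<nu>"
    and end_slope: "\<beta> + 1 / b = e * \<nu>"
    and time: "b + \<beta> * b\<^sup>2 / 2 = \<nu>"
begin

text \<open>The line \<open>1 + \<beta> x\<close> and the ray \<open>e \<nu> x\<close> meet at
  \<open>b\<close>, and at 0 the line is higher. Hence \<open>w \<ge> 1\<close> up to
  \<open>b\<close>, and the constraint \<open>x p \<le> 1\<close> stays inactive.\<close>

lemma y_ge:
  assumes "0 < x" "x \<le> b"
  shows "e * \<nu> * x \<le> 1 + \<beta> * x"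
proof -
  have "e * \<nu> * x = \<beta> * x + x / b" using end_slope by (metis distrib_right times_divide_eq_left mult_1)
  moreover have "x / b \<le> 1" using assms by simp
  ultimately show ?thesis by simp
qed

lemma y_pos:
  assumes "0 \<le> x" "x \<le> b"
  shows "0 < 1 + \<beta> * x"
proof (cases "x = 0")
  case False
  then have "0 < e * \<nu> * x" using \<nu>_pos assms by simp
  then show ?thesis using y_ge[of x] assms False by simp
qed simp

lemma w_ge_1:
  assumes "0 < x" "x \<le> b"
  shows "1 \<le> w_up \<beta> \<nu> x"
proof -
  have "ln (e * \<nu> * x) \<le> ln (1 + \<beta> * x)" using y_ge[OF assms] y_pos[of x] assms \<nu>_pos by simp
  then show ?thesis using assms \<nu>_pos by (simp add: w_up_def ln_mult)
qed

lemma y_b: "1 + \<beta> * b = e * \<nu> * b"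
  using end_slope b_pos by (simp add: field_simps)

lemma w_b: "w_up \<beta> \<nu> b = 1"
  unfolding w_up_def y_b using b_pos \<nu>_pos by (simp add: ln_mult)

lemma A_up_b: "A_up \<beta> \<nu> b = b + L_up \<beta> b" and B_up_b: "B_up \<beta> \<nu> b = b\<^sup>2 / 2 + M_up \<beta> b"
  by (simp_all add: A_up_def B_up_def w_b)

lemma isCont_of_y_pos:
  assumes "0 < 1 + \<beta> * x"
  shows "isCont (L_up \<beta>) x" "isCont (M_up \<beta>) x"
  using DERIV_isCont[OF DERIV_L_up[OF assms]] DERIV_isCont[OF DERIV_M_up[OF assms]] by auto

lemma continuous_L_M: "continuous_on {0..b} (L_up \<beta>)" "continuous_on {0..b} (M_up \<beta>)"
  using isCont_of_y_pos y_pos by (auto intro!: continuous_at_imp_continuous_on)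

text \<open>\<open>w\<close> tends to infinity at 0, so its singular part is isolated as
  \<open>x ln x\<close>.\<close>

lemma continuous_x_w: "continuous_on {0..b} (\<lambda>x. x * w_up \<beta> \<nu> x)"
proof -
  have "continuous_on {0..b} (\<lambda>x. x * (ln (1 + \<beta> * x) - ln \<nu>) - x * ln x)"
    using y_pos
    by (intro continuous_on_diff continuous_on_subset[OF continuous_on_x_ln_x] continuous_intros)
      (auto simp: less_imp_neq[symmetric])
  moreover have "x * w_up \<beta> \<nu> x = x * (ln (1 + \<beta> * x) - ln \<nu>) - x * ln x" for x
    by (simp add: w_up_def algebra_simps)
  ultimately show ?thesis by simp
qed

lemma continuous_A: "continuous_on {0..b} (A_up \<beta> \<nu>)"
  unfolding A_up_def[abs_def] by (intro continuous_on_add continuous_x_w continuous_L_M)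

lemma continuous_B: "continuous_on {0..b} (B_up \<beta> \<nu>)"
proof -
  have "continuous_on {0..b} (\<lambda>x. x / 2 * (x * w_up \<beta> \<nu> x) + M_up \<beta> x)"
    by (intro continuous_on_add continuous_on_mult[OF _ continuous_x_w] continuous_L_M) (auto intro!: continuous_intros)
  moreover have "B_up \<beta> \<nu> = (\<lambda>x. x / 2 * (x * w_up \<beta> \<nu> x) + M_up \<beta> x)"
    by (simp add: B_up_def fun_eq_iff power2_eq_square)
  ultimately show ?thesis by simp
qed

text \<open>Beyond \<open>b\<close> the weight of the dual function vanishes: there, the entropy gained is at most the
  price \<open>\<nu>\<close> of time.\<close>

lemma upper_bound:
  assumes "f \<in> admissible"
  shows "J_fun f / sqrt 2 + \<beta> * I_fun f \<le> A_up \<beta> \<nu> b + \<beta> * B_up \<beta> \<nu> b"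
proof -
  from assms obtain N where "admissible_off f N" by (rule admissible_offE)
  then interpret admissible_off f N .
  \<comment> \<open>\<open>A_up + \<beta> B_up\<close> is a primitive of
    \<open>(1 + \<beta> x) w\<close>, and the last bracket is one of \<open>1 + \<beta> x\<close>;
    so \<open>\<Psi>\<close> is a primitive of the Legendre transform \<open>\<psi>\<close>.\<close>
  define \<Psi> where "\<Psi> x = A_up \<beta> \<nu> x + \<beta> * B_up \<beta> \<nu> x - (x + \<beta> * x\<^sup>2 / 2)" for x
  define \<psi> where "\<psi> x = (1 + \<beta> * x) * (w_up \<beta> \<nu> x - 1)" for x
  define \<Phi> where "\<Phi> x = (if x \<le> b then \<Psi> x else \<Psi> b)" for x
  define \<phi> where "\<phi> x = (if x \<le> b then \<psi> x else 0)" for x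
  have d\<Psi>: "(\<Psi> has_real_derivative \<psi> x) (at x)" if x: "0 < x" "x \<le> b" for x
  proof -
    have "0 < 1 + \<beta> * x" using y_pos x by simp
    note dA = DERIV_A_up[OF this x(1), of \<nu>] and dB = DERIV_B_up[OF this x(1), of \<nu>]
    have "(\<Psi> has_real_derivative w_up \<beta> \<nu> x + \<beta> * (x * w_up \<beta> \<nu> x) - (1 + \<beta> * x)) (at x)"
      unfolding \<Psi>_def by (auto intro!: derivative_eq_intros dA dB)
    then show ?thesis by (simp add: \<psi>_def algebra_simps)
  qed
  have cont\<Psi>: "continuous_on {0..b} \<Psi>"
    unfolding \<Psi>_def by (auto intro!: continuous_intros continuous_A continuous_B)
  have \<psi>_nonneg: "0 \<le> \<psi> x" if "0 < x" "x \<le> b" for x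
    using w_ge_1[OF that] y_pos[of x] that by (simp add: \<psi>_def)
  have \<psi>_b: "\<psi> b = 0" by (simp add: \<psi>_def w_b)
  have "J_fun f / sqrt 2 + \<beta> * I_fun f = 1 * (J_fun f / sqrt 2) + \<beta> * I_fun f" by simp
  also have "\<dots> \<le> \<nu> + (\<Phi> (f 1) - \<Phi> 0)"
  proof (rule dual_bound[where \<phi> = \<phi> and C = 0])
    show "continuous_on {0..} \<Phi>"
      unfolding \<Phi>_def by (rule continuous_on_cases_le) (auto intro!: continuous_intros continuous_on_subset[OF cont\<Psi>])
    show "(\<Phi> has_real_derivative \<phi> x) (at x)" if "0 < x" for x
      unfolding \<Phi>_def \<phi>_def by (rule DERIV_if_le) (use that d\<Psi> \<psi>_b in auto)
    have "continuous_on {0<..b} \<psi>"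
      unfolding \<psi>_def w_up_def using y_pos
      by (intro continuous_intros) (auto simp: less_imp_neq[symmetric])
    then show "continuous_on {0<..} \<phi>"
      unfolding \<phi>_def by (intro continuous_on_cases_le) (auto intro!: continuous_intros simp: \<psi>_b elim: continuous_on_subset)
    show "- 0 * x \<le> \<phi> x" if "0 < x" for x using \<psi>_nonneg that by (simp add: \<phi>_def)
    fix x p :: real assume x: "0 < x" and p: "0 \<le> p" "x * p \<le> 1"
    show "- (1 + \<beta> * x) * (p * ln (x * p)) \<le> \<nu> + \<phi> x * p"
    proof (cases "x \<le> b")
      case True
      have "0 < 1 + \<beta> * x" using y_pos x True by simp
      with weighted_entropy_le[OF this x p(1) \<nu>_pos] show ?thesis
        using True x \<nu>_pos by (simp add: \<phi>_def \<psi>_def w_up_def ln_div ln_mult algebra_simps)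
    next
      case False
      have "0 \<le> x * p" using x p by simp
      have ln: "0 \<le> - (x * p * ln (x * p))"
      proof (cases "x * p = 0")
        case False
        then have "0 < x * p" using \<open>0 \<le> x * p\<close> by linarith
        then have "ln (x * p) \<le> 0" using p(2) by (simp only: ln_le_zero_iff)
        then have "x * p * ln (x * p) \<le> 0" using \<open>0 \<le> x * p\<close> by (rule mult_nonneg_nonpos[rotated])
        then show ?thesis by simp
      qed auto
      \<comment> \<open>Whatever the sign of \<open>\<beta>\<close>, the quotient
        \<open>y / x\<close> decreases and equals \<open>e \<nu>\<close> at \<open>b\<close>.
        Negative \<open>y\<close> is covered too, because the quotient multiplies a nonnegative
        entropy.\<close>
      have "(1 + \<beta> * x) / x = 1 / x + \<beta>" using x by (simp add: field_simps)
      also have "\<dots> \<le> 1 / b + \<beta>" using False b_pos by (intro add_right_mono divide_left_mono) auto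
      also have "\<dots> = e * \<nu>" using end_slope by simp
      finally have ratio: "(1 + \<beta> * x) / x \<le> e * \<nu>" .
      have "- (1 + \<beta> * x) * (p * ln (x * p)) = - ((1 + \<beta> * x) * (p * ln (x * p)))"
        by (rule mult_minus_left)
      also have "\<dots> = (1 + \<beta> * x) / x * (- (x * p * ln (x * p)))"
        using x by simp
      also have "\<dots> \<le> e * \<nu> * (- (x * p * ln (x * p)))"
        by (rule mult_right_mono[OF ratio ln])
      also have "\<dots> \<le> e * \<nu> * (1 / e)"
        using neg_x_ln_x_le[OF \<open>0 \<le> x * p\<close>, of "1 / e"] \<nu>_pos
        by (intro mult_left_mono) (auto simp: ln_div)
      finally show ?thesis using False by (simp add: \<phi>_def)
    qed
  qed (use \<nu>_pos in auto)
  also have "\<Phi> (f 1) \<le> \<Psi> b"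
  proof (cases "f 1 \<le> b")
    case True
    have "\<Psi> (f 1) \<le> \<Psi> b"
    proof (rule DERIV_nonneg_imp_increasing_open[OF True, where f = \<Psi>])
      fix x assume "f 1 < x" "x < b"
      then have "0 < x" "x \<le> b" using nonneg[of 1] by auto
      then show "\<exists>y. (\<Psi> has_real_derivative y) (at x) \<and> 0 \<le> y" using d\<Psi> \<psi>_nonneg by blast
    qed (use nonneg[of 1] in \<open>auto intro!: continuous_on_subset[OF cont\<Psi>]\<close>)
    then show ?thesis using True by (simp add: \<Phi>_def)
  qed (simp add: \<Phi>_def)
  also have "\<Phi> 0 = 0" using b_pos by (simp add: \<Phi>_def \<Psi>_def)
  \<comment> \<open>By \<open>time\<close>, the bracket subtracted in \<open>\<Psi> b\<close> is
    exactly the price \<open>\<nu>\<close>.\<close>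
  finally show ?thesis using time by (simp add: \<Psi>_def)
qed

text \<open>The solution of \<open>lam + \<beta> lam^2 / 2 = \<nu> \<sigma>\<close> that starts at
  0, with the root in the denominator: one expression serves positive, negative and vanishing
  \<open>\<beta>\<close>.\<close>

definition lam :: "real \<Rightarrow> real" where
  "lam \<sigma> = 2 * \<nu> * \<sigma> / (1 + sqrt (1 + 2 * \<beta> * \<nu> * \<sigma>))"

text \<open>The radicand is affine in \<open>\<sigma>\<close>, equal to 1 at time 0 and, by
  \<open>time\<close>, to \<open>(1 + \<beta> b)^2\<close> at time 1; so it is a convex combination
  of positive numbers.\<close>

lemma root_arg:
  assumes "\<sigma> \<in> {0..1}"
  shows "0 < 1 + 2 * \<beta> * \<nu> * \<sigma>"
proof -
  have eq: "1 + 2 * \<beta> * \<nu> = (1 + \<beta> * b)\<^sup>2"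
    unfolding time[symmetric] by (simp add: power2_eq_square algebra_simps)
  have sq: "0 < (1 + \<beta> * b)\<^sup>2" using y_pos[of b] b_pos by simp
  have convex: "0 < (1 - \<sigma>) + \<sigma> * S" if "0 < S" for S
    using assms that by (cases "\<sigma> = 1") (auto intro: add_pos_nonneg)
  have "1 + 2 * \<beta> * \<nu> * \<sigma> = (1 - \<sigma>) + \<sigma> * (1 + \<beta> * b)\<^sup>2"
    unfolding eq[symmetric] by (simp add: algebra_simps)
  also have "0 < \<dots>" by (rule convex[OF sq])
  finally show ?thesis .
qed

lemma lam_1: "lam 1 = b"
proof -
  have eq: "1 + 2 * \<beta> * \<nu> = (1 + \<beta> * b)\<^sup>2"
    unfolding time[symmetric] by (simp add: power2_eq_square algebra_simps)
  have "0 < 1 + \<beta> * b" using y_pos[of b] b_pos by simp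
  then have "lam 1 = 2 * \<nu> / (2 + \<beta> * b)" using eq by (simp add: lam_def)
  also have "\<dots> = b" unfolding time[symmetric] using \<open>0 < 1 + \<beta> * b\<close> by (simp add: power2_eq_square field_simps)
  finally show ?thesis .
qed

lemma y_lam:
  assumes "\<sigma> \<in> {0..1}"
  shows "1 + \<beta> * lam \<sigma> = sqrt (1 + 2 * \<beta> * \<nu> * \<sigma>)"
proof -
  define R where "R = sqrt (1 + 2 * \<beta> * \<nu> * \<sigma>)"
  have R: "0 < R" "R\<^sup>2 = 1 + 2 * \<beta> * \<nu> * \<sigma>" using root_arg[OF assms] by (auto simp: R_def)
  have "lam \<sigma> = 2 * \<nu> * \<sigma> / (1 + R)" unfolding lam_def R_def ..
  then have "(1 + \<beta> * lam \<sigma>) * (1 + R) = 1 + R + (R\<^sup>2 - 1)"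
    unfolding R(2) using R(1) by (simp add: field_simps)
  also have "\<dots> = R * (1 + R)" by (simp add: power2_eq_square algebra_simps)
  finally show ?thesis using R by (simp add: R_def[symmetric])
qed

text \<open>The slope law \<open>y p = \<nu>\<close>, the case of equality in
  \<open>weighted_entropy_le\<close>.\<close>

lemma DERIV_lam:
  assumes "\<sigma> \<in> {0..1}"
  shows "(lam has_real_derivative \<nu> / (1 + \<beta> * lam \<sigma>)) (at \<sigma>)"
proof -
  define R where "R = sqrt (1 + 2 * \<beta> * \<nu> * \<sigma>)"
  have R: "0 < R" "R\<^sup>2 = 1 + 2 * \<beta> * \<nu> * \<sigma>" using root_arg[OF assms] by (auto simp: R_def)
  have dR: "((\<lambda>\<sigma>. sqrt (1 + 2 * \<beta> * \<nu> * \<sigma>)) has_real_derivative \<beta> * \<nu> / R) (at \<sigma>)"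
    using root_arg[OF assms] R(1) by (auto intro!: derivative_eq_intros simp: R_def field_simps)
  have "(lam has_real_derivative (2 * \<nu> * (1 + R) - 2 * \<nu> * \<sigma> * (\<beta> * \<nu> / R)) / ((1 + R) * (1 + R))) (at \<sigma>)"
  proof -
    have d1: "((\<lambda>\<sigma>. 2 * \<nu> * \<sigma>) has_real_derivative 2 * \<nu>) (at \<sigma>)"
      by (auto intro!: derivative_eq_intros)
    have d2: "((\<lambda>\<sigma>. 1 + sqrt (1 + 2 * \<beta> * \<nu> * \<sigma>)) has_real_derivative \<beta> * \<nu> / R) (at \<sigma>)"
      using DERIV_add[OF DERIV_const dR] by simp
    have "1 + sqrt (1 + 2 * \<beta> * \<nu> * \<sigma>) \<noteq> 0" using R(1) unfolding R_def by linarith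
    from DERIV_divide[OF d1 d2 this] show ?thesis
      unfolding lam_def[abs_def] R_def[symmetric] .
  qed
  moreover have "(2 * \<nu> * (1 + R) - 2 * \<nu> * \<sigma> * (\<beta> * \<nu> / R)) / ((1 + R) * (1 + R)) = \<nu> / R"
  proof -
    have "2 * \<nu> * (1 + R) - 2 * \<nu> * \<sigma> * (\<beta> * \<nu> / R) = \<nu> * (2 * R * (1 + R) - (R\<^sup>2 - 1)) / R"
      unfolding R(2) using R(1) by (simp add: field_simps)
    also have "2 * R * (1 + R) - (R\<^sup>2 - 1) = (1 + R) * (1 + R)" by (simp add: power2_eq_square algebra_simps)
    finally show ?thesis using R(1) by simp
  qed
  ultimately show ?thesis using y_lam[OF assms] by (simp add: R_def)
qed

lemma lam_pos:
  assumes "\<sigma> \<in> {0<..1}"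
  shows "0 < lam \<sigma>"
proof -
  have "0 < sqrt (1 + 2 * \<beta> * \<nu> * \<sigma>)" using root_arg[of \<sigma>] assms by simp
  then show ?thesis using assms \<nu>_pos unfolding lam_def
    by (intro divide_pos_pos mult_pos_pos add_pos_pos) auto
qed

lemma lam_le:
  assumes "\<sigma> \<in> {0..1}"
  shows "lam \<sigma> \<le> b"
proof -
  have "lam \<sigma> \<le> lam 1"
  proof (rule DERIV_nonneg_imp_nondecreasing[where f = lam])
    fix x assume "\<sigma> \<le> x" "x \<le> 1"
    then have x: "x \<in> {0..1}" using assms by auto
    then have "0 \<le> \<nu> / (1 + \<beta> * lam x)" using y_lam[OF x] root_arg[OF x] \<nu>_pos by simp
    then show "\<exists>y. (lam has_real_derivative y) (at x) \<and> 0 \<le> y" using DERIV_lam[OF x] by blast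
  qed (use assms in auto)
  then show ?thesis by (simp add: lam_1)
qed

text \<open>Along \<open>lam\<close> the slope law turns \<open>- ln (f f')\<close> into
  \<open>w_up\<close>, so \<open>A_up\<close> and \<open>B_up\<close> composed with
  \<open>lam\<close> are the antiderivatives in question. Agreement on \<open>{0..1}\<close>
  suffices, as derivatives are compared on the open interval.\<close>

lemma candidate:
  assumes eq: "\<And>\<sigma>. \<sigma> \<in> {0..1} \<Longrightarrow> f \<sigma> = lam \<sigma>"
  shows "f \<in> admissible" "J_fun f = sqrt 2 * A_up \<beta> \<nu> b" "I_fun f = B_up \<beta> \<nu> b"
proof -
  define f' where "f' \<sigma> = \<nu> / (1 + \<beta> * lam \<sigma>)" for \<sigma>
  have cont: "continuous_on {0..1} lam"
    by (intro continuous_at_imp_continuous_on ballI DERIV_isCont[OF DERIV_lam])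
  have range: "lam \<sigma> \<in> {0..b}" if "\<sigma> \<in> {0..1}" for \<sigma>
    using lam_pos[of \<sigma>] lam_le[OF that] that b_pos by (cases "\<sigma> = 0") (auto simp: lam_def)
  have der: "(f has_real_derivative f' \<sigma>) (at \<sigma>)" if "\<sigma> \<in> {0<..<1} - {}" for \<sigma>
    unfolding f'_def
    by (rule has_field_derivative_transform_within_open[OF DERIV_lam, of _ "{0<..<1}"]) (use that eq in auto)
  have basic: "0 < lam \<sigma>" "lam \<sigma> \<le> b" "0 < 1 + \<beta> * lam \<sigma>" "0 < f' \<sigma>" if "\<sigma> \<in> {0<..<1} - {}" for \<sigma>
  proof -
    show pos: "0 < lam \<sigma>" and le: "lam \<sigma> \<le> b" using that lam_pos[of \<sigma>] lam_le[of \<sigma>] by auto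
    then show y: "0 < 1 + \<beta> * lam \<sigma>" using y_pos by simp
    then show "0 < f' \<sigma>" using \<nu>_pos by (simp add: f'_def)
  qed
  have ln: "ln (lam \<sigma> * f' \<sigma>) = - w_up \<beta> \<nu> (lam \<sigma>)" if "\<sigma> \<in> {0<..<1} - {}" for \<sigma>
    using basic[OF that] \<nu>_pos by (simp add: f'_def w_up_def ln_div ln_mult)
  have le1: "f \<sigma> * f' \<sigma> \<le> 1" if "\<sigma> \<in> {0<..<1} - {}" for \<sigma>
  proof -
    have "ln (lam \<sigma> * f' \<sigma>) \<le> 0" using ln[OF that] w_ge_1[OF basic(1,2)[OF that]] by simp
    then have "lam \<sigma> * f' \<sigma> \<le> 1" using basic[OF that] by (subst (asm) ln_le_zero_iff) auto
    then show ?thesis using eq[of \<sigma>] that by simp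
  qed
  have cf: "continuous_on {0..1} f" using cont eq by (metis (no_types, lifting) continuous_on_cong)
  have cA: "continuous_on {0..1} (\<lambda>\<sigma>. A_up \<beta> \<nu> (lam \<sigma>))" and cB: "continuous_on {0..1} (\<lambda>\<sigma>. B_up \<beta> \<nu> (lam \<sigma>))"
    by (rule continuous_on_compose2[OF continuous_A cont] continuous_on_compose2[OF continuous_B cont];
      use range in blast)+
  have dA: "((\<lambda>\<sigma>. A_up \<beta> \<nu> (lam \<sigma>)) has_real_derivative - (f' \<sigma> * ln (f \<sigma> * f' \<sigma>))) (at \<sigma>)"
    and dB: "((\<lambda>\<sigma>. B_up \<beta> \<nu> (lam \<sigma>)) has_real_derivative - (f \<sigma> * f' \<sigma> * ln (f \<sigma> * f' \<sigma>))) (at \<sigma>)"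
    if "\<sigma> \<in> {0<..<1} - {}" for \<sigma>
  proof -
    have \<sigma>: "\<sigma> \<in> {0..1}" using that by auto
    note d = DERIV_lam[OF \<sigma>, folded f'_def]
    show "((\<lambda>\<sigma>. A_up \<beta> \<nu> (lam \<sigma>)) has_real_derivative - (f' \<sigma> * ln (f \<sigma> * f' \<sigma>))) (at \<sigma>)"
      unfolding eq[OF \<sigma>] ln[OF that]
      using DERIV_chain2[OF DERIV_A_up[OF basic(3,1)[OF that]] d] by (simp add: mult.commute)
    show "((\<lambda>\<sigma>. B_up \<beta> \<nu> (lam \<sigma>)) has_real_derivative - (f \<sigma> * f' \<sigma> * ln (f \<sigma> * f' \<sigma>))) (at \<sigma>)"
      unfolding eq[OF \<sigma>] ln[OF that]
      using DERIV_chain2[OF DERIV_B_up[OF basic(3,1)[OF that]] d] by (simp add: mult_ac)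
  qed
  have f0: "f 0 = 0" using eq[of 0] by (simp add: lam_def)
  have fpos: "0 < f \<sigma>" if "\<sigma> \<in> {0<..<1} - {}" for \<sigma> using basic(1)[OF that] eq[of \<sigma>] that by simp
  note explicit = admissible_explicit[OF finite.emptyI cf f0 der less_imp_le[OF basic(4)] fpos le1 cA dA cB dB]
  show "f \<in> admissible" by (rule explicit(1))
  show "J_fun f = sqrt 2 * A_up \<beta> \<nu> b" using explicit(2) by (simp add: lam_1) (simp add: lam_def)
  show "I_fun f = B_up \<beta> \<nu> b" using explicit(3) by (simp add: lam_1) (simp add: lam_def)
qed

end

section \<open>The lower bound\<close>

text \<open>The unconstrained optimal \<open>w\<close> for the weight \<open>x - \<kappa>\<close>
  and the time price \<open>c\<close>: it solves \<open>c x exp w = x - \<kappa>\<close>.\<close>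

definition w_lo :: "real \<Rightarrow> real \<Rightarrow> real \<Rightarrow> real" where
  "w_lo \<kappa> c x = ln (x - \<kappa>) - ln c - ln x"

definition A_lo :: "real \<Rightarrow> real \<Rightarrow> real \<Rightarrow> real" where
  "A_lo \<kappa> c x = x * w_lo \<kappa> c x - \<kappa> * ln (x - \<kappa>)"

definition B_lo :: "real \<Rightarrow> real \<Rightarrow> real \<Rightarrow> real" where
  "B_lo \<kappa> c x = x\<^sup>2 / 2 * w_lo \<kappa> c x - \<kappa> / 2 * (x + \<kappa> * ln (x - \<kappa>))"

text \<open>A primitive of the Legendre transform \<open>(x - \<kappa>) (w - 1)\<close>.\<close>

definition Q_lo :: "real \<Rightarrow> real \<Rightarrow> real \<Rightarrow> real" where
  "Q_lo \<kappa> c x = (x - \<kappa>)\<^sup>2 / 2 * (w_lo \<kappa> c x - 1) - (\<kappa> * x - \<kappa>\<^sup>2 * ln x) / 2"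

text \<open>The dual bound \<open>c + \<Phi> x\<close> at the end point \<open>x\<close>, with
  \<open>c = (1 - \<kappa> / x) / e\<close> and \<open>a = \<kappa> / (1 - c)\<close>
  eliminated.\<close>

definition G_lo :: "real \<Rightarrow> real \<Rightarrow> real" where
  "G_lo \<kappa> x = (1 - \<kappa> / x) / e + \<kappa>\<^sup>2 / 2 - \<kappa> * x / 2 + \<kappa>\<^sup>2 / 2 * (ln ((e - 1) * x + \<kappa>) - 1 - ln \<kappa>)"

lemma e_gt_2: "2 < e"
  using exp_lower_Taylor_quadratic[of 1] by simp

lemma DERIV_w_lo:
  assumes "\<kappa> < x" "0 < x"
  shows "(w_lo \<kappa> c has_real_derivative \<kappa> / (x * (x - \<kappa>))) (at x)"
proof -
  have "((\<lambda>x. ln (x - \<kappa>) - ln c - ln x) has_real_derivative 1 / (x - \<kappa>) - 1 / x) (at x)"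
    using assms by (auto intro!: derivative_eq_intros)
  moreover have "1 / (x - \<kappa>) - 1 / x = \<kappa> / (x * (x - \<kappa>))"
    using assms by (simp add: field_simps)
  moreover have "w_lo \<kappa> c = (\<lambda>x. ln (x - \<kappa>) - ln c - ln x)" by (simp add: w_lo_def fun_eq_iff)
  ultimately show ?thesis by simp
qed

lemma DERIV_ln_shift:
  assumes "\<kappa> < (x::real)"
  shows "((\<lambda>x. ln (x - \<kappa>)) has_real_derivative 1 / (x - \<kappa>)) (at x)"
  using assms by (auto intro!: derivative_eq_intros)

lemma DERIV_A_lo:
  assumes "\<kappa> < x" "0 < x"
  shows "(A_lo \<kappa> c has_real_derivative w_lo \<kappa> c x) (at x)"
proof -
  have "((\<lambda>x. x * w_lo \<kappa> c x - \<kappa> * ln (x - \<kappa>)) has_real_derivative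
      1 * w_lo \<kappa> c x + \<kappa> / (x * (x - \<kappa>)) * x - \<kappa> * (1 / (x - \<kappa>))) (at x)"
    by (intro DERIV_diff DERIV_mult DERIV_ident DERIV_cmult DERIV_w_lo[OF assms] DERIV_ln_shift[OF assms(1)])
  moreover have "\<kappa> / (x * (x - \<kappa>)) * x - \<kappa> * (1 / (x - \<kappa>)) = 0" using assms by simp
  moreover have "A_lo \<kappa> c = (\<lambda>x. x * w_lo \<kappa> c x - \<kappa> * ln (x - \<kappa>))" by (simp add: A_lo_def fun_eq_iff)
  ultimately show ?thesis by (simp add: algebra_simps)
qed

lemma DERIV_half_square: "((\<lambda>x. (x - \<kappa>)\<^sup>2 / 2) has_real_derivative (x - \<kappa>)) (at x)" for x \<kappa> :: real
  by (auto intro!: derivative_eq_intros)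

lemma DERIV_B_lo:
  assumes "\<kappa> < x" "0 < x"
  shows "(B_lo \<kappa> c has_real_derivative x * w_lo \<kappa> c x) (at x)"
proof -
  have "((\<lambda>x. x\<^sup>2 / 2) has_real_derivative x) (at x)" using DERIV_half_square[of 0 x] by simp
  then have "((\<lambda>x. x\<^sup>2 / 2 * w_lo \<kappa> c x - \<kappa> / 2 * (x + \<kappa> * ln (x - \<kappa>))) has_real_derivative
      x * w_lo \<kappa> c x + \<kappa> / (x * (x - \<kappa>)) * (x\<^sup>2 / 2) - \<kappa> / 2 * (1 + \<kappa> * (1 / (x - \<kappa>)))) (at x)"
    by (intro DERIV_diff DERIV_mult DERIV_add DERIV_ident DERIV_cmult DERIV_w_lo[OF assms] DERIV_ln_shift[OF assms(1)])
  moreover have "\<kappa> / (x * (x - \<kappa>)) * (x\<^sup>2 / 2) - \<kappa> / 2 * (1 + \<kappa> * (1 / (x - \<kappa>))) = 0"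
  proof -
    have "\<kappa> / (x * (x - \<kappa>)) * (x\<^sup>2 / 2) = \<kappa> / 2 * (x / (x - \<kappa>))" using assms by (simp add: power2_eq_square)
    moreover have "1 + \<kappa> * (1 / (x - \<kappa>)) = x / (x - \<kappa>)" using assms by (simp add: field_simps)
    ultimately show ?thesis by simp
  qed
  moreover have "B_lo \<kappa> c = (\<lambda>x. x\<^sup>2 / 2 * w_lo \<kappa> c x - \<kappa> / 2 * (x + \<kappa> * ln (x - \<kappa>)))"
    by (simp add: B_lo_def fun_eq_iff)
  ultimately show ?thesis by (simp add: algebra_simps)
qed

lemma DERIV_Q_lo:
  assumes "\<kappa> < x" "0 < x"
  shows "(Q_lo \<kappa> c has_real_derivative (x - \<kappa>) * (w_lo \<kappa> c x - 1)) (at x)"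
proof -
  have dln: "(ln has_real_derivative 1 / x) (at x)" using DERIV_ln[OF assms(2)] by (simp add: inverse_eq_divide)
  have "((\<lambda>x. (x - \<kappa>)\<^sup>2 / 2 * (w_lo \<kappa> c x - 1) - (\<kappa> * x - \<kappa>\<^sup>2 * ln x) / 2) has_real_derivative
      (x - \<kappa>) * (w_lo \<kappa> c x - 1) + (\<kappa> / (x * (x - \<kappa>)) - 0) * ((x - \<kappa>)\<^sup>2 / 2) - (\<kappa> * 1 - \<kappa>\<^sup>2 * (1 / x)) / 2) (at x)"
    by (intro DERIV_diff DERIV_mult DERIV_half_square DERIV_cdivide DERIV_const DERIV_ident DERIV_cmult DERIV_w_lo[OF assms] dln)
  moreover have "(\<kappa> / (x * (x - \<kappa>)) - 0) * ((x - \<kappa>)\<^sup>2 / 2) - (\<kappa> * 1 - \<kappa>\<^sup>2 * (1 / x)) / 2 = 0"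
    using assms by (simp add: power2_eq_square field_simps)
  then have "(x - \<kappa>) * (w_lo \<kappa> c x - 1) + (\<kappa> / (x * (x - \<kappa>)) - 0) * ((x - \<kappa>)\<^sup>2 / 2) -
      (\<kappa> * 1 - \<kappa>\<^sup>2 * (1 / x)) / 2 = (x - \<kappa>) * (w_lo \<kappa> c x - 1)" by linarith
  moreover have "Q_lo \<kappa> c = (\<lambda>x. (x - \<kappa>)\<^sup>2 / 2 * (w_lo \<kappa> c x - 1) - (\<kappa> * x - \<kappa>\<^sup>2 * ln x) / 2)"
    by (simp add: Q_lo_def fun_eq_iff)
  ultimately show ?thesis by metis
qed

text \<open>With this \<open>c\<close>, \<open>w\<close> is 1 at the end point and 0 at
  \<open>a\<close>, so of all logarithms only \<open>ln x - ln a\<close> remains.\<close>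

lemma G_lo_eq:
  assumes "0 < \<kappa>" "\<kappa> < x" "c = (x - \<kappa>) / (e * x)" "a = \<kappa> / (1 - c)"
  shows "c + (Q_lo \<kappa> c x - Q_lo \<kappa> c a - c * a\<^sup>2 / 2) = G_lo \<kappa> x"
proof -
  have x: "0 < x" using assms by simp
  have "0 < c" using assms x by simp
  moreover have "x - \<kappa> = e * c * x" "e * c = 1 - \<kappa> / x" using assms(1-3) x by (simp_all add: field_simps)
  ultimately have c: "0 < c" "x - \<kappa> = e * c * x" "e * c = 1 - \<kappa> / x" by auto
  have "e * c < 1" using c(3) assms x by simp
  moreover have "1 * c < e * c" using c(1) e_gt_2 by (intro mult_strict_right_mono) auto
  ultimately have "c < 1" by simp
  then have a: "0 < a" "a - \<kappa> = c * a" "\<kappa> = a * (1 - c)" using assms(1) \<open>c < 1\<close> by (simp_all add: assms(4) field_simps)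
  have wx: "w_lo \<kappa> c x = 1" unfolding w_lo_def c(2) using c(1) x by (simp add: ln_mult)
  have wa: "w_lo \<kappa> c a = 0" unfolding w_lo_def a(2) using c(1) a(1) by (simp add: ln_mult)
  \<comment> \<open>Origin of the logarithm in \<open>G_lo\<close>:
    \<open>x / a = x (1 - c) / \<kappa>\<close>, and \<open>x (1 - c)\<close> is affine in
    \<open>x\<close>.\<close>
  have x1c: "x * (1 - c) = ((e - 1) * x + \<kappa>) / e" using assms x by (simp add: field_simps)
  have "ln x + ln (1 - c) = ln (((e - 1) * x + \<kappa>) / e)"
  proof -
    have "ln (x * (1 - c)) = ln x + ln (1 - c)" using x \<open>c < 1\<close> by (simp add: ln_mult)
    with x1c show ?thesis by simp
  qed
  moreover have "0 < (e - 1) * x + \<kappa>" using e_gt_2 x assms(1) by (intro add_pos_pos mult_pos_pos) auto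
  ultimately have ln_x: "ln x + ln (1 - c) = ln ((e - 1) * x + \<kappa>) - 1" by (simp add: ln_div)
  have ln_a: "ln a = ln \<kappa> - ln (1 - c)" using assms \<open>c < 1\<close> by (simp add: ln_div)
  have "Q_lo \<kappa> c a = - (c * a)\<^sup>2 / 2 - (\<kappa> * a - \<kappa>\<^sup>2 * ln a) / 2" by (simp add: Q_lo_def wa a(2))
  moreover have "Q_lo \<kappa> c x = - (\<kappa> * x - \<kappa>\<^sup>2 * ln x) / 2"
    unfolding Q_lo_def wx diff_self mult_zero_right by linarith
  moreover have "(c * a)\<^sup>2 / 2 + \<kappa> * a / 2 - c * a\<^sup>2 / 2 = \<kappa>\<^sup>2 / 2"
    unfolding a(3) by (simp add: power2_eq_square field_simps)
  ultimately have "c + (Q_lo \<kappa> c x - Q_lo \<kappa> c a - c * a\<^sup>2 / 2) = c + \<kappa>\<^sup>2 / 2 - \<kappa> * x / 2 + (\<kappa>\<^sup>2 * ln x - \<kappa>\<^sup>2 * ln a) / 2"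
    by argo
  also have "\<dots> = c + \<kappa>\<^sup>2 / 2 - \<kappa> * x / 2 + \<kappa>\<^sup>2 / 2 * (ln x - ln a)"
    by (simp add: algebra_simps)
  also have "\<dots> = c + \<kappa>\<^sup>2 / 2 - \<kappa> * x / 2 + \<kappa>\<^sup>2 / 2 * (ln ((e - 1) * x + \<kappa>) - 1 - ln \<kappa>)"
    using ln_x by (simp add: ln_a)
  also have "\<dots> = G_lo \<kappa> x"
  proof -
    have "(1 - \<kappa> / x) / e = c" using c(3) by (simp add: field_simps)
    then show ?thesis by (simp only: G_lo_def)
  qed
  finally show ?thesis .
qed

text \<open>The derivative is \<open>\<kappa> / 2\<close> times a function \<open>g\<close> that
  decreases on the positive axis, so the zero of \<open>g\<close> at \<open>b\<close> separates
  growth from decay.\<close>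

lemma G_lo_max:
  assumes "0 < \<kappa>" "\<kappa> \<le> b" "\<kappa> \<le> x"
    and stationary: "2 / (e * b\<^sup>2) - 1 + \<kappa> * (e - 1) / ((e - 1) * b + \<kappa>) = 0"
  shows "G_lo \<kappa> x \<le> G_lo \<kappa> b"
proof -
  define g where "g x = 2 / (e * x\<^sup>2) - 1 + \<kappa> * (e - 1) / ((e - 1) * x + \<kappa>)" for x
  have der: "(G_lo \<kappa> has_real_derivative \<kappa> / 2 * g x) (at x)" if "0 < x" for x
  proof -
    have pos: "0 < (e - 1) * x + \<kappa>" using e_gt_2 that assms(1) by (intro add_pos_pos mult_pos_pos) auto
    have 1: "((\<lambda>x. (1 - \<kappa> / x) / e) has_real_derivative \<kappa> / (x * x) / e) (at x)"
      using that by (auto intro!: derivative_eq_intros)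
    have 2: "((\<lambda>x. \<kappa>\<^sup>2 / 2) has_real_derivative 0) (at x)" by simp
    have 3: "((\<lambda>x. \<kappa> * x / 2) has_real_derivative \<kappa> / 2) (at x)" by (auto intro!: derivative_eq_intros)
    have 4: "((\<lambda>x. \<kappa>\<^sup>2 / 2 * (ln ((e - 1) * x + \<kappa>) - 1 - ln \<kappa>)) has_real_derivative
        \<kappa>\<^sup>2 / 2 * ((e - 1) / ((e - 1) * x + \<kappa>))) (at x)"
    proof -
      have "((\<lambda>x. ln ((e - 1) * x + \<kappa>)) has_real_derivative (e - 1) / ((e - 1) * x + \<kappa>)) (at x)"
        using pos by (auto intro!: derivative_eq_intros)
      from DERIV_cmult[OF DERIV_diff[OF DERIV_diff[OF this DERIV_const] DERIV_const], of "\<kappa>\<^sup>2 / 2"]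
      show ?thesis by (simp only: diff_zero)
    qed
    have "(G_lo \<kappa> has_real_derivative \<kappa> / (x * x) / e + 0 - \<kappa> / 2 + \<kappa>\<^sup>2 / 2 * ((e - 1) / ((e - 1) * x + \<kappa>))) (at x)"
      unfolding G_lo_def[abs_def] by (intro DERIV_add DERIV_diff 1 2 3 4)
    moreover have "\<kappa> / (x * x) / e + 0 - \<kappa> / 2 + \<kappa>\<^sup>2 / 2 * ((e - 1) / ((e - 1) * x + \<kappa>)) = \<kappa> / 2 * g x"
    proof -
      have "\<kappa>\<^sup>2 / 2 * ((e - 1) / ((e - 1) * x + \<kappa>)) = \<kappa> / 2 * (\<kappa> * (e - 1) / ((e - 1) * x + \<kappa>))"
        by (simp add: power2_eq_square)
      moreover have "\<kappa> / (x * x) / e = \<kappa> / 2 * (2 / (e * x\<^sup>2))"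
        by (simp add: power2_eq_square)
      ultimately show ?thesis
        unfolding g_def distrib_left right_diff_distrib by linarith
    qed
    ultimately show ?thesis by metis
  qed
  have g_mono: "g v \<le> g u" if "0 < u" "u \<le> v" for u v
  proof -
    have pos: "0 < (e - 1) * u + \<kappa>" using e_gt_2 that assms(1) by (intro add_pos_pos mult_pos_pos) auto
    have le: "(e - 1) * u \<le> (e - 1) * v" using that e_gt_2 by (intro mult_left_mono) auto
    have pos': "0 < (e - 1) * v + \<kappa>" using pos le by linarith
    have "2 / (e * v\<^sup>2) \<le> 2 / (e * u\<^sup>2)"
      using that by (intro divide_left_mono mult_left_mono power_mono mult_pos_pos) auto
    moreover have "\<kappa> * (e - 1) / ((e - 1) * v + \<kappa>) \<le> \<kappa> * (e - 1) / ((e - 1) * u + \<kappa>)"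
      using assms(1) e_gt_2 le by (intro divide_left_mono mult_pos_pos[OF pos' pos]) auto
    ultimately show ?thesis by (simp add: g_def)
  qed
  have g_b: "g b = 0" using stationary by (simp add: g_def)
  show ?thesis
  proof (cases "x \<le> b")
    case True
    show ?thesis
    proof (rule DERIV_nonneg_imp_nondecreasing[OF True, where f = "G_lo \<kappa>"])
      fix t assume "x \<le> t" "t \<le> b"
      then have "0 < t" "0 \<le> \<kappa> / 2 * g t" using g_mono[of t b] g_b assms by auto
      then show "\<exists>y. (G_lo \<kappa> has_real_derivative y) (at t) \<and> 0 \<le> y" using der by blast
    qed
  next
    case False
    then have "b \<le> x" by simp
    then show ?thesis
    proof (rule DERIV_nonpos_imp_nonincreasing[where f = "G_lo \<kappa>"])
      fix t assume "b \<le> t" "t \<le> x"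
      then have "0 < t" "\<kappa> / 2 * g t \<le> 0"
        using g_mono[of b t] g_b assms by (auto intro: mult_nonneg_nonpos)
      then show "\<exists>y. (G_lo \<kappa> has_real_derivative y) (at t) \<and> y \<le> 0" using der by blast
    qed
  qed
qed

context admissible_off
begin

text \<open>The multiplier \<open>c\<close> is adapted to the end point \<open>f 1\<close>: the dual function is stationary
  there.\<close>

lemma lower_bound_G_lo:
  assumes \<kappa>: "0 < \<kappa>" "\<kappa> < f 1"
  shows "I_fun f - \<kappa> * (J_fun f / sqrt 2) \<le> G_lo \<kappa> (f 1)"
proof -
  define x1 where "x1 = f 1"
  define c where "c = (x1 - \<kappa>) / (e * x1)"
  define a where "a = \<kappa> / (1 - c)"
  have x1: "0 < x1" "\<kappa> < x1" using \<kappa> by (auto simp: x1_def)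
  have c: "0 < c" "e * c = 1 - \<kappa> / x1" "x1 - \<kappa> = e * c * x1"
    using x1 by (simp add: c_def, simp_all add: c_def field_simps)
  have "e * c < 1" using c(2) \<kappa>(1) x1 by simp
  moreover have ec: "1 * c < e * c" using c(1) e_gt_2 by (intro mult_strict_right_mono) auto
  ultimately have "c < 1" by simp
  then have a: "0 < a" "a - \<kappa> = c * a" "\<kappa> = a * (1 - c)" using \<kappa>(1) by (simp_all add: a_def field_simps)
  have "0 < c * a" using c a by simp
  then have "\<kappa> < a" using a(2) by linarith
  have a_less: "a < x1"
  proof -
    have "1 * c * x1 < e * c * x1" by (rule mult_strict_right_mono[OF ec x1(1)])
    then have "\<kappa> < x1 * (1 - c)" using c(3) by (simp add: algebra_simps)
    then show ?thesis using \<open>c < 1\<close> by (simp add: a_def field_simps)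
  qed
  \<comment> \<open>The constants make the two pieces agree at \<open>a\<close>; the slopes agree as
    well, because \<open>w_lo\<close> vanishes there.\<close>
  define \<Phi> where "\<Phi> x = (if x \<le> a then - c * x\<^sup>2 / 2 else Q_lo \<kappa> c x - Q_lo \<kappa> c a - c * a\<^sup>2 / 2)" for x
  define \<psi> where "\<psi> x = (x - \<kappa>) * (w_lo \<kappa> c x - 1)" for x
  define \<phi> where "\<phi> x = (if x \<le> a then - c * x else \<psi> x)" for x
  have wa: "w_lo \<kappa> c a = 0" unfolding w_lo_def a(2) using c(1) a(1) by (simp add: ln_mult)
  have \<psi>_a: "\<psi> a = - c * a" by (simp add: \<psi>_def wa a(2))
  have above: "\<kappa> < x" "c * x \<le> x - \<kappa>" "0 \<le> w_lo \<kappa> c x" if "a \<le> x" for x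
  proof -
    show "\<kappa> < x" using that \<open>\<kappa> < a\<close> by simp
    have "a * (1 - c) \<le> x * (1 - c)" using that \<open>c < 1\<close> by (intro mult_right_mono) auto
    then show le: "c * x \<le> x - \<kappa>" using a(3) by (simp add: algebra_simps)
    have "ln (c * x) \<le> ln (x - \<kappa>)" using le c(1) that a(1) \<open>\<kappa> < x\<close> by simp
    then show "0 \<le> w_lo \<kappa> c x" using c(1) that a(1) by (simp add: w_lo_def ln_mult)
  qed
  have d\<Phi>: "(\<Phi> has_real_derivative \<phi> x) (at x)" if "0 < x" for x
    unfolding \<Phi>_def \<phi>_def
  proof (rule DERIV_if_le)
    show "((\<lambda>x. - c * x\<^sup>2 / 2) has_real_derivative - c * x) (at x)" by (auto intro!: derivative_eq_intros)
    show "((\<lambda>x. Q_lo \<kappa> c x - Q_lo \<kappa> c a - c * a\<^sup>2 / 2) has_real_derivative \<psi> x) (at x)" if "a \<le> x"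
    proof -
      have "0 < x" using a(1) that by simp
      from DERIV_diff[OF DERIV_diff[OF DERIV_Q_lo[OF above(1)[OF that] this, of c] DERIV_const] DERIV_const]
      show ?thesis by (simp add: \<psi>_def)
    qed
  qed (use \<psi>_a in auto)
  have "- \<kappa> * (J_fun f / sqrt 2) + 1 * I_fun f \<le> c + (\<Phi> (f 1) - \<Phi> 0)"
  proof (rule dual_bound[where \<phi> = \<phi> and C = 1])
    show "continuous_on {0..} \<Phi>"
    proof (rule continuous_at_imp_continuous_on, rule ballI)
      fix x :: real assume "x \<in> {0..}"
      then consider "0 < x" | "x = 0" by fastforce
      then show "isCont \<Phi> x"
      proof cases
        case 2
        \<comment> \<open>Near 0 the function is this parabola; \<open>d\<Phi>\<close> speaks only
          of positive \<open>x\<close>.\<close>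
        have "((\<lambda>x. - c * x\<^sup>2 / 2) has_real_derivative - c * 0) (at 0)" by (auto intro!: derivative_eq_intros)
        then have "(\<Phi> has_real_derivative - c * 0) (at 0)"
          by (rule has_field_derivative_transform_within_open[of _ _ _ "{..<a}"]) (use a(1) in \<open>auto simp: \<Phi>_def\<close>)
        then show ?thesis using 2 DERIV_isCont by blast
      qed (use d\<Phi> DERIV_isCont in blast)
    qed
    show "continuous_on {0<..} \<phi>"
      unfolding \<phi>_def
    proof (rule continuous_on_cases_le)
      show "continuous_on {x \<in> {0<..}. a \<le> x} \<psi>"
        unfolding \<psi>_def w_lo_def using above(1) a(1)
        by (intro continuous_intros) (auto simp: less_imp_neq[symmetric])
    qed (auto intro!: continuous_intros simp: \<psi>_a)
    \<comment> \<open>The lower bound comes from \<open>c < 1\<close> up to \<open>a\<close> and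
      from \<open>w \<ge> 0\<close> beyond it.\<close>
    show "- 1 * x \<le> \<phi> x" if "0 < x" for x
    proof (cases "x \<le> a")
      case True
      then show ?thesis using \<open>c < 1\<close> that by (simp add: \<phi>_def)
    next
      case False
      then have "\<kappa> < x" "0 \<le> w_lo \<kappa> c x" using above[of x] by auto
      then have "(x - \<kappa>) * (- 1) \<le> \<psi> x" unfolding \<psi>_def by (intro mult_left_mono) auto
      then show ?thesis using False \<kappa>(1) by (simp add: \<phi>_def)
    qed
    fix x p :: real assume x: "0 < x" and p: "0 \<le> p" "x * p \<le> 1"
    have "0 \<le> x * p" using x p by simp
    have goal_eq: "- (- \<kappa> + 1 * x) * (p * ln (x * p)) = - (x - \<kappa>) * (p * ln (x * p))" by simp
    show "- (- \<kappa> + 1 * x) * (p * ln (x * p)) \<le> c + \<phi> x * p"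
    proof (cases "x \<le> a")
      case False
      then have ax: "\<kappa> < x" using above[of x] by simp
      show ?thesis
        unfolding goal_eq
        using weighted_entropy_le[of "x - \<kappa>" x p c] ax x p c(1) False
        by (simp add: \<phi>_def \<psi>_def w_lo_def ln_div ln_mult algebra_simps)
    next
      case True
      \<comment> \<open>Up to \<open>a\<close> the maximum over \<open>w \<ge> 0\<close> sits at
        \<open>w = 0\<close>: the weight is at most \<open>c x\<close>, and then
        \<open>- u ln u \<le> 1 - u\<close> applies.\<close>
      have "x - \<kappa> \<le> c * x"
      proof -
        have "x * (1 - c) \<le> a * (1 - c)" using True \<open>c < 1\<close> by (intro mult_right_mono) auto
        then show ?thesis using a(3) by (simp add: algebra_simps)
      qed
      moreover have ln: "0 \<le> - (p * ln (x * p))"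
      proof (cases "p = 0")
        case False
        then have "0 < x * p" using x p by simp
        then have "ln (x * p) \<le> 0" using p(2) by (simp only: ln_le_zero_iff)
        then have "p * ln (x * p) \<le> 0" by (rule mult_nonneg_nonpos[OF p(1)])
        then show ?thesis by linarith
      qed simp
      ultimately have "(x - \<kappa>) * (- (p * ln (x * p))) \<le> c * x * (- (p * ln (x * p)))"
        by (rule mult_right_mono)
      also have "\<dots> = c * (- (x * p * ln (x * p)))" by simp
      also have "\<dots> \<le> c * (1 - x * p)"
        using neg_x_ln_x_le[OF \<open>0 \<le> x * p\<close>, of 1] c(1) by (intro mult_left_mono) auto
      finally show ?thesis using True by (simp add: \<phi>_def algebra_simps)
    qed
  qed (use d\<Phi> c in auto)
  moreover have "c + (\<Phi> (f 1) - \<Phi> 0) = G_lo \<kappa> (f 1)"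
    using G_lo_eq[OF \<kappa> c_def[unfolded x1_def] a_def] a_less a(1) by (simp add: \<Phi>_def x1_def)
  ultimately show ?thesis by simp
qed

text \<open>If the end point is at most \<open>\<kappa>\<close>, the weight
  \<open>x - \<kappa>\<close> is never positive along \<open>f\<close>, and the zero dual function
  suffices.\<close>

lemma lower_bound_short:
  assumes \<kappa>: "0 < \<kappa>" "f 1 \<le> \<kappa>"
  shows "I_fun f - \<kappa> * (J_fun f / sqrt 2) \<le> 0"
proof -
  have "- \<kappa> * (J_fun f / sqrt 2) + 1 * I_fun f \<le> 0 + ((\<lambda>_. 0) (f 1) - (\<lambda>_. 0) 0)"
  proof (rule dual_bound[where \<phi> = "\<lambda>_. 0" and \<Phi> = "\<lambda>_. 0" and C = 0])
    fix x p :: real assume x: "0 < x" "x \<le> f 1" and p: "0 \<le> p" "x * p \<le> 1"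
    have "p * ln (x * p) \<le> 0"
    proof (cases "p = 0")
      case False
      then have "0 < x * p" using x p by simp
      then have "ln (x * p) \<le> 0" using p(2) by (simp only: ln_le_zero_iff)
      then show ?thesis by (rule mult_nonneg_nonpos[OF p(1)])
    qed simp
    then have "(\<kappa> - x) * (p * ln (x * p)) \<le> 0" using x \<kappa> by (intro mult_nonneg_nonpos[of "\<kappa> - x" "p * ln (x * p)"]) auto
    then show "- (- \<kappa> + 1 * x) * (p * ln (x * p)) \<le> 0 + 0 * p" by (simp add: algebra_simps)
  qed auto
  then show ?thesis by simp
qed

end

text \<open>Links the two cases: the bound 0 for short end points is a value of \<open>G_lo\<close>,
  hence at most its maximum.\<close>

lemma G_lo_self:
  assumes "0 < \<kappa>"
  shows "G_lo \<kappa> \<kappa> = 0"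
proof -
  have "(e - 1) * \<kappa> + \<kappa> = e * \<kappa>" by (simp add: algebra_simps)
  then show ?thesis using assms by (simp add: G_lo_def ln_mult power2_eq_square)
qed

lemma lower_bound:
  assumes "f \<in> admissible" "0 < \<kappa>" "\<kappa> \<le> b"
    and stationary: "2 / (e * b\<^sup>2) - 1 + \<kappa> * (e - 1) / ((e - 1) * b + \<kappa>) = 0"
  shows "I_fun f - \<kappa> * (J_fun f / sqrt 2) \<le> G_lo \<kappa> b"
proof -
  from assms(1) obtain N where "admissible_off f N" by (rule admissible_offE)
  then interpret admissible_off f N .
  show ?thesis
  proof (cases "\<kappa> < f 1")
    case True
    then show ?thesis
      using lower_bound_G_lo[OF assms(2) True] G_lo_max[OF assms(2,3) _ stationary, of "f 1"] by simp
  next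
    case False
    then show ?thesis
      using lower_bound_short[OF assms(2)] G_lo_max[OF assms(2,3) order_refl stationary] G_lo_self[OF assms(2)]
      by simp
  qed
qed

text \<open>\<open>a_eq\<close> is \<open>w = 0\<close>, where the constraint
  \<open>f f' \<le> 1\<close> is released, and \<open>b_eq\<close> is \<open>w = 1\<close> at the
  free end point. \<open>time\<close> is \<open>(f - \<kappa>) f' = c\<close> integrated from the
  release time \<open>a^2 / 2\<close> to 1.\<close>

locale lo_params =
  fixes \<kappa> c a b :: real
  assumes \<kappa>_pos: "0 < \<kappa>" and c_pos: "0 < c" and a_pos: "0 < a" and a_less_b: "a < b" and a_sq: "a\<^sup>2 < 2"
    and a_eq: "a - \<kappa> = c * a" and b_eq: "b - \<kappa> = e * c * b"
    and time: "c * (2 - a\<^sup>2) = (b - \<kappa>)\<^sup>2 - (a - \<kappa>)\<^sup>2"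
begin

definition \<gamma> :: real where "\<gamma> = a\<^sup>2 / 2"

definition root :: "real \<Rightarrow> real" where
  "root \<sigma> = sqrt (2 * c * (\<sigma> - \<gamma>) + (a - \<kappa>)\<^sup>2)"

definition lam :: "real \<Rightarrow> real" where
  "lam \<sigma> = (if \<sigma> \<le> \<gamma> then sqrt (2 * \<sigma>) else \<kappa> + root \<sigma>)"

definition lam' :: "real \<Rightarrow> real" where
  "lam' \<sigma> = (if \<sigma> < \<gamma> then 1 / sqrt (2 * \<sigma>) else c / root \<sigma>)"

lemma \<kappa>_less_a: "\<kappa> < a"
proof -
  have "0 < c * a" using c_pos a_pos by simp
  then show ?thesis using a_eq by linarith
qed

lemma b_pos: "0 < b"
  using a_pos a_less_b by simp

lemma c_less_1: "c < 1"
proof -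
  have "c * a < 1 * a" using a_eq \<kappa>_pos by simp
  then show ?thesis using a_pos by (simp only: mult_less_cancel_right_pos)
qed

lemma w_a: "w_lo \<kappa> c a = 0"
  unfolding w_lo_def a_eq using c_pos a_pos by (simp add: ln_mult)

lemma w_b: "w_lo \<kappa> c b = 1"
  unfolding w_lo_def b_eq using c_pos b_pos by (simp add: ln_mult)

lemma c_mult_le:
  assumes "a \<le> x"
  shows "c * x \<le> x - \<kappa>"
proof -
  have "a * (1 - c) \<le> x * (1 - c)" using assms c_less_1 by (intro mult_right_mono) auto
  then show ?thesis using a_eq by (simp add: algebra_simps)
qed

lemma w_pos:
  assumes "a < x"
  shows "0 < w_lo \<kappa> c x"
proof -
  have "a * (1 - c) < x * (1 - c)" using assms c_less_1 by (intro mult_strict_right_mono) auto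
  then have "c * x < x - \<kappa>" using a_eq by (simp add: algebra_simps)
  then have "ln (c * x) < ln (x - \<kappa>)" using c_pos assms a_pos \<kappa>_less_a by simp
  then show ?thesis using c_pos assms a_pos by (simp add: w_lo_def ln_mult)
qed

text \<open>The source of \<open>q > 0\<close>: the entropy density \<open>w\<close> is positive
  beyond \<open>a\<close>.\<close>

lemma B_lo_less: "B_lo \<kappa> c a < B_lo \<kappa> c b"
proof (rule DERIV_pos_imp_increasing_open[OF a_less_b, where f = "B_lo \<kappa> c"])
  fix x assume "a < x" "x < b"
  then show "\<exists>y. (B_lo \<kappa> c has_real_derivative y) (at x) \<and> 0 < y"
    using DERIV_B_lo[of \<kappa> x c] w_pos[of x] \<kappa>_less_a a_pos
    by (intro exI[of _ "x * w_lo \<kappa> c x"]) auto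
next
  show "continuous_on {a..b} (B_lo \<kappa> c)"
    using \<kappa>_less_a a_pos by (intro continuous_at_imp_continuous_on ballI DERIV_isCont[OF DERIV_B_lo]) auto
qed

lemma A_lo_diff: "A_lo \<kappa> c b - A_lo \<kappa> c a = b - \<kappa> - \<kappa> * ln (b / a)"
  using c_pos a_pos b_pos by (simp add: A_lo_def w_a w_b, simp add: a_eq b_eq ln_mult ln_div algebra_simps)

lemma B_lo_diff: "B_lo \<kappa> c b - B_lo \<kappa> c a = (b\<^sup>2 - \<kappa>\<^sup>2 - \<kappa> * (b - a) - \<kappa>\<^sup>2 * ln (b / a)) / 2"
  using c_pos a_pos b_pos
  by (simp add: B_lo_def w_a w_b, simp add: a_eq b_eq ln_mult ln_div power2_eq_square field_simps)

lemma \<gamma>_bounds: "0 < \<gamma>" "\<gamma> < 1"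
  using a_pos a_sq by (auto simp: \<gamma>_def)

lemma root_bounds:
  assumes "\<gamma> \<le> \<sigma>"
  shows "a - \<kappa> \<le> root \<sigma>" "0 < root \<sigma>"
proof -
  have "(a - \<kappa>)\<^sup>2 \<le> 2 * c * (\<sigma> - \<gamma>) + (a - \<kappa>)\<^sup>2" using assms c_pos by simp
  then show "a - \<kappa> \<le> root \<sigma>" unfolding root_def by (rule real_le_rsqrt)
  then show "0 < root \<sigma>" using \<kappa>_less_a by simp
qed

lemma root_\<gamma>: "root \<gamma> = a - \<kappa>"
  using \<kappa>_less_a by (simp add: root_def)

lemma lam_\<gamma>: "sqrt (2 * \<gamma>) = a"
  using a_pos by (simp add: \<gamma>_def)

lemma lam_0: "lam 0 = 0"
  using \<gamma>_bounds by (simp add: lam_def)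

lemma lam_1: "lam 1 = b"
proof -
  have "2 * c * (1 - \<gamma>) + (a - \<kappa>)\<^sup>2 = (b - \<kappa>)\<^sup>2" using time by (simp add: \<gamma>_def algebra_simps)
  then show ?thesis using \<gamma>_bounds \<kappa>_less_a a_less_b by (simp add: lam_def root_def)
qed

lemma lam_le_a: "\<sigma> \<le> \<gamma> \<Longrightarrow> lam \<sigma> \<le> a"
  using lam_\<gamma> by (simp add: lam_def) (metis mult_le_cancel_left_pos real_sqrt_le_mono zero_less_numeral)

lemma lam_ge_a: "\<gamma> \<le> \<sigma> \<Longrightarrow> a \<le> lam \<sigma>"
  using root_bounds[of \<sigma>] lam_\<gamma> by (auto simp: lam_def)

lemma continuous_lam: "continuous_on {0..1} lam"
  unfolding lam_def root_def
  by (rule continuous_on_cases_le)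
    (use lam_\<gamma> root_\<gamma> in \<open>auto intro!: continuous_intros simp: root_def\<close>)

lemma DERIV_lam:
  assumes "\<sigma> \<in> {0<..<1} - {\<gamma>}"
  shows "(lam has_real_derivative lam' \<sigma>) (at \<sigma>)"
proof (cases "\<sigma> < \<gamma>")
  case True
  have "((\<lambda>\<sigma>. sqrt (2 * \<sigma>)) has_real_derivative 1 / sqrt (2 * \<sigma>)) (at \<sigma>)"
    using assms by (auto intro!: derivative_eq_intros simp: field_simps)
  then have "(lam has_real_derivative 1 / sqrt (2 * \<sigma>)) (at \<sigma>)"
    by (rule has_field_derivative_transform_within_open[of _ _ _ "{..<\<gamma>}"]) (use True in \<open>auto simp: lam_def\<close>)
  then show ?thesis using True by (simp add: lam'_def)
next
  case False
  then have \<sigma>: "\<gamma> < \<sigma>" using assms by auto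
  then have "0 < sqrt (2 * c * (\<sigma> - \<gamma>) + (a - \<kappa>)\<^sup>2)" using root_bounds[of \<sigma>] by (simp add: root_def)
  then have pos: "0 < 2 * c * (\<sigma> - \<gamma>) + (a - \<kappa>)\<^sup>2" by simp
  have "((\<lambda>\<sigma>. 2 * c * (\<sigma> - \<gamma>) + (a - \<kappa>)\<^sup>2) has_real_derivative 2 * c) (at \<sigma>)"
    by (auto intro!: derivative_eq_intros)
  from DERIV_chain2[OF DERIV_real_sqrt[OF pos] this]
  have "(root has_real_derivative inverse (root \<sigma>) / 2 * (2 * c)) (at \<sigma>)"
    by (simp add: root_def[abs_def])
  from DERIV_add[OF DERIV_const this, of \<kappa>]
  have "((\<lambda>\<sigma>. \<kappa> + root \<sigma>) has_real_derivative c / root \<sigma>) (at \<sigma>)"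
    by (simp add: field_simps)
  then have "(lam has_real_derivative c / root \<sigma>) (at \<sigma>)"
    by (rule has_field_derivative_transform_within_open[of _ _ _ "{\<gamma><..}"]) (use \<sigma> in \<open>auto simp: lam_def\<close>)
  then show ?thesis using \<sigma> by (simp add: lam'_def)
qed

lemma lam_lam':
  assumes "\<sigma> \<in> {0<..<1} - {\<gamma>}"
  shows "0 < lam \<sigma>" "0 < lam' \<sigma>" "\<sigma> < \<gamma> \<Longrightarrow> lam \<sigma> * lam' \<sigma> = 1"
    "\<gamma> < \<sigma> \<Longrightarrow> ln (lam \<sigma> * lam' \<sigma>) = - w_lo \<kappa> c (lam \<sigma>)" "lam \<sigma> * lam' \<sigma> \<le> 1"
proof -
  consider "\<sigma> < \<gamma>" | "\<gamma> < \<sigma>" using assms by fastforce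
  then have "0 < lam \<sigma> \<and> 0 < lam' \<sigma> \<and> (\<sigma> < \<gamma> \<longrightarrow> lam \<sigma> * lam' \<sigma> = 1) \<and>
    (\<gamma> < \<sigma> \<longrightarrow> ln (lam \<sigma> * lam' \<sigma>) = - w_lo \<kappa> c (lam \<sigma>)) \<and> lam \<sigma> * lam' \<sigma> \<le> 1"
  proof cases
    case 1
    then show ?thesis using assms by (simp add: lam_def lam'_def)
  next
    case 2
    have ge: "a \<le> lam \<sigma>" using lam_ge_a 2 by simp
    have root: "root \<sigma> = lam \<sigma> - \<kappa>" "0 < root \<sigma>" using 2 root_bounds[of \<sigma>] by (auto simp: lam_def)
    have lam': "lam' \<sigma> = c / (lam \<sigma> - \<kappa>)" using 2 root by (simp add: lam'_def)
    have "lam \<sigma> * lam' \<sigma> \<le> 1" unfolding lam' using c_mult_le[OF ge] root by (simp add: mult.commute)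
    moreover have "ln (lam \<sigma> * lam' \<sigma>) = - w_lo \<kappa> c (lam \<sigma>)"
      unfolding lam' using ge a_pos root c_pos by (simp add: w_lo_def ln_mult ln_div)
    ultimately show ?thesis using 2 ge a_pos root c_pos by (simp add: lam')
  qed
  then show "0 < lam \<sigma>" "0 < lam' \<sigma>" "\<sigma> < \<gamma> \<Longrightarrow> lam \<sigma> * lam' \<sigma> = 1"
    "\<gamma> < \<sigma> \<Longrightarrow> ln (lam \<sigma> * lam' \<sigma>) = - w_lo \<kappa> c (lam \<sigma>)" "lam \<sigma> * lam' \<sigma> \<le> 1" by auto
qed

text \<open>The initial arc \<open>f f' = 1\<close> carries no entropy, and the formulas
  \<open>A_lo\<close> and \<open>B_lo\<close> have no meaning for \<open>x \<le> \<kappa>\<close>.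
  Truncation by \<open>max a\<close> freezes the antiderivative until the release time.\<close>

lemma DERIV_max_lam:
  assumes "\<sigma> \<in> {0<..<1} - {\<gamma>}" and dF: "\<And>x. a \<le> x \<Longrightarrow> (F has_real_derivative F' x) (at x)"
  shows "((\<lambda>\<sigma>. F (max a (lam \<sigma>))) has_real_derivative (if \<sigma> < \<gamma> then 0 else F' (lam \<sigma>) * lam' \<sigma>)) (at \<sigma>)"
proof (cases "\<sigma> < \<gamma>")
  case True
  have "((\<lambda>_. F a) has_real_derivative 0) (at \<sigma>)" by simp
  then have "((\<lambda>\<sigma>. F (max a (lam \<sigma>))) has_real_derivative 0) (at \<sigma>)"
    by (rule has_field_derivative_transform_within_open[of _ _ _ "{..<\<gamma>}"])
      (use True lam_le_a in \<open>auto simp: max_absorb1\<close>)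
  then show ?thesis using True by simp
next
  case False
  then have \<sigma>: "\<gamma> < \<sigma>" using assms by auto
  from DERIV_chain2[OF dF[OF lam_ge_a] DERIV_lam[OF assms(1)]] \<sigma>
  have "((\<lambda>\<sigma>. F (lam \<sigma>)) has_real_derivative F' (lam \<sigma>) * lam' \<sigma>) (at \<sigma>)" by simp
  then have "((\<lambda>\<sigma>. F (max a (lam \<sigma>))) has_real_derivative F' (lam \<sigma>) * lam' \<sigma>) (at \<sigma>)"
    by (rule has_field_derivative_transform_within_open[of _ _ _ "{\<gamma><..}"])
      (use \<sigma> lam_ge_a in \<open>auto simp: max_absorb2\<close>)
  then show ?thesis using \<sigma> by simp
qed

lemma DERIV_AB:
  assumes "a \<le> x"
  shows "(A_lo \<kappa> c has_real_derivative w_lo \<kappa> c x) (at x)"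
    "(B_lo \<kappa> c has_real_derivative x * w_lo \<kappa> c x) (at x)"
  using assms \<kappa>_less_a a_pos by (auto intro!: DERIV_A_lo DERIV_B_lo)

lemma continuous_AB:
  "continuous_on {0..1} (\<lambda>\<sigma>. A_lo \<kappa> c (max a (lam \<sigma>)))"
  "continuous_on {0..1} (\<lambda>\<sigma>. B_lo \<kappa> c (max a (lam \<sigma>)))"
proof -
  have max: "continuous_on {0..1} (\<lambda>\<sigma>. max a (lam \<sigma>))"
    by (intro continuous_on_max continuous_lam continuous_on_const)
  have "continuous_on {a..} (A_lo \<kappa> c)" "continuous_on {a..} (B_lo \<kappa> c)"
    by (auto intro!: continuous_at_imp_continuous_on DERIV_isCont[OF DERIV_AB(1)] DERIV_isCont[OF DERIV_AB(2)])
  then show "continuous_on {0..1} (\<lambda>\<sigma>. A_lo \<kappa> c (max a (lam \<sigma>)))"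
    "continuous_on {0..1} (\<lambda>\<sigma>. B_lo \<kappa> c (max a (lam \<sigma>)))"
    by (auto intro: continuous_on_compose2[OF _ max])
qed

lemma candidate:
  assumes eq: "\<And>\<sigma>. \<sigma> \<in> {0..1} \<Longrightarrow> f \<sigma> = lam \<sigma>"
  shows "f \<in> admissible" "J_fun f = sqrt 2 * (b - \<kappa> - \<kappa> * ln (b / a))"
    "I_fun f = (b\<^sup>2 - \<kappa>\<^sup>2 - \<kappa> * (b - a) - \<kappa>\<^sup>2 * ln (b / a)) / 2"
proof -
  have f0: "f 0 = 0" using eq[of 0] lam_0 by simp
  have cf: "continuous_on {0..1} f" using continuous_lam eq by (metis (no_types, lifting) continuous_on_cong)
  have eq': "f \<sigma> = lam \<sigma>" if "\<sigma> \<in> {0<..<1} - {\<gamma>}" for \<sigma> using eq that by simp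
  have der: "(f has_real_derivative lam' \<sigma>) (at \<sigma>)" if "\<sigma> \<in> {0<..<1} - {\<gamma>}" for \<sigma>
    by (rule has_field_derivative_transform_within_open[OF DERIV_lam[OF that], of "{0<..<1}"]) (use that eq in auto)
  have dA: "((\<lambda>\<sigma>. A_lo \<kappa> c (max a (lam \<sigma>))) has_real_derivative - (lam' \<sigma> * ln (f \<sigma> * lam' \<sigma>))) (at \<sigma>)"
    and dB: "((\<lambda>\<sigma>. B_lo \<kappa> c (max a (lam \<sigma>))) has_real_derivative - (f \<sigma> * lam' \<sigma> * ln (f \<sigma> * lam' \<sigma>))) (at \<sigma>)"
    if \<sigma>: "\<sigma> \<in> {0<..<1} - {\<gamma>}" for \<sigma>
  proof -
    have "(if \<sigma> < \<gamma> then 0 else w_lo \<kappa> c (lam \<sigma>) * lam' \<sigma>) = - (lam' \<sigma> * ln (f \<sigma> * lam' \<sigma>))"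
      "(if \<sigma> < \<gamma> then 0 else lam \<sigma> * w_lo \<kappa> c (lam \<sigma>) * lam' \<sigma>) = - (f \<sigma> * lam' \<sigma> * ln (f \<sigma> * lam' \<sigma>))"
      unfolding eq'[OF \<sigma>] using lam_lam'(3,4)[OF \<sigma>] \<sigma> by auto
    then show "((\<lambda>\<sigma>. A_lo \<kappa> c (max a (lam \<sigma>))) has_real_derivative - (lam' \<sigma> * ln (f \<sigma> * lam' \<sigma>))) (at \<sigma>)"
      "((\<lambda>\<sigma>. B_lo \<kappa> c (max a (lam \<sigma>))) has_real_derivative - (f \<sigma> * lam' \<sigma> * ln (f \<sigma> * lam' \<sigma>))) (at \<sigma>)"
      using DERIV_max_lam[OF \<sigma> DERIV_AB(1)] DERIV_max_lam[OF \<sigma> DERIV_AB(2)] by simp_all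
  qed
  have fpos: "0 < f \<sigma>" and le1: "f \<sigma> * lam' \<sigma> \<le> 1" if "\<sigma> \<in> {0<..<1} - {\<gamma>}" for \<sigma>
    using eq'[OF that] lam_lam'(1,5)[OF that] by auto
  have fin: "finite {\<gamma>}" by simp
  note explicit = admissible_explicit[OF fin cf f0 der less_imp_le[OF lam_lam'(2)] fpos le1
      continuous_AB(1) dA continuous_AB(2) dB]
  show "f \<in> admissible" by (rule explicit(1))
  have "max a (lam 1) = b" "max a (lam 0) = a" using lam_1 lam_0 a_less_b a_pos by auto
  then show "J_fun f = sqrt 2 * (b - \<kappa> - \<kappa> * ln (b / a))"
    "I_fun f = (b\<^sup>2 - \<kappa>\<^sup>2 - \<kappa> * (b - a) - \<kappa>\<^sup>2 * ln (b / a)) / 2"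
    using explicit(2,3) A_lo_diff B_lo_diff by simp_all
qed

text \<open>The integrand of \<open>I_fun\<close> is at most \<open>1 / e\<close>, and it vanishes on the initial interval.\<close>

lemma B_lo_diff_less: "B_lo \<kappa> c b - B_lo \<kappa> c a < 1 / e"
proof -
  \<comment> \<open>\<open>h\<close> compares the accumulated value of \<open>I_fun\<close> with
    growth at the maximal rate \<open>1 / e\<close>.\<close>
  define h where "h \<sigma> = B_lo \<kappa> c (max a (lam \<sigma>)) - \<sigma> / e" for \<sigma>
  have "h 1 \<le> h \<gamma>"
  proof (rule DERIV_nonpos_imp_decreasing_open[where f = h])
    fix \<sigma> assume "\<gamma> < \<sigma>" "\<sigma> < 1"
    then have \<sigma>: "\<sigma> \<in> {0<..<1} - {\<gamma>}" "\<gamma> < \<sigma>" using \<gamma>_bounds by auto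
    have dh: "(h has_real_derivative lam \<sigma> * w_lo \<kappa> c (lam \<sigma>) * lam' \<sigma> - 1 / e) (at \<sigma>)"
      unfolding h_def[abs_def] using DERIV_max_lam[OF \<sigma>(1) DERIV_AB(2)] \<sigma>(2)
      by (auto intro!: derivative_eq_intros)
    have "- (lam \<sigma> * lam' \<sigma> * ln (lam \<sigma> * lam' \<sigma>)) \<le> 1 / e - (ln (1 / e) + 1) * (lam \<sigma> * lam' \<sigma>)"
      using lam_lam'(1,2)[OF \<sigma>(1)] by (intro neg_x_ln_x_le) auto
    then have "lam \<sigma> * w_lo \<kappa> c (lam \<sigma>) * lam' \<sigma> - 1 / e \<le> 0"
      using lam_lam'(4)[OF \<sigma>] by (simp add: ln_div mult_ac)
    then show "\<exists>y. (h has_real_derivative y) (at \<sigma>) \<and> y \<le> 0" using dh by blast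
  next
    show "continuous_on {\<gamma>..1} h"
      unfolding h_def[abs_def] using \<gamma>_bounds
      by (intro continuous_intros continuous_on_subset[OF continuous_AB(2)]) auto
  qed (use \<gamma>_bounds in simp)
  moreover have "h 1 = B_lo \<kappa> c b - 1 / e" using lam_1 a_less_b by (simp add: h_def)
  moreover have "h \<gamma> = B_lo \<kappa> c a - \<gamma> / e" using lam_\<gamma> by (simp add: h_def lam_def)
  \<comment> \<open>Strictness comes from the initial interval, which uses up the time
    \<open>\<gamma>\<close> without entropy.\<close>
  moreover have "0 < \<gamma> / e" using \<gamma>_bounds by simp
  ultimately show ?thesis by linarith
qed

end

section \<open>Parametrization of the maximum\<close>

lemma sqrt_bounds_iff:
  assumes "0 < b"
  shows "b < sqrt (r / e) \<longleftrightarrow> b\<^sup>2 * e < r" "b = sqrt (r / e) \<longleftrightarrow> b\<^sup>2 * e = r" "sqrt (r / e) < b \<longleftrightarrow> r < b\<^sup>2 * e"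
proof -
  have "b = sqrt (b\<^sup>2)" using assms by simp
  then have "b < sqrt (r / e) \<longleftrightarrow> b\<^sup>2 < r / e" "b = sqrt (r / e) \<longleftrightarrow> b\<^sup>2 = r / e" "sqrt (r / e) < b \<longleftrightarrow> r / e < b\<^sup>2"
    by (metis real_sqrt_less_iff, metis real_sqrt_eq_iff, metis real_sqrt_less_iff)
  then show "b < sqrt (r / e) \<longleftrightarrow> b\<^sup>2 * e < r" "b = sqrt (r / e) \<longleftrightarrow> b\<^sup>2 * e = r" "sqrt (r / e) < b \<longleftrightarrow> r < b\<^sup>2 * e"
    by (simp_all add: field_simps)
qed

lemma sqrt_1_2_div_e: "sqrt (1 / e) < sqrt (2 / e)"
  by (simp add: divide_strict_right_mono)

text \<open>This is \<open>(b + k) / k\<close>, the argument of the logarithm, in closed form. It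
  grows from 0 to infinity over the parameter interval; infinite \<open>k\<close> becomes
  \<open>z = 1\<close>, and \<open>k = 0\<close> becomes infinite \<open>z\<close>.\<close>

definition z_up :: "real \<Rightarrow> real" where
  "z_up b = b\<^sup>2 * e / (2 - b\<^sup>2 * e)"

text \<open>The formula for \<open>q\<close>, times \<open>e\<close>, as a function of
  \<open>z\<close> alone.\<close>

definition Q_up :: "real \<Rightarrow> real" where
  "Q_up z = z * (z\<^sup>2 - z - ln z) / ((1 + z) * (z - 1)\<^sup>2)"

text \<open>The substitutions \<open>k = b / (z - 1)\<close> and
  \<open>b^2 = 2 z / (e (1 + z))\<close> eliminate \<open>k\<close> and \<open>b^2\<close> in favour
  of \<open>z\<close>.\<close>

lemma up_formula_z:
  assumes b: "0 < b" "b\<^sup>2 * e < 2" "b\<^sup>2 * e \<noteq> 1"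
  shows "q_up_formula b = Q_up (z_up b) / e"
    and "J_up_formula b = sqrt 2 * b * (ln (z_up b) / (z_up b - 1) + 1)"
    and "0 < z_up b" "z_up b \<noteq> 1" "z_up b < 1 \<longleftrightarrow> b\<^sup>2 * e < 1"
proof -
  define s where "s = b\<^sup>2 * e"
  define z where "z = z_up b"
  have s: "0 < s" "s < 2" "s \<noteq> 1" using b by (auto simp: s_def)
  have z: "z = s / (2 - s)" by (simp add: z_def z_up_def s_def)
  have z': "0 < z" "z \<noteq> 1" "z < 1 \<longleftrightarrow> s < 1" using s by (auto simp: z field_simps)
  then show "0 < z_up b" "z_up b \<noteq> 1" "z_up b < 1 \<longleftrightarrow> b\<^sup>2 * e < 1"
    unfolding z_def s_def by blast+
  have k: "k_up b = b / (z - 1)"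
  proof -
    have "z - 1 = 2 * (s - 1) / (2 - s)" using s by (simp add: z field_simps)
    then have "b / (z - 1) = b * (2 - s) / (2 * (s - 1))" by simp
    also have "b * (2 - s) = - (b * (s - 2))" by (simp add: algebra_simps)
    finally show ?thesis unfolding k_up_def s_def minus_divide_left by (rule sym)
  qed
  have kz: "(b + k_up b) / k_up b = z"
  proof -
    have "b + b / (z - 1) = z * (b / (z - 1))" using z' by (simp add: field_simps)
    then show ?thesis unfolding k using b z' by simp
  qed
  note kz' = kz[unfolded k]
  have b2: "b\<^sup>2 = 2 * z / (e * (1 + z))"
  proof -
    have "1 + z = 2 / (2 - s)" using s by (simp add: z field_simps)
    then have "2 * z / (e * (1 + z)) = s / e" using s by (simp add: z field_simps)
    then show ?thesis by (simp add: s_def)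
  qed
  have "q_up_formula b = (b\<^sup>2 + b / (z - 1) * b - (b / (z - 1))\<^sup>2 * ln z) / 2"
    by (simp only: q_up_formula_def Let_def k kz')
  also have "\<dots> = b\<^sup>2 * (z\<^sup>2 - z - ln z) / (2 * (z - 1)\<^sup>2)"
  proof -
    have "b / (z - 1) * b = b\<^sup>2 * (z - 1) / (z - 1)\<^sup>2" using z' by (simp add: power2_eq_square)
    moreover have "b\<^sup>2 = b\<^sup>2 * (z - 1)\<^sup>2 / (z - 1)\<^sup>2" using z' by simp
    ultimately have "b\<^sup>2 + b / (z - 1) * b - (b / (z - 1))\<^sup>2 * ln z =
        (b\<^sup>2 * (z - 1)\<^sup>2 + b\<^sup>2 * (z - 1) - b\<^sup>2 * ln z) / (z - 1)\<^sup>2"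
      by (simp add: power_divide add_divide_distrib diff_divide_distrib)
    also have "b\<^sup>2 * (z - 1)\<^sup>2 + b\<^sup>2 * (z - 1) - b\<^sup>2 * ln z = b\<^sup>2 * (z\<^sup>2 - z - ln z)"
      by (simp add: power2_eq_square algebra_simps)
    finally show ?thesis by simp
  qed
  also have "\<dots> = Q_up z / e" unfolding b2 Q_up_def by simp
  finally show "q_up_formula b = Q_up (z_up b) / e" by (simp add: z_def)
  have "J_up_formula b = sqrt 2 * (b / (z - 1) * ln z + b)"
    by (simp only: J_up_formula_def Let_def k kz')
  then show "J_up_formula b = sqrt 2 * b * (ln (z_up b) / (z_up b - 1) + 1)"
    by (simp add: z_def[symmetric] algebra_simps)
qed

text \<open>The bounds 0 and 1 are strict forms of \<open>ln t \<le> t - 1\<close> at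
  \<open>t = z\<close> and \<open>t = 1 / z\<close>. For 3/4 the difference is expressed by a
  function \<open>D\<close> with \<open>D 1 = 0\<close> whose derivative is positive away from
  1.\<close>

lemma Q_up_bounds:
  assumes "0 < z" "z \<noteq> 1"
  shows "0 < Q_up z" "Q_up z < 1" "z < 1 \<Longrightarrow> Q_up z < 3 / 4" "1 < z \<Longrightarrow> 3 / 4 < Q_up z"
proof -
  have den: "0 < (1 + z) * (z - 1)\<^sup>2" using assms by simp
  have lnz: "ln z < z - 1" using assms ln_add_one_self_less_self ln_eq_minus_one ln_le_minus_one
    by (metis order_le_less)
  have "0 < (z - 1)\<^sup>2" using assms by simp
  also have "(z - 1)\<^sup>2 = z\<^sup>2 - z - (z - 1)" by (simp add: power2_eq_square algebra_simps)
  also have "\<dots> < z\<^sup>2 - z - ln z" using lnz by simp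
  finally have pos: "0 < z\<^sup>2 - z - ln z" .
  then show "0 < Q_up z" unfolding Q_up_def using assms den by (intro divide_pos_pos mult_pos_pos) auto
  have "ln (1 / z) < 1 / z - 1"
    using assms ln_eq_minus_one[of "1/z"] ln_le_minus_one[of "1/z"] by (auto simp: order_le_less)
  then have "z * (- ln z) < z * (1 / z - 1)" using assms by (intro mult_strict_left_mono) (auto simp: ln_div)
  then have "- (z * ln z) < 1 - z" using assms by (simp add: algebra_simps)
  then have "z * (z\<^sup>2 - z - ln z) < (1 + z) * (z - 1)\<^sup>2" by (simp add: power2_eq_square algebra_simps)
  then show "Q_up z < 1" unfolding Q_up_def using den by simp
  \<comment> \<open>The numerator of \<open>Q_up z - 3 / 4\<close> divided by \<open>z\<close>: this
    leaves \<open>ln z\<close> without a factor, so the derivative is rational.\<close>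
  define D where "D z = z\<^sup>2 - z - 3 / 4 * (z\<^sup>2 - z - 1 + 1 / z) - ln z" for z :: real
  have dD: "(D has_real_derivative (x - 1)\<^sup>2 * (2 * x + 3) / (4 * x\<^sup>2)) (at x)" if "0 < x" for x
  proof -
    have "(D has_real_derivative 2 * x - 1 - 3 / 4 * (2 * x - 1 - 1 / (x * x)) - 1 / x) (at x)"
      unfolding D_def[abs_def] using that by (auto intro!: derivative_eq_intros simp: field_simps)
    moreover have "2 * x - 1 - 3 / 4 * (2 * x - 1 - 1 / (x * x)) - 1 / x = (x - 1)\<^sup>2 * (2 * x + 3) / (4 * x\<^sup>2)"
      using that by (simp add: power2_eq_square field_simps)
    ultimately show ?thesis by simp
  qed
  have dpos: "0 < (x - 1)\<^sup>2 * (2 * x + 3) / (4 * x\<^sup>2)" if "0 < x" "x \<noteq> 1" for x :: real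
    using that by (intro divide_pos_pos mult_pos_pos) auto
  have D1: "D 1 = 0" by (simp add: D_def)
  have Q_D: "Q_up z - 3 / 4 = z * D z / ((1 + z) * (z - 1)\<^sup>2)"
  proof -
    have "z * D z = z * (z\<^sup>2 - z - ln z) - 3 / 4 * (z * (z\<^sup>2 - z - 1 + 1 / z))"
      by (simp add: D_def algebra_simps)
    also have "z * (z\<^sup>2 - z - 1 + 1 / z) = (1 + z) * (z - 1)\<^sup>2"
      using assms by (simp add: power2_eq_square field_simps)
    finally have eq: "z * D z = z * (z\<^sup>2 - z - ln z) - 3 / 4 * ((1 + z) * (z - 1)\<^sup>2)" .
    have "3 / 4 * ((1 + z) * (z - 1)\<^sup>2) / ((1 + z) * (z - 1)\<^sup>2) = 3 / 4"
      by (rule nonzero_mult_div_cancel_right[OF den[THEN less_imp_neq, THEN not_sym]])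
    then show ?thesis unfolding Q_up_def eq diff_divide_distrib by simp
  qed
  have contD: "continuous_on {u..v} D" if "0 < u" for u v
    using that by (intro continuous_at_imp_continuous_on ballI DERIV_isCont[OF dD]) auto
  show "Q_up z < 3 / 4" if "z < 1"
  proof -
    have "D z < D 1"
    proof (rule DERIV_pos_imp_increasing_open[OF that, where f = D])
      fix x assume "z < x" "x < 1"
      then have "0 < x" "x \<noteq> 1" using assms by auto
      then show "\<exists>y. (D has_real_derivative y) (at x) \<and> 0 < y" using dD dpos by blast
    qed (rule contD[OF assms(1)])
    then have "z * D z / ((1 + z) * (z - 1)\<^sup>2) < 0"
      using D1 assms den by (intro divide_neg_pos mult_pos_neg) auto
    then show ?thesis using Q_D by simp
  qed
  show "3 / 4 < Q_up z" if "1 < z"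
  proof -
    have "D 1 < D z"
    proof (rule DERIV_pos_imp_increasing_open[OF that, where f = D])
      fix x assume "1 < x" "x < z"
      then have "0 < x" "x \<noteq> 1" by auto
      then show "\<exists>y. (D has_real_derivative y) (at x) \<and> 0 < y" using dD dpos by blast
    qed (rule contD[OF zero_less_one])
    then have "0 < z * D z / ((1 + z) * (z - 1)\<^sup>2)"
      using D1 assms den by (intro divide_pos_pos mult_pos_pos) auto
    then show ?thesis using Q_D by simp
  qed
qed

section \<open>Limits at the singular parameters and range of the parametrization\<close>

lemma Q_up_limits:
  "(Q_up \<longlongrightarrow> 0) (at_right 0)" "(Q_up \<longlongrightarrow> 3 / 4) (at 1)" "(Q_up \<longlongrightarrow> 1) at_top"
  unfolding Q_up_def[abs_def] by real_asymp+

lemma ln_quotient_limits: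
  "((\<lambda>z::real. ln z / (z - 1)) \<longlongrightarrow> 1) (at 1)" "((\<lambda>z::real. ln z / (z - 1)) \<longlongrightarrow> 0) at_top"
  by real_asymp+

text \<open>At \<open>z = 1\<close> the formula \<open>Q_up\<close> is a quotient 0 / 0, so its
  limit there must be taken along \<open>z \<noteq> 1\<close>; near 0 its logarithm asks for
  \<open>z > 0\<close>.\<close>

lemma z_up_limits:
  "filterlim z_up (at_right 0) (at_right 0)"
  "filterlim z_up (at 1) (at (sqrt (1 / e)))"
  "filterlim z_up at_top (at_left (sqrt (2 / e)))"
proof -
  have near0: "\<forall>\<^sub>F b in at_right 0. b \<in> {0<..<sqrt (2 / e)}"
    by (rule eventually_at_right_real) simp
  have "(z_up \<longlongrightarrow> 0\<^sup>2 * e / (2 - 0\<^sup>2 * e)) (at_right 0)"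
    unfolding z_up_def[abs_def] by (intro tendsto_intros) simp
  moreover have "\<forall>\<^sub>F b in at_right 0. 0 < z_up b"
    using near0 by eventually_elim (auto simp: z_up_def sqrt_bounds_iff)
  ultimately show "filterlim z_up (at_right 0) (at_right 0)"
    by (intro tendsto_imp_filterlim_at_right) simp_all
  have "(z_up \<longlongrightarrow> (sqrt (1 / e))\<^sup>2 * e / (2 - (sqrt (1 / e))\<^sup>2 * e)) (at (sqrt (1 / e)))"
    unfolding z_up_def[abs_def] by (intro tendsto_intros) simp
  then have "(z_up \<longlongrightarrow> 1) (at (sqrt (1 / e)))" by simp
  moreover have "\<forall>\<^sub>F b in at (sqrt (1 / e)). z_up b \<noteq> 1"
  proof -
    have "\<forall>\<^sub>F b in at (sqrt (1 / e)). b \<in> {0<..<sqrt (2 / e)} - {sqrt (1 / e)}"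
      by (rule eventually_at_in_open) (use sqrt_1_2_div_e in auto)
    then show ?thesis
    proof eventually_elim
      case (elim b)
      then have "0 < b" "b\<^sup>2 * e < 2" "b\<^sup>2 * e \<noteq> 1" using sqrt_bounds_iff[of b] by auto
      then show ?case by (rule up_formula_z(4))
    qed
  qed
  ultimately show "filterlim z_up (at 1) (at (sqrt (1 / e)))"
    by (simp add: filterlim_at)
  have "((\<lambda>b. 2 - b\<^sup>2 * e) \<longlongrightarrow> 2 - (sqrt (2 / e))\<^sup>2 * e) (at_left (sqrt (2 / e)))"
    by (intro tendsto_intros)
  then have den: "((\<lambda>b. 2 - b\<^sup>2 * e) \<longlongrightarrow> 0) (at_left (sqrt (2 / e)))" by simp
  have "\<forall>\<^sub>F b in at_left (sqrt (2 / e)). b \<in> {0<..<sqrt (2 / e)}"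
    by (rule eventually_at_left_real) simp
  then have den_pos: "\<forall>\<^sub>F b in at_left (sqrt (2 / e)). 0 < 2 - b\<^sup>2 * e"
    by eventually_elim (auto simp: sqrt_bounds_iff)
  have "((\<lambda>b. b\<^sup>2 * e) \<longlongrightarrow> (sqrt (2 / e))\<^sup>2 * e) (at_left (sqrt (2 / e)))"
    by (intro tendsto_intros)
  then have num: "((\<lambda>b. b\<^sup>2 * e) \<longlongrightarrow> 2) (at_left (sqrt (2 / e)))" by simp
  show "filterlim z_up at_top (at_left (sqrt (2 / e)))"
    unfolding z_up_def[abs_def]
    by (rule LIM_at_top_divide[OF num _ den den_pos]) simp
qed

lemma eventually_up_domain:
  "\<forall>\<^sub>F b in at_right 0. 0 < b \<and> b\<^sup>2 * e < 2 \<and> b\<^sup>2 * e \<noteq> 1"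
  "\<forall>\<^sub>F b in at (sqrt (1 / e)). 0 < b \<and> b\<^sup>2 * e < 2 \<and> b\<^sup>2 * e \<noteq> 1"
  "\<forall>\<^sub>F b in at_left (sqrt (2 / e)). 0 < b \<and> b\<^sup>2 * e < 2 \<and> b\<^sup>2 * e \<noteq> 1"
proof -
  have "\<forall>\<^sub>F b in at_right 0. b \<in> {0<..<sqrt (1 / e)}"
    by (rule eventually_at_right_real) simp
  then show "\<forall>\<^sub>F b in at_right 0. 0 < b \<and> b\<^sup>2 * e < 2 \<and> b\<^sup>2 * e \<noteq> 1"
  proof eventually_elim
    case (elim b)
    then show ?case using sqrt_bounds_iff(1)[of b 1] by auto
  qed
  have "\<forall>\<^sub>F b in at (sqrt (1 / e)). b \<in> {0<..<sqrt (2 / e)} - {sqrt (1 / e)}"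
    by (rule eventually_at_in_open) (use sqrt_1_2_div_e in auto)
  then show "\<forall>\<^sub>F b in at (sqrt (1 / e)). 0 < b \<and> b\<^sup>2 * e < 2 \<and> b\<^sup>2 * e \<noteq> 1"
  proof eventually_elim
    case (elim b)
    then show ?case using sqrt_bounds_iff[of b] by auto
  qed
  have "\<forall>\<^sub>F b in at_left (sqrt (2 / e)). b \<in> {sqrt (1 / e)<..<sqrt (2 / e)}"
    by (rule eventually_at_left_real[OF sqrt_1_2_div_e])
  then show "\<forall>\<^sub>F b in at_left (sqrt (2 / e)). 0 < b \<and> b\<^sup>2 * e < 2 \<and> b\<^sup>2 * e \<noteq> 1"
  proof eventually_elim
    case (elim b)
    then have "0 < b" by (auto intro: less_trans[of 0 "sqrt (1 / e)"])
    then show ?case using elim sqrt_bounds_iff[of b] by auto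
  qed
qed

text \<open>Each limit in \<open>b\<close> becomes a limit in \<open>z\<close>: of
  \<open>Q_up\<close> for \<open>q\<close>, and of \<open>ln z / (z - 1)\<close> for the values of
  the functional.\<close>

lemma up_formula_limits:
  "(q_up_formula \<longlongrightarrow> 0) (at_right 0)"
  "(q_up_formula \<longlongrightarrow> q_star) (at (sqrt (1 / e)))"
  "(J_up_formula \<longlongrightarrow> 2 * sqrt (2 / e)) (at (sqrt (1 / e)))"
  "(q_up_formula \<longlongrightarrow> q_max) (at_left (sqrt (2 / e)))"
  "(J_up_formula \<longlongrightarrow> 2 / sqrt e) (at_left (sqrt (2 / e)))"
proof -
  have q: "(q_up_formula \<longlongrightarrow> l / e) F"
    if "filterlim z_up G F" "(Q_up \<longlongrightarrow> l) G" "\<forall>\<^sub>F b in F. 0 < b \<and> b\<^sup>2 * e < 2 \<and> b\<^sup>2 * e \<noteq> 1" for F G l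
  proof (rule Lim_transform_eventually)
    show "((\<lambda>b. Q_up (z_up b) / e) \<longlongrightarrow> l / e) F"
      by (intro tendsto_divide filterlim_compose[OF that(2,1)] tendsto_const) simp
    show "\<forall>\<^sub>F b in F. Q_up (z_up b) / e = q_up_formula b"
      using that(3) by eventually_elim (simp add: up_formula_z(1))
  qed
  have J: "(J_up_formula \<longlongrightarrow> sqrt 2 * b0 * (l + 1)) F"
    if "filterlim z_up G F" "((\<lambda>z. ln z / (z - 1)) \<longlongrightarrow> l) G" "((\<lambda>b. b) \<longlongrightarrow> b0) F"
      "\<forall>\<^sub>F b in F. 0 < b \<and> b\<^sup>2 * e < 2 \<and> b\<^sup>2 * e \<noteq> 1" for F G l b0
  proof (rule Lim_transform_eventually)
    show "((\<lambda>b. sqrt 2 * b * (ln (z_up b) / (z_up b - 1) + 1)) \<longlongrightarrow> sqrt 2 * b0 * (l + 1)) F"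
      by (intro tendsto_mult tendsto_add filterlim_compose[OF that(2,1)] tendsto_const that(3))
    show "\<forall>\<^sub>F b in F. sqrt 2 * b * (ln (z_up b) / (z_up b - 1) + 1) = J_up_formula b"
      using that(4) by eventually_elim (simp add: up_formula_z(2))
  qed
  show "(q_up_formula \<longlongrightarrow> 0) (at_right 0)"
    using q[OF z_up_limits(1) Q_up_limits(1) eventually_up_domain(1)] by simp
  show "(q_up_formula \<longlongrightarrow> q_star) (at (sqrt (1 / e)))"
    using q[OF z_up_limits(2) Q_up_limits(2) eventually_up_domain(2)] by (simp add: q_star_def)
  show "(q_up_formula \<longlongrightarrow> q_max) (at_left (sqrt (2 / e)))"
    using q[OF z_up_limits(3) Q_up_limits(3) eventually_up_domain(3)] by (simp add: q_max_def)
  show "(J_up_formula \<longlongrightarrow> 2 * sqrt (2 / e)) (at (sqrt (1 / e)))"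
    using J[OF z_up_limits(2) ln_quotient_limits(1) tendsto_ident_at eventually_up_domain(2)]
    by (simp add: real_sqrt_divide mult.commute)
  have "sqrt 2 * sqrt (2 / e) = 2 / sqrt e" by (simp add: real_sqrt_divide)
  then show "(J_up_formula \<longlongrightarrow> 2 / sqrt e) (at_left (sqrt (2 / e)))"
    using J[OF z_up_limits(3) ln_quotient_limits(2) tendsto_ident_at eventually_up_domain(3)] by simp
qed

text \<open>The end limits supply two interior points whose values enclose \<open>y\<close>; the
  function may be singular at the ends.\<close>

lemma IVT_open_interval:
  fixes g :: "real \<Rightarrow> real"
  assumes "l < r" "continuous_on {l<..<r} g" "(g \<longlongrightarrow> L) (at_right l)" "(g \<longlongrightarrow> R) (at_left r)" "L < y" "y < R"
  shows "y \<in> g ` {l<..<r}"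
proof -
  have "\<forall>\<^sub>F x in at_right l. g x < y \<and> x \<in> {l<..<r}"
    using order_tendstoD(2)[OF assms(3,5)] eventually_at_right_real[OF assms(1)] by eventually_elim auto
  then obtain u where u: "g u < y" "u \<in> {l<..<r}"
    using eventually_happens'[OF trivial_limit_at_right_real] by blast
  have "\<forall>\<^sub>F x in at_left r. y < g x \<and> x \<in> {l<..<r}"
    using order_tendstoD(1)[OF assms(4,6)] eventually_at_left_real[OF assms(1)] by eventually_elim auto
  then obtain v where v: "y < g v" "v \<in> {l<..<r}"
    using eventually_happens'[OF trivial_limit_at_left_real] by blast
  have "connected (g ` {l<..<r})"
    by (intro connected_continuous_image assms(2)) simp
  then show ?thesis
    using connectedD_interval[of "g ` {l<..<r}" "g u" "g v" y] u v by auto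
qed

lemma continuous_q_up_formula:
  assumes "\<And>b. b \<in> S \<Longrightarrow> 0 < b \<and> b\<^sup>2 * e < 2 \<and> b\<^sup>2 * e \<noteq> 1"
  shows "continuous_on S q_up_formula"
proof -
  have "continuous_on S z_up"
    unfolding z_up_def[abs_def] using assms by (intro continuous_intros) force
  moreover have "0 < z_up b" "z_up b \<noteq> 1" if "b \<in> S" for b
    using up_formula_z(3,4)[of b] assms[OF that] by auto
  ultimately have "continuous_on S (\<lambda>b. Q_up (z_up b) / e)"
    unfolding Q_up_def by (intro continuous_intros) (auto simp: less_imp_neq[symmetric] add_pos_pos)
  moreover have "Q_up (z_up b) / e = q_up_formula b" if "b \<in> S" for b
    using up_formula_z(1)[of b] assms[OF that] by simp
  ultimately show ?thesis by (metis (no_types, lifting) continuous_on_cong)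
qed

text \<open>The bounds on \<open>Q_up\<close> give one inclusion, the end limits with the
  intermediate value theorem the other. The third image joins the two open pieces with the values
  inserted at the singular parameters.\<close>

lemma q_up_images:
  "q_up ` {0<..<sqrt (1 / e)} = {0<..<q_star}"
  "q_up ` {sqrt (1 / e)<..sqrt (2 / e)} = {q_star<..q_max}"
  "q_up ` {0<..sqrt (2 / e)} = {0<..q_max}"
proof -
  have less: "sqrt (1 / e) < sqrt (2 / e)" "0 < sqrt (1 / e)" using sqrt_1_2_div_e by simp_all
  have star: "q_star < q_max" "0 < q_star" by (simp_all add: q_star_def q_max_def field_simps)
  have low: "0 < b \<and> b\<^sup>2 * e < 2 \<and> b\<^sup>2 * e \<noteq> 1 \<and> z_up b < 1" if "b \<in> {0<..<sqrt (1 / e)}" for b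
  proof -
    have "0 < b" "b\<^sup>2 * e < 1" using that sqrt_bounds_iff(1)[of b 1] by auto
    then show ?thesis using up_formula_z(5)[of b] by auto
  qed
  have high: "0 < b \<and> b\<^sup>2 * e < 2 \<and> b\<^sup>2 * e \<noteq> 1 \<and> 1 < z_up b" if "b \<in> {sqrt (1 / e)<..<sqrt (2 / e)}" for b
  proof -
    have "0 < b" using that less(2) by (meson greaterThanLessThan_iff less_trans)
    moreover from this have "1 < b\<^sup>2 * e" "b\<^sup>2 * e < 2" using that sqrt_bounds_iff[of b] by auto
    ultimately show ?thesis using up_formula_z(4,5)[of b] by auto
  qed
  have eq: "q_up b = q_up_formula b" if "b \<noteq> sqrt (1 / e)" "b \<noteq> sqrt (2 / e)" for b
    using that by (simp add: q_up_def)
  have im_low: "q_up ` {0<..<sqrt (1 / e)} = q_up_formula ` {0<..<sqrt (1 / e)}"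
    by (rule image_cong) (use less in \<open>auto intro!: eq\<close>)
  have im_high: "q_up ` {sqrt (1 / e)<..<sqrt (2 / e)} = q_up_formula ` {sqrt (1 / e)<..<sqrt (2 / e)}"
    by (rule image_cong) (auto intro!: eq)
  show 1: "q_up ` {0<..<sqrt (1 / e)} = {0<..<q_star}"
  proof (intro equalityI subsetI)
    fix y assume "y \<in> q_up ` {0<..<sqrt (1 / e)}"
    then obtain b where b: "b \<in> {0<..<sqrt (1 / e)}" "y = q_up_formula b" unfolding im_low by blast
    then have "y = Q_up (z_up b) / e" "0 < z_up b" "z_up b < 1"
      using low[OF b(1)] up_formula_z(1,3)[of b] by auto
    moreover from this have "0 < Q_up (z_up b) / e" "Q_up (z_up b) / e < (3 / 4) / e"
      using Q_up_bounds(1,3)[of "z_up b"] by (simp, intro divide_strict_right_mono) simp_all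
    ultimately show "y \<in> {0<..<q_star}" by (simp add: q_star_def)
  next
    fix y assume "y \<in> {0<..<q_star}"
    then show "y \<in> q_up ` {0<..<sqrt (1 / e)}"
      unfolding im_low using low
      by (intro IVT_open_interval[OF less(2) continuous_q_up_formula up_formula_limits(1)
          filterlim_mono[OF up_formula_limits(2) order_refl at_le]]) auto
  qed
  have 2: "q_up ` {sqrt (1 / e)<..<sqrt (2 / e)} = {q_star<..<q_max}"
  proof (intro equalityI subsetI)
    fix y assume "y \<in> q_up ` {sqrt (1 / e)<..<sqrt (2 / e)}"
    then obtain b where b: "b \<in> {sqrt (1 / e)<..<sqrt (2 / e)}" "y = q_up_formula b" unfolding im_high by blast
    then have "y = Q_up (z_up b) / e" "0 < z_up b" "1 < z_up b"
      using high[OF b(1)] up_formula_z(1,3)[of b] by auto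
    moreover from this have "Q_up (z_up b) / e < 1 / e" "(3 / 4) / e < Q_up (z_up b) / e"
      using Q_up_bounds(2,4)[of "z_up b"] by (intro divide_strict_right_mono; simp)+
    ultimately show "y \<in> {q_star<..<q_max}" by (simp add: q_star_def q_max_def)
  next
    fix y assume "y \<in> {q_star<..<q_max}"
    then show "y \<in> q_up ` {sqrt (1 / e)<..<sqrt (2 / e)}"
      unfolding im_high using high
      by (intro IVT_open_interval[OF less(1) continuous_q_up_formula
          filterlim_mono[OF up_formula_limits(2) order_refl at_le] up_formula_limits(4)]) auto
  qed
  have q_at: "q_up (sqrt (1 / e)) = q_star" "q_up (sqrt (2 / e)) = q_max" by (auto simp: q_up_def)
  have "{sqrt (1 / e)<..sqrt (2 / e)} = insert (sqrt (2 / e)) {sqrt (1 / e)<..<sqrt (2 / e)}"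
    using less by (auto simp del: real_sqrt_less_iff real_sqrt_gt_0_iff real_sqrt_le_iff)
  then have "q_up ` {sqrt (1 / e)<..sqrt (2 / e)} = insert q_max {q_star<..<q_max}"
    using 2 q_at by simp
  then show 3: "q_up ` {sqrt (1 / e)<..sqrt (2 / e)} = {q_star<..q_max}" using star by auto
  have "{0<..sqrt (2 / e)} = {0<..<sqrt (1 / e)} \<union> insert (sqrt (1 / e)) {sqrt (1 / e)<..sqrt (2 / e)}"
    using less by (auto simp del: real_sqrt_less_iff real_sqrt_gt_0_iff real_sqrt_le_iff)
  then have "q_up ` {0<..sqrt (2 / e)} = {0<..<q_star} \<union> insert q_star {q_star<..q_max}"
    using 1 3 q_at by (simp add: image_Un)
  then show "q_up ` {0<..sqrt (2 / e)} = {0<..q_max}" using star by auto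
qed

section \<open>Parametrization of the minimum\<close>

lemma lo_basic:
  assumes "sqrt (2 / e) < b" "b < sqrt 2"
  shows "0 < b" "b\<^sup>2 < 2" "2 < b\<^sup>2 * e" "0 < 2 + (e - 2) * b\<^sup>2 * e"
proof -
  have "0 < sqrt (2 / e)" by simp
  then show b: "0 < b" using assms(1) by linarith
  show "b\<^sup>2 < 2" using assms(2) b by (metis real_sqrt_less_iff real_sqrt_abs abs_of_pos)
  show "2 < b\<^sup>2 * e" using assms(1) sqrt_bounds_iff(3)[OF b] by simp
  show "0 < 2 + (e - 2) * b\<^sup>2 * e" using e_gt_2 b by (intro add_pos_pos mult_pos_pos) auto
qed

text \<open>For given \<open>b\<close>, the formulas for \<open>k\<close>, \<open>a\<close> and
  \<open>c\<close> solve the system \<open>a_eq\<close>, \<open>b_eq\<close>,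
  \<open>time\<close>.\<close>

lemma lo_instance:
  assumes "sqrt (2 / e) < b" "b < sqrt 2"
  shows "lo_params (- k_lo b) (c_lo b) (a_lo b) b"
proof -
  \<comment> \<open>Hiding \<open>exp 1\<close> behind a name leaves identities that are rational in
    \<open>E\<close> and \<open>b\<close>.\<close>
  define E where "E = e"
  define m where "m = (E - 1) * b"
  define n where "n = b\<^sup>2 * E - 2"
  define D where "D = 2 + (E - 2) * b\<^sup>2 * E"
  note basic = lo_basic[OF assms]
  have E: "2 < E" using e_gt_2 by (simp add: E_def)
  have pos: "0 < m" "0 < n" "0 < D" "0 < 2 - b\<^sup>2"
    using basic E by (auto simp: m_def n_def D_def E_def)
  have k: "- k_lo b = m * n / D" and a: "a_lo b = n / m" and c: "c_lo b = (2 - b\<^sup>2) / D"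
    by (simp_all add: k_lo_def a_lo_def c_lo_def m_def n_def D_def E_def)
  \<comment> \<open>Equivalently \<open>1 - c = m^2 / D\<close>, whence
    \<open>a = \<kappa> / (1 - c) = n / m\<close>.\<close>
  have D1: "D - m\<^sup>2 = 2 - b\<^sup>2" by (simp add: D_def m_def power2_eq_square algebra_simps)
  have D2: "b * D - m * n = E * (2 - b\<^sup>2) * b"
    by (simp add: D_def m_def n_def power2_eq_square algebra_simps)
  have a_eq: "n / m - m * n / D = (2 - b\<^sup>2) / D * (n / m)"
    unfolding D1[symmetric] using pos by (simp add: power2_eq_square field_simps)
  have b_eq: "b - m * n / D = E * ((2 - b\<^sup>2) / D) * b"
  proof -
    have "b - m * n / D = (b * D - m * n) / D" using pos by (simp add: field_simps)
    then show ?thesis by (simp add: D2)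
  qed
  have less: "n / m < b"
  proof -
    have "n < b * m" using basic by (simp add: n_def m_def power2_eq_square algebra_simps)
    then show ?thesis using pos by (simp add: divide_less_eq)
  qed
  \<comment> \<open>The condition \<open>time\<close> divided by \<open>c\<close>, after inserting
    \<open>b - \<kappa> = E c b\<close> and \<open>a - \<kappa> = c a\<close>.\<close>
  have time: "2 - (n / m)\<^sup>2 = (2 - b\<^sup>2) / D * (E\<^sup>2 * b\<^sup>2 - (n / m)\<^sup>2)"
  proof -
    have "D * (2 * m\<^sup>2 - n\<^sup>2) = (2 - b\<^sup>2) * (E\<^sup>2 * b\<^sup>2 * m\<^sup>2 - n\<^sup>2)"
      unfolding D_def m_def n_def by algebra
    then have "D * (2 * m\<^sup>2 - n\<^sup>2) / (D * m\<^sup>2) = (2 - b\<^sup>2) * (E\<^sup>2 * b\<^sup>2 * m\<^sup>2 - n\<^sup>2) / (D * m\<^sup>2)" by simp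
    moreover have "D * (2 * m\<^sup>2 - n\<^sup>2) / (D * m\<^sup>2) = 2 - (n / m)\<^sup>2"
      using pos by (simp add: power_divide diff_divide_distrib)
    moreover have "(2 - b\<^sup>2) * (E\<^sup>2 * b\<^sup>2 * m\<^sup>2 - n\<^sup>2) / (D * m\<^sup>2) = (2 - b\<^sup>2) / D * (E\<^sup>2 * b\<^sup>2 - (n / m)\<^sup>2)"
    proof -
      have "(E\<^sup>2 * b\<^sup>2 * m\<^sup>2 - n\<^sup>2) / m\<^sup>2 = E\<^sup>2 * b\<^sup>2 - (n / m)\<^sup>2"
        using pos by (simp add: power_divide diff_divide_distrib)
      then show ?thesis by (metis times_divide_times_eq)
    qed
    ultimately show ?thesis by simp
  qed
  show ?thesis
    unfolding k a c
  proof unfold_locales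
    show "(n / m)\<^sup>2 < 2"
    proof -
      have "(n / m)\<^sup>2 < b\<^sup>2" using less pos by (intro power_strict_mono) auto
      then show ?thesis using basic by simp
    qed
    show "b - m * n / D = e * ((2 - b\<^sup>2) / D) * b" using b_eq by (simp add: E_def)
    show "(2 - b\<^sup>2) / D * (2 - (n / m)\<^sup>2) = (b - m * n / D)\<^sup>2 - (n / m - m * n / D)\<^sup>2"
    proof -
      have "t * (t * (E\<^sup>2 * b\<^sup>2 - r\<^sup>2)) = (E * t * b)\<^sup>2 - (t * r)\<^sup>2" for t r
        by (simp add: power2_eq_square algebra_simps)
      then show ?thesis unfolding a_eq b_eq time .
    qed
  qed (use pos less a_eq in auto)
qed

text \<open>Solved for \<open>\<kappa>\<close>, this equation is the formula for \<open>- k\<close>: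
  in terms of \<open>s = b^2 e\<close> the last quotient is \<open>(s - 2) / s\<close>.\<close>

lemma lo_stationary:
  assumes "sqrt (2 / e) < b" "b < sqrt 2"
  shows "2 / (e * b\<^sup>2) - 1 + - k_lo b * (e - 1) / ((e - 1) * b + - k_lo b) = 0"
proof -
  define s where "s = b\<^sup>2 * e"
  define m where "m = (e - 1) * b"
  define D where "D = 2 + (e - 2) * b\<^sup>2 * e"
  note basic = lo_basic[OF assms]
  have pos: "0 < m" "0 < D" "2 < s" "0 < e - 1" using basic e_gt_2 by (auto simp: m_def D_def s_def)
  have k: "- k_lo b = m * (s - 2) / D"
    by (simp add: k_lo_def m_def s_def D_def)
  have "m + m * (s - 2) / D = m * (D + (s - 2)) / D" using pos by (simp add: field_simps)
  also have "D + (s - 2) = (e - 1) * s" by (simp add: D_def s_def algebra_simps)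
  finally have "- k_lo b * (e - 1) / ((e - 1) * b + - k_lo b) = (m * (s - 2) / D * (e - 1)) / (m * ((e - 1) * s) / D)"
    unfolding k m_def[symmetric] by simp
  then have 1: "- k_lo b * (e - 1) / ((e - 1) * b + - k_lo b) = (s - 2) / s" using pos by simp
  have 2: "2 / (e * b\<^sup>2) = 2 / s" by (simp add: s_def mult.commute)
  show ?thesis unfolding 1 2 using pos by (simp add: field_simps)
qed

context lo_params
begin

text \<open>There is no duality gap: the right-hand side is
  \<open>I_fun - \<kappa> J_fun / sqrt 2\<close> of the candidate. \<open>time\<close> turns the
  multiplier term into squares.\<close>

lemma G_lo_b:
  "G_lo \<kappa> b = (b\<^sup>2 - \<kappa>\<^sup>2 - \<kappa> * (b - a) - \<kappa>\<^sup>2 * ln (b / a)) / 2 - \<kappa> * (b - \<kappa> - \<kappa> * ln (b / a))"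
proof -
  have "c = (b - \<kappa>) / (e * b)" using b_eq b_pos by simp
  moreover have "a = \<kappa> / (1 - c)" using a_eq c_less_1 by (simp add: field_simps)
  moreover have "\<kappa> < b" using \<kappa>_less_a a_less_b by simp
  ultimately have "G_lo \<kappa> b = c + (Q_lo \<kappa> c b - Q_lo \<kappa> c a - c * a\<^sup>2 / 2)"
    using G_lo_eq[OF \<kappa>_pos] by metis
  also have "\<dots> = c * (2 - a\<^sup>2) / 2 + (a - \<kappa>)\<^sup>2 / 2 - \<kappa> * (b - a) / 2 + \<kappa>\<^sup>2 * (ln b - ln a) / 2"
    by (simp add: Q_lo_def w_a w_b) (simp add: field_simps)
  also have "\<dots> = (b - \<kappa>)\<^sup>2 / 2 - \<kappa> * (b - a) / 2 + \<kappa>\<^sup>2 * (ln b - ln a) / 2"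
    unfolding time by (simp add: field_simps)
  also have "ln b - ln a = ln (b / a)" using a_pos b_pos by (simp add: ln_div)
  finally show ?thesis by (simp add: power2_eq_square field_simps)
qed

end

lemma lo_formulas:
  "q_lo b = (b\<^sup>2 - (- k_lo b)\<^sup>2 - (- k_lo b) * (b - a_lo b) - (- k_lo b)\<^sup>2 * ln (b / a_lo b)) / 2"
  "J_lo b = sqrt 2 * (b - (- k_lo b) - (- k_lo b) * ln (b / a_lo b))"
  by (simp_all add: q_lo_def J_lo_def Let_def algebra_simps)

lemma lam_lo_candidate:
  assumes "sqrt (2 / e) < b" "b < sqrt 2"
  shows "lam_lo b \<in> admissible" "I_fun (lam_lo b) = q_lo b" "J_fun (lam_lo b) = J_lo b"
proof -
  interpret lo_params "- k_lo b" "c_lo b" "a_lo b" b by (rule lo_instance[OF assms])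
  have "lam_lo b \<sigma> = (if \<sigma> < \<gamma> then sqrt (2 * \<sigma>) else - k_lo b + root \<sigma>)" for \<sigma>
    by (simp add: lam_lo_def Let_def \<gamma>_lo_def \<gamma>_def root_def)
  \<comment> \<open>The two definitions put \<open>\<gamma>\<close> into different branches, but
    both branches equal \<open>a\<close> there.\<close>
  then have "lam_lo b \<sigma> = lam \<sigma>" for \<sigma>
    using lam_\<gamma> root_\<gamma> by (cases "\<sigma> = \<gamma>") (simp_all add: lam_def)
  then show "lam_lo b \<in> admissible" "I_fun (lam_lo b) = q_lo b" "J_fun (lam_lo b) = J_lo b"
    using candidate[of "lam_lo b"] unfolding lo_formulas by simp_all
qed

lemma J_lo_le:
  assumes "sqrt (2 / e) < b" "b < sqrt 2" and f: "f \<in> level (q_lo b)"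
  shows "J_lo b \<le> J_fun f"
proof -
  interpret lo_params "- k_lo b" "c_lo b" "a_lo b" b by (rule lo_instance[OF assms(1,2)])
  have J: "b - (- k_lo b) - (- k_lo b) * ln (b / a_lo b) = J_lo b / sqrt 2"
    by (simp add: lo_formulas(2))
  have "- k_lo b \<le> b" using \<kappa>_less_a a_less_b by simp
  from f have "f \<in> admissible" "I_fun f = q_lo b" by (auto simp: level_def)
  with lower_bound[OF _ \<kappa>_pos \<open>- k_lo b \<le> b\<close> lo_stationary[OF assms(1,2)], of f]
  have "q_lo b - (- k_lo b) * (J_fun f / sqrt 2) \<le> q_lo b - (- k_lo b) * (J_lo b / sqrt 2)"
    unfolding G_lo_b J lo_formulas(1)[symmetric] by simp
  then have "- k_lo b * (J_lo b / sqrt 2) \<le> - k_lo b * (J_fun f / sqrt 2)" by linarith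
  then have "J_lo b / sqrt 2 \<le> J_fun f / sqrt 2" using \<kappa>_pos by (simp only: mult_le_cancel_left_pos)
  then show ?thesis by (simp add: divide_le_cancel)
qed

text \<open>The bounds on the candidate's entropy give one inclusion. For the other,
  \<open>q_lo\<close> is extended continuously to the closed parameter interval, with
  \<open>q_max\<close> at the left end and 0 at the right end.\<close>

lemma q_lo_image: "q_lo ` {sqrt (2 / e)<..<sqrt 2} = {0<..<q_max}"
proof (intro equalityI subsetI)
  fix y assume "y \<in> q_lo ` {sqrt (2 / e)<..<sqrt 2}"
  then obtain b where b: "sqrt (2 / e) < b" "b < sqrt 2" "y = q_lo b" by auto
  interpret lo_params "- k_lo b" "c_lo b" "a_lo b" b by (rule lo_instance[OF b(1,2)])
  show "y \<in> {0<..<q_max}"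
    using B_lo_less B_lo_diff_less unfolding b(3) lo_formulas(1) B_lo_diff[symmetric] q_max_def by simp
next
  fix y assume y: "y \<in> {0<..<q_max}"
  \<comment> \<open>\<open>k = - a m\<close> exposes the factor \<open>a\<close>, which vanishes at
    the left end and absorbs the singularity of \<open>ln a\<close>.\<close>
  define m where "m b = (e - 1)\<^sup>2 * b\<^sup>2 / (2 + (e - 2) * b\<^sup>2 * e)" for b
  define g where "g b = (b\<^sup>2 - (k_lo b)\<^sup>2 + k_lo b * (b - a_lo b) - (k_lo b)\<^sup>2 * ln b
    + (m b)\<^sup>2 * (a_lo b * (a_lo b * ln (a_lo b)))) / 2" for b
  let ?S = "{sqrt (2 / e)..sqrt 2}"
  have S_pos: "0 < b" "0 < 2 + (e - 2) * b\<^sup>2 * e" "2 \<le> b\<^sup>2 * e" if "b \<in> ?S" for b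
  proof -
    have "0 < sqrt (2 / e)" by simp
    then show b: "0 < b" using that by (auto simp del: real_sqrt_gt_0_iff)
    show "0 < 2 + (e - 2) * b\<^sup>2 * e" using e_gt_2 b by (intro add_pos_pos mult_pos_pos) auto
    have "\<not> b < sqrt (2 / e)" using that by auto
    then show "2 \<le> b\<^sup>2 * e" using sqrt_bounds_iff(1)[OF b] by simp
  qed
  have k_m: "k_lo b = - (a_lo b * m b)" if "0 < b" for b
    using that e_gt_2 by (simp add: k_lo_def a_lo_def m_def power2_eq_square)
  have le: "sqrt (2 / e) \<le> sqrt 2" using e_gt_2 by (simp add: field_simps)
  have cont_a: "continuous_on ?S a_lo"
    unfolding a_lo_def[abs_def] using S_pos(1) e_gt_2 by (intro continuous_intros) force
  have cont_k: "continuous_on ?S k_lo" and cont_m: "continuous_on ?S m"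
    unfolding k_lo_def[abs_def] m_def[abs_def] using S_pos(2) by (intro continuous_intros; force)+
  have "a_lo b \<in> {0..}" if "b \<in> ?S" for b
    using S_pos[OF that] e_gt_2 by (simp add: a_lo_def)
  then have "continuous_on ?S (\<lambda>b. a_lo b * ln (a_lo b))"
    by (intro continuous_on_compose2[OF continuous_on_x_ln_x cont_a]) auto
  note sing = continuous_on_mult[OF continuous_on_power[OF cont_m, of 2] continuous_on_mult[OF cont_a this]]
  have cont: "continuous_on ?S g"
    unfolding g_def[abs_def]
  proof (rule continuous_on_divide[OF continuous_on_add[OF _ sing] continuous_on_const])
    show "continuous_on ?S (\<lambda>b. b\<^sup>2 - (k_lo b)\<^sup>2 + k_lo b * (b - a_lo b) - (k_lo b)\<^sup>2 * ln b)"
      using S_pos(1) by (intro continuous_intros cont_a cont_k) force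
  qed simp
  have g_left: "g (sqrt (2 / e)) = q_max"
    by (simp add: g_def q_max_def a_lo_def k_lo_def)
  have g_right: "g (sqrt 2) = 0"
  proof -
    have a: "a_lo (sqrt 2) = sqrt 2"
    proof -
      have "a_lo (sqrt 2) = (e - 1) * 2 / ((e - 1) * sqrt 2)" by (simp add: a_lo_def algebra_simps)
      also have "\<dots> = 2 / sqrt 2" by (rule mult_divide_mult_cancel_left) (use e_gt_2 in simp)
      finally show ?thesis by (simp add: real_div_sqrt)
    qed
    have "2 + (e - 2) * 2 * e = 2 * (e - 1)\<^sup>2" by (simp add: power2_eq_square algebra_simps)
    then have m: "m (sqrt 2) = 1" using e_gt_2 by (simp add: m_def)
    have k: "k_lo (sqrt 2) = - sqrt 2" using k_m[of "sqrt 2"] a m by simp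
    show ?thesis by (simp add: g_def a m k)
  qed
  have "\<exists>b. sqrt (2 / e) \<le> b \<and> b \<le> sqrt 2 \<and> g b = y"
    using y g_left g_right by (intro IVT2' cont le) auto
  then obtain b where b: "sqrt (2 / e) \<le> b" "b \<le> sqrt 2" "g b = y" by blast
  then have "b \<noteq> sqrt (2 / e)" "b \<noteq> sqrt 2" using g_left g_right y by auto
  then have b': "sqrt (2 / e) < b" "b < sqrt 2" using b by auto
  interpret lo_params "- k_lo b" "c_lo b" "a_lo b" b by (rule lo_instance[OF b'])
  have "q_lo b = g b"
    using a_pos b_pos
    by (simp add: q_lo_def Let_def g_def ln_div k_m[OF b_pos] power_mult_distrib power2_eq_square algebra_simps)
  then show "y \<in> q_lo ` {sqrt (2 / e)<..<sqrt 2}" using b b' by auto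
qed

section \<open>Optimality\<close>

text \<open>A closed form of its own for \<open>1 / k\<close>: at \<open>b = sqrt (1 / e)\<close>,
  where \<open>k_up\<close> divides by zero, it has the right value 0.\<close>

definition \<beta>_up :: "real \<Rightarrow> real" where
  "\<beta>_up b = 2 * (b\<^sup>2 * e - 1) / (b * (2 - b\<^sup>2 * e))"

text \<open>\<open>end_slope\<close> and \<open>time\<close> are linear in \<open>\<beta>\<close>
  and \<open>\<nu>\<close>; eliminating \<open>\<beta>\<close> leaves
  \<open>\<nu> (2 - b^2 e) = b\<close>.\<close>

definition \<nu>_up :: "real \<Rightarrow> real" where
  "\<nu>_up b = b / (2 - b\<^sup>2 * e)"

lemma up_instance:
  assumes "0 < b" "b\<^sup>2 * e < 2"
  shows "up_params (\<beta>_up b) (\<nu>_up b) b"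
proof
  have pos: "0 < 2 - b\<^sup>2 * e" using assms by simp
  show "0 < b" "0 < \<nu>_up b" using assms by (simp_all add: \<nu>_up_def)
  have "1 / b = (2 - b\<^sup>2 * e) / (b * (2 - b\<^sup>2 * e))" using assms pos by simp
  then have "\<beta>_up b + 1 / b = (2 * (b\<^sup>2 * e - 1) + (2 - b\<^sup>2 * e)) / (b * (2 - b\<^sup>2 * e))"
    unfolding \<beta>_up_def by (simp only: add_divide_distrib)
  also have "2 * (b\<^sup>2 * e - 1) + (2 - b\<^sup>2 * e) = b * (e * b)" by (simp add: power2_eq_square)
  also have "b * (e * b) / (b * (2 - b\<^sup>2 * e)) = e * \<nu>_up b"
    using assms(1) by (simp add: \<nu>_up_def)
  finally show "\<beta>_up b + 1 / b = e * \<nu>_up b" .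
  have "\<beta>_up b * b\<^sup>2 / 2 = b * (b\<^sup>2 * e - 1) / (2 - b\<^sup>2 * e)"
  proof -
    have "2 * t / (b * u) * b\<^sup>2 / 2 = b * t / u" for t u
      using assms(1) by (simp add: power2_eq_square)
    then show ?thesis by (simp only: \<beta>_up_def)
  qed
  moreover have "b = b * (2 - b\<^sup>2 * e) / (2 - b\<^sup>2 * e)" using pos by simp
  ultimately have "b + \<beta>_up b * b\<^sup>2 / 2 = (b * (2 - b\<^sup>2 * e) + b * (b\<^sup>2 * e - 1)) / (2 - b\<^sup>2 * e)"
    by (simp only: add_divide_distrib)
  also have "b * (2 - b\<^sup>2 * e) + b * (b\<^sup>2 * e - 1) = b" by (simp add: algebra_simps)
  finally show "b + \<beta>_up b * b\<^sup>2 / 2 = \<nu>_up b" by (simp add: \<nu>_up_def)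
qed

lemma k_up_\<beta>_up:
  assumes "0 < b" "b\<^sup>2 * e < 2" "b\<^sup>2 * e \<noteq> 1"
  shows "\<beta>_up b = 1 / k_up b" "k_up b \<noteq> 0" "c_up b = \<nu>_up b * k_up b" "k_up b < 0 \<longleftrightarrow> b\<^sup>2 * e < 1"
proof -
  define s where "s = b\<^sup>2 * e"
  have s: "s < 2" "s \<noteq> 1" using assms by (auto simp: s_def)
  have "b * (2 - s) = - (b * (s - 2))" by (simp add: algebra_simps)
  then have k: "k_up b = b * (2 - s) / (2 * (s - 1))"
    unfolding k_up_def s_def[symmetric] by (simp only: minus_divide_left)
  show "\<beta>_up b = 1 / k_up b" "k_up b \<noteq> 0"
    using s assms(1) by (simp_all add: k \<beta>_up_def s_def[symmetric])
  show "c_up b = \<nu>_up b * k_up b"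
    unfolding c_up_def \<nu>_up_def k s_def[symmetric] using s assms(1) by (simp add: power2_eq_square)
  have "0 < b * (2 - s)" using s assms(1) by simp
  then show "k_up b < 0 \<longleftrightarrow> b\<^sup>2 * e < 1"
    by (simp add: k divide_less_0_iff s_def)
qed

text \<open>At \<open>b^2 e = 1\<close> the branches of \<open>L_up\<close> and \<open>M_up\<close>
  for \<open>\<beta> = 0\<close> deliver the values inserted in \<open>q_up\<close> and
  \<open>J_up\<close>.\<close>

lemma AB_up_values:
  assumes "0 < b" "b\<^sup>2 * e < 2"
  shows "sqrt 2 * A_up (\<beta>_up b) (\<nu>_up b) b = J_up b" "B_up (\<beta>_up b) (\<nu>_up b) b = q_up b"
proof -
  interpret up_params "\<beta>_up b" "\<nu>_up b" b by (rule up_instance[OF assms])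
  have ne2: "b \<noteq> sqrt (2 / e)" using assms sqrt_bounds_iff(2)[of b 2] by simp
  have "sqrt 2 * A_up (\<beta>_up b) (\<nu>_up b) b = J_up b \<and> B_up (\<beta>_up b) (\<nu>_up b) b = q_up b"
  proof (cases "b\<^sup>2 * e = 1")
    case True
    then have b: "b = sqrt (1 / e)" using sqrt_bounds_iff(2)[OF assms(1)] by simp
    have \<beta>: "\<beta>_up b = 0" using True by (simp add: \<beta>_up_def)
    have "b\<^sup>2 = 1 / e" using True by (simp add: field_simps)
    then have "b\<^sup>2 / 2 + b\<^sup>2 / 4 = q_star" by (simp add: q_star_def field_simps)
    moreover have "sqrt 2 * (b + b) = 2 * sqrt (2 / e)" by (simp add: b real_sqrt_divide)
    moreover have "J_up b = 2 * sqrt (2 / e)" "q_up b = q_star" by (simp_all add: b J_up_def q_up_def)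
    ultimately show ?thesis
      unfolding A_up_b B_up_b by (simp only: \<beta> L_up_def M_up_def if_True simp_thms)
  next
    case False
    then have ne1: "b \<noteq> sqrt (1 / e)" using sqrt_bounds_iff(2)[OF assms(1)] by simp
    define k where "k = k_up b"
    have k: "\<beta>_up b = 1 / k" "k \<noteq> 0" using k_up_\<beta>_up[OF assms False] by (auto simp: k_def)
    have \<beta>: "\<beta>_up b \<noteq> 0" using k by simp
    have y: "1 + \<beta>_up b * b = (b + k) / k" using k by (simp add: field_simps)
    have "L_up (\<beta>_up b) b = ln (1 + \<beta>_up b * b) / \<beta>_up b" using \<beta> by (simp add: L_up_def)
    then have L: "L_up (\<beta>_up b) b = k * ln ((b + k) / k)" unfolding y by (simp add: k)
    have "M_up (\<beta>_up b) b = (b - L_up (\<beta>_up b) b) / (2 * \<beta>_up b)" using \<beta> by (simp add: M_up_def)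
    then have M: "M_up (\<beta>_up b) b = k * (b - k * ln ((b + k) / k)) / 2" unfolding L by (simp add: k)
    have "J_up b = sqrt 2 * (k * ln ((b + k) / k) + b)"
      using ne1 ne2 by (simp add: J_up_def J_up_formula_def Let_def k_def)
    moreover have "q_up b = (b\<^sup>2 + k * b - k\<^sup>2 * ln ((b + k) / k)) / 2"
      using ne1 ne2 by (simp add: q_up_def q_up_formula_def Let_def k_def)
    ultimately show ?thesis
      unfolding A_up_b B_up_b L M by (simp add: power2_eq_square field_simps)
  qed
  then show "sqrt 2 * A_up (\<beta>_up b) (\<nu>_up b) b = J_up b" "B_up (\<beta>_up b) (\<nu>_up b) b = q_up b" by auto
qed

lemma lam_up_candidate:
  assumes "0 < b" "b\<^sup>2 * e < 2"
  shows "lam_up b \<in> admissible" "I_fun (lam_up b) = q_up b" "J_fun (lam_up b) = J_up b"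
proof -
  interpret up_params "\<beta>_up b" "\<nu>_up b" b by (rule up_instance[OF assms])
  have "lam_up b \<sigma> = lam \<sigma>" if \<sigma>: "\<sigma> \<in> {0..1}" for \<sigma>
  proof (cases "b\<^sup>2 * e = 1")
    case True
    then have b: "b = sqrt (1 / e)" using sqrt_bounds_iff(2)[OF assms(1)] by simp
    have "\<beta>_up b = 0" "\<nu>_up b = b" using True by (auto simp: \<beta>_up_def \<nu>_up_def)
    then have "lam \<sigma> = b * \<sigma>" unfolding lam_def by simp
    moreover have "lam_up b \<sigma> = \<sigma> / sqrt e" by (simp add: lam_up_def Let_def b)
    ultimately show ?thesis using b by (simp add: real_sqrt_divide)
  next
    case False
    then have ne1: "b \<noteq> sqrt (1 / e)" and less: "b < sqrt (1 / e) \<longleftrightarrow> b\<^sup>2 * e < 1"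
      using sqrt_bounds_iff[OF assms(1)] by auto
    define k where "k = k_up b"
    have k: "\<beta>_up b = 1 / k" "k \<noteq> 0" "c_up b = \<nu>_up b * k" "k < 0 \<longleftrightarrow> b < sqrt (1 / e)"
      using k_up_\<beta>_up[OF assms False] less by (auto simp: k_def)
    define R where "R = sqrt (1 + 2 * \<beta>_up b * \<nu>_up b * \<sigma>)"
    have "R - 1 = \<beta>_up b * lam \<sigma>" unfolding R_def using y_lam[OF \<sigma>] by simp
    then have "k * (R - 1) = k * \<beta>_up b * lam \<sigma>" by simp
    also have "k * \<beta>_up b = 1" using k(1,2) by simp
    finally have lam: "lam \<sigma> = k * (R - 1)" by simp
    have "2 * c_up b * \<sigma> + k\<^sup>2 = k\<^sup>2 * (1 + 2 * \<beta>_up b * \<nu>_up b * \<sigma>)"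
      using k by (simp add: power2_eq_square field_simps)
    \<comment> \<open>Given \<open>lam = k (R - 1)\<close>, the absolute value of \<open>k\<close>
      decides the sign in front of the root, hence the two branches of
      \<open>lam_up\<close>.\<close>
    then have root: "sqrt (2 * c_up b * \<sigma> + k\<^sup>2) = \<bar>k\<bar> * R" by (simp add: real_sqrt_mult R_def)
    show ?thesis
      using k(2,4) ne1 root by (cases "k < 0") (simp_all add: lam lam_up_def Let_def k_def[symmetric] algebra_simps)
  qed
  then show "lam_up b \<in> admissible" "I_fun (lam_up b) = q_up b" "J_fun (lam_up b) = J_up b"
    using candidate[of "lam_up b"] AB_up_values[OF assms] by simp_all
qed

text \<open>Here \<open>\<nu>\<close> would be infinite, so the values are computed directly:
  \<open>f f'\<close> is constantly \<open>1 / e\<close>, \<open>w\<close> is 1, and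
  \<open>f\<close> itself is the antiderivative for \<open>J_fun\<close>.\<close>

lemma lam_up_candidate_top:
  fixes b defines "b \<equiv> sqrt (2 / e)"
  shows "lam_up b \<in> admissible" "I_fun (lam_up b) = q_up b" "J_fun (lam_up b) = J_up b"
proof -
  have ge: "\<not> b < sqrt (1 / e)" "b \<noteq> sqrt (1 / e)" using sqrt_1_2_div_e by (auto simp: b_def)
  have b2: "b\<^sup>2 = 2 / e" by (simp add: b_def)
  then have "k_up b = 0" "c_up b = 1 / e" by (simp_all add: k_up_def c_up_def)
  then have lam: "lam_up b \<sigma> = sqrt (2 * \<sigma> / e)" for \<sigma> using ge by (simp add: lam_up_def Let_def)
  define f' where "f' \<sigma> = 1 / (e * lam_up b \<sigma>)" for \<sigma>
  have pos: "0 < lam_up b \<sigma>" if "\<sigma> \<in> {0<..<1} - {}" for \<sigma> using that by (simp add: lam)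
  have der: "(lam_up b has_real_derivative f' \<sigma>) (at \<sigma>)" if "\<sigma> \<in> {0<..<1} - {}" for \<sigma>
  proof -
    have "((\<lambda>\<sigma>. sqrt (2 * \<sigma> / e)) has_real_derivative f' \<sigma>) (at \<sigma>)"
      using that unfolding f'_def lam by (auto intro!: derivative_eq_intros simp: field_simps)
    then show ?thesis by (simp add: lam[abs_def])
  qed
  have prod: "lam_up b \<sigma> * f' \<sigma> = 1 / e" if "\<sigma> \<in> {0<..<1} - {}" for \<sigma>
    using pos[OF that] by (simp add: f'_def)
  have cont: "continuous_on {0..1} (lam_up b)" unfolding lam[abs_def] by (intro continuous_intros) auto
  have dJ: "(lam_up b has_real_derivative - (f' \<sigma> * ln (lam_up b \<sigma> * f' \<sigma>))) (at \<sigma>)"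
    and dI: "((\<lambda>\<sigma>. \<sigma> / e) has_real_derivative - (lam_up b \<sigma> * f' \<sigma> * ln (lam_up b \<sigma> * f' \<sigma>))) (at \<sigma>)"
    if "\<sigma> \<in> {0<..<1} - {}" for \<sigma>
    using der[OF that] unfolding prod[OF that] by (auto simp: ln_div intro!: derivative_eq_intros)
  have f'_nonneg: "0 \<le> f' \<sigma>" and le1: "lam_up b \<sigma> * f' \<sigma> \<le> 1" if "\<sigma> \<in> {0<..<1} - {}" for \<sigma>
    using pos[OF that] prod[OF that] by (auto simp: f'_def)
  have lam0: "lam_up b 0 = 0" by (simp add: lam)
  have cI: "continuous_on {0..1} (\<lambda>\<sigma>. \<sigma> / e)" by (intro continuous_intros) auto
  note explicit = admissible_explicit[OF finite.emptyI cont lam0 der f'_nonneg pos le1 cont dJ cI dI]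
  show "lam_up b \<in> admissible" by (rule explicit(1))
  have q: "q_up b = 1 / e" and J: "J_up b = 2 / sqrt e"
    using ge(2) by (auto simp: q_up_def J_up_def q_max_def b_def)
  show "I_fun (lam_up b) = q_up b" using explicit(3) by (simp add: q)
  have "lam_up b 1 = sqrt 2 / sqrt e" by (simp add: lam real_sqrt_divide)
  then show "J_fun (lam_up b) = J_up b" using explicit(2) by (simp add: J lam0)
qed

lemma J_up_ge:
  assumes "0 < b" "b\<^sup>2 * e < 2" and f: "f \<in> level (q_up b)"
  shows "J_fun f \<le> J_up b"
proof -
  interpret up_params "\<beta>_up b" "\<nu>_up b" b by (rule up_instance[OF assms(1,2)])
  have "f \<in> admissible" "I_fun f = q_up b" using f by (auto simp: level_def)
  then have "J_fun f / sqrt 2 \<le> A_up (\<beta>_up b) (\<nu>_up b) b"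
    using upper_bound[of f] by (simp add: AB_up_values(2)[OF assms(1,2)])
  then have "J_fun f \<le> sqrt 2 * A_up (\<beta>_up b) (\<nu>_up b) b" by (simp add: divide_le_eq mult.commute)
  then show ?thesis by (simp add: AB_up_values(1)[OF assms(1,2)])
qed

text \<open>At \<open>q_max\<close> the multiplier is infinite; the bound is the limit of the bounds for the
  parameters \<open>b' < sqrt (2 / e)\<close>, whose multipliers are positive there.\<close>

lemma J_up_ge_top:
  assumes f: "f \<in> level q_max"
  shows "J_fun f \<le> 2 / sqrt e"
proof (rule tendsto_lowerbound[OF up_formula_limits(5)])
  have "\<forall>\<^sub>F b in at_left (sqrt (2 / e)). b \<in> {sqrt (1 / e)<..<sqrt (2 / e)}"
    by (rule eventually_at_left_real[OF sqrt_1_2_div_e])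
  then show "\<forall>\<^sub>F b in at_left (sqrt (2 / e)). J_fun f \<le> J_up_formula b"
  proof eventually_elim
    case (elim b)
    have "0 < sqrt (1 / e)" by simp
    then have b: "0 < b" using elim by (auto simp del: real_sqrt_gt_0_iff)
    then have s: "1 < b\<^sup>2 * e" "b\<^sup>2 * e < 2" using elim sqrt_bounds_iff[OF b] by auto
    interpret up_params "\<beta>_up b" "\<nu>_up b" b by (rule up_instance[OF b s(2)])
    have "q_up b \<in> q_up ` {0<..sqrt (2 / e)}" using b elim by auto
    then have "q_up b \<le> q_max" unfolding q_up_images by simp
    moreover have "0 < \<beta>_up b" using b s by (simp add: \<beta>_up_def)
    \<comment> \<open>Since \<open>q_up b\<close> is at most \<open>I_fun f = q_max\<close>, a
      positive multiplier lets both terms cancel in the favourable direction.\<close>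
    ultimately have "\<beta>_up b * q_up b \<le> \<beta>_up b * q_max" by simp
    moreover have "f \<in> admissible" "I_fun f = q_max" using f by (auto simp: level_def)
    ultimately have "J_fun f / sqrt 2 \<le> A_up (\<beta>_up b) (\<nu>_up b) b"
      using upper_bound[of f] by (simp add: AB_up_values(2)[OF b s(2)])
    then have "J_fun f \<le> sqrt 2 * A_up (\<beta>_up b) (\<nu>_up b) b" by (simp add: divide_le_eq mult.commute)
    also have "\<dots> = J_up b" by (rule AB_up_values(1)[OF b s(2)])
    also have "\<dots> = J_up_formula b" using elim by (simp add: J_up_def)
    finally show ?case .
  qed
qed simp

lemma lam_up_optimal:
  assumes "b \<in> {0<..sqrt (2 / e)}"
  shows "lam_up b \<in> level (q_up b)" "J_fun (lam_up b) = J_up b"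
    "\<And>f. f \<in> level (q_up b) \<Longrightarrow> J_fun f \<le> J_up b"
proof -
  have "lam_up b \<in> level (q_up b) \<and> J_fun (lam_up b) = J_up b \<and> (\<forall>f\<in>level (q_up b). J_fun f \<le> J_up b)"
  proof (cases "b = sqrt (2 / e)")
    case True
    have "q_up b = q_max" "J_up b = 2 / sqrt e"
      using True sqrt_1_2_div_e by (auto simp: q_up_def J_up_def)
    then show ?thesis
      using lam_up_candidate_top J_up_ge_top unfolding True by (simp add: level_def)
  next
    case False
    then have b: "0 < b" "b\<^sup>2 * e < 2" using assms sqrt_bounds_iff(1)[of b 2] by auto
    show ?thesis using lam_up_candidate[OF b] J_up_ge[OF b] by (simp add: level_def)
  qed
  then show "lam_up b \<in> level (q_up b)" "J_fun (lam_up b) = J_up b"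
    "\<And>f. f \<in> level (q_up b) \<Longrightarrow> J_fun f \<le> J_up b" by auto
qed

lemma J_max_eq:
  assumes "g \<in> level q" "\<And>f. f \<in> level q \<Longrightarrow> J_fun f \<le> J_fun g"
  shows "J_max q = J_fun g" "is_arg_max J_fun (\<lambda>f. f \<in> level q) g"
  using assms by (auto simp: J_max_def is_arg_max_def not_less intro!: Greatest_equality)

lemma J_min_eq:
  assumes "g \<in> level q" "\<And>f. f \<in> level q \<Longrightarrow> J_fun g \<le> J_fun f"
  shows "J_min q = J_fun g" "is_arg_min J_fun (\<lambda>f. f \<in> level q) g"
  using assms by (auto simp: J_min_def is_arg_min_def not_less intro!: Least_equality)

theorem theorem1:
  shows
    "q_lo ` {sqrt (2 / e)<..<sqrt 2} = {0<..<q_max} \<and>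
     (\<forall>b\<in>{sqrt (2 / e)<..<sqrt 2}.
        J_min (q_lo b) = J_lo b \<and>
        is_arg_min J_fun (\<lambda>f. f \<in> level (q_lo b)) (lam_lo b) \<and>
        J_fun (lam_lo b) = J_min (q_lo b)) \<and>
     (q_up_formula \<longlongrightarrow> q_star) (at (sqrt (1 / e))) \<and>
     (J_up_formula \<longlongrightarrow> 2 * sqrt (2 / e)) (at (sqrt (1 / e))) \<and>
     (q_up_formula \<longlongrightarrow> q_max) (at_left (sqrt (2 / e))) \<and>
     (J_up_formula \<longlongrightarrow> 2 / sqrt e) (at_left (sqrt (2 / e))) \<and>
     q_up ` {0<..sqrt (2 / e)} = {0<..q_max} \<and>
     q_up ` {0<..<sqrt (1 / e)} = {0<..<q_star} \<and>
     q_up ` {sqrt (1 / e)<..sqrt (2 / e)} = {q_star<..q_max} \<and>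
     (\<forall>b\<in>{0<..sqrt (2 / e)}.
        J_max (q_up b) = J_up b \<and>
        is_arg_max J_fun (\<lambda>f. f \<in> level (q_up b)) (lam_up b) \<and>
        J_fun (lam_up b) = J_max (q_up b))"
proof (intro conjI ballI)
  fix b assume "b \<in> {sqrt (2 / e)<..<sqrt 2}"
  then have b: "sqrt (2 / e) < b" "b < sqrt 2" by auto
  have lam: "lam_lo b \<in> level (q_lo b)" "J_fun (lam_lo b) = J_lo b"
    using lam_lo_candidate[OF b] by (auto simp: level_def)
  have opt: "J_fun (lam_lo b) \<le> J_fun f" if "f \<in> level (q_lo b)" for f
    using J_lo_le[OF b that] lam(2) by simp
  note min = J_min_eq[OF lam(1) opt]
  show "J_min (q_lo b) = J_lo b" using min(1) lam(2) by simp
  show "is_arg_min J_fun (\<lambda>f. f \<in> level (q_lo b)) (lam_lo b)" by (rule min(2))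
  show "J_fun (lam_lo b) = J_min (q_lo b)" using min(1) by simp
next
  fix b assume b: "b \<in> {0<..sqrt (2 / e)}"
  note lam = lam_up_optimal[OF b]
  have opt: "J_fun f \<le> J_fun (lam_up b)" if "f \<in> level (q_up b)" for f
    using lam(3)[OF that] lam(2) by simp
  note max = J_max_eq[OF lam(1) opt]
  show "J_max (q_up b) = J_up b" using max(1) lam(2) by simp
  show "is_arg_max J_fun (\<lambda>f. f \<in> level (q_up b)) (lam_up b)" by (rule max(2))
  show "J_fun (lam_up b) = J_max (q_up b)" using max(1) by simp
qed (rule q_lo_image up_formula_limits q_up_images)+

end
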